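(* For $q\in L^2(Q)$ let $p=p(q)$ be the solution of $$\frac{\partial p}{\partial t}+\nu\Delta p-a_0p=-q\ \text{ in }\Omega\times(0,T),\qquad p=0\ \text{ on }\Gamma\times(0,T),\qquad p(T)=0,$$ and set $$J(q)=\langle p,\operatorname{Pr}_{\mathcal{C}}(\tfrac{p}{\gamma})\rangle_{L^2(\mathcal{O})}-\frac{\gamma}{2}\|\operatorname{Pr}_{\mathcal{C}}(\tfrac{p}{\gamma})\|^2_{L^2(\mathcal{O})}-\langle q,y_d\rangle_{L^2(Q)}+\frac12\|q\|^2_{L^2(Q)}.$$ Then there exists a unique $\bar q\in L^2(Q)$ such that $J(\bar q)\le J(q)$ for all $q\in L^2(Q)$.
   Context: $\Omega\subset\mathbb{R}^n$ is a domain with piecewise continuous boundary $\Gamma=\partial\Omega$, $0<T<\infty$, $Q=\Omega\times(0,T)$, $O\subset\Omega$ is open and $\mathcal{O}=O\times(0,T)$. $\nu>0$ and $\gamma>0$ are constants, $a_0\in L^\infty(Q)$ with $a_0\ge 0$, $y_d\in L^2(Q)$, and $a\le 0\le b$ are real constants. The set $\mathcal{C}=\{u\in L^2(\mathcal{O}) : a\le u(x,t)\le b \text{ a.e. in } \mathcal{O}\}$, and $\operatorname{Pr}_{\mathcal{C}}(v)(x,t)=\min\{b,\max\{a,v(x,t)\}\}$ is the projection onto $\mathcal{C}$. Terms on $\mathcal{O}$ involving $p$ use the restriction of $p$ to $\mathcal{O}$. Solutions of the (backward) parabolic equation are understood in the usual weak sense with homogeneous Dirichlet boundary condition. *)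

theory Defs
  imports "HOL-Analysis.Analysis"
begin

text \<open>
  The elements are functions, not equivalence classes: equality in \<open>L\<^sup>2\<close> has to be read
  as equality almost everywhere. The measures used below are Lebesgue measures
  \<open>lebesgue_on S\<close> on open sets \<open>S\<close>.
\<close>

definition L2 :: "'a measure \<Rightarrow> ('a \<Rightarrow> 'b::euclidean_space) set" where
  "L2 M = {f. f \<in> borel_measurable M \<and> integrable M (\<lambda>z. (norm (f z))\<^sup>2)}"

definition L2_inner :: "'a measure \<Rightarrow> ('a \<Rightarrow> 'b::euclidean_space) \<Rightarrow> ('a \<Rightarrow> 'b) \<Rightarrow> real" where
  "L2_inner M f g = (LINT z|M. f z \<bullet> g z)"

definition L2_norm :: "'a measure \<Rightarrow> ('a \<Rightarrow> 'b::euclidean_space) \<Rightarrow> real" where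
  "L2_norm M f = sqrt (LINT z|M. (norm (f z))\<^sup>2)"

definition Linfty :: "'a measure \<Rightarrow> ('a \<Rightarrow> real) set" where
  "Linfty M = {f. f \<in> borel_measurable M \<and> (\<exists>B. AE z in M. \<bar>f z\<bar> \<le> B)}"

definition cylinder :: "'a set \<Rightarrow> real \<Rightarrow> ('a \<times> real) set" where
  "cylinder S T = S \<times> {0<..<T}"

text \<open>A continuous hypersurface piece: the graph, in the direction of some unit vector \<open>e\<close>, of a
  continuous function over a compact subset of the hyperplane orthogonal to \<open>e\<close>.\<close>

definition continuous_graph_piece :: "'a::euclidean_space set \<Rightarrow> bool" where
  "continuous_graph_piece S \<longleftrightarrow>
     (\<exists>e D (g :: 'a \<Rightarrow> real). norm e = 1 \<and> compact D \<and> (\<forall>x\<in>D. x \<bullet> e = 0) \<and>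
        continuous_on D g \<and> S = (\<lambda>x. x + g x *\<^sub>R e) ` D)"

text \<open>The boundary consists, locally, of finitely many continuous pieces, which may have
  different directions. For a bounded set this amounts to finitely many pieces altogether.\<close>

definition piecewise_continuous_boundary :: "'a::euclidean_space set \<Rightarrow> bool" where
  "piecewise_continuous_boundary S \<longleftrightarrow>
     (\<forall>x\<in>frontier S. \<exists>r>0. \<exists>F. finite F \<and> (\<forall>P\<in>F. continuous_graph_piece P) \<and>
        frontier S \<inter> cball x r = \<Union>F)"

primrec C_k :: "nat \<Rightarrow> ('a::euclidean_space \<Rightarrow> real) \<Rightarrow> bool" where
  "C_k 0 f \<longleftrightarrow> continuous_on UNIV f"
| "C_k (Suc k) f \<longleftrightarrow> (\<forall>z. f differentiable (at z)) \<and>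
     (\<forall>b\<in>Basis. C_k k (\<lambda>z. frechet_derivative f (at z) b))"

definition C_infinity :: "('a::euclidean_space \<Rightarrow> real) \<Rightarrow> bool" where
  "C_infinity f \<longleftrightarrow> (\<forall>k. C_k k f)"

definition space_grad :: "((real^'n) \<times> real \<Rightarrow> real) \<Rightarrow> (real^'n) \<times> real \<Rightarrow> real^'n" where
  "space_grad f z = (\<chi> i. frechet_derivative f (at z) (axis i 1, 0))"

definition time_deriv :: "((real^'n) \<times> real \<Rightarrow> real) \<Rightarrow> (real^'n) \<times> real \<Rightarrow> real" where
  "time_deriv f z = frechet_derivative f (at z) (0, 1)"

text \<open>Smooth functions of \<open>(x, t)\<close> that vanish near the lateral boundary \<open>\<Gamma> \<times> [0, T]\<close> (and for large
  \<open>x\<close>, if \<open>\<Omega>\<close> is unbounded). Nothing is required at \<open>t = 0\<close> and \<open>t = T\<close>.\<close>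

definition lateral_test :: "(real^'n) set \<Rightarrow> ((real^'n) \<times> real \<Rightarrow> real) set" where
  "lateral_test \<Omega> = {\<phi>. C_infinity \<phi> \<and>
     (\<exists>K. compact K \<and> K \<subseteq> \<Omega> \<and> (\<forall>x t. x \<notin> K \<longrightarrow> \<phi> (x, t) = 0))}"

text \<open>
  The space \<open>L\<^sup>2(0, T; H\<^sup>1\<^sub>0(\<Omega>))\<close>, as the closure of the smooth functions vanishing near
  \<open>\<Gamma> \<times> [0, T]\<close> in the norm \<open>(\<parallel>p\<parallel>\<^sup>2 + \<parallel>\<nabla>p\<parallel>\<^sup>2)\<^sup>1\<^sup>/\<^sup>2\<close> of \<open>L\<^sup>2(Q)\<close>, where \<open>\<nabla>\<close> is the gradient in
  \<open>x\<close> only. This is how the homogeneous Dirichlet condition enters. The predicate relates \<open>p\<close> to its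
  weak spatial gradient \<open>g\<close>, which the approximation determines up to null sets.
\<close>

definition L2_H10 ::
  "(real^'n) set \<Rightarrow> real \<Rightarrow> ((real^'n) \<times> real \<Rightarrow> real) \<Rightarrow> ((real^'n) \<times> real \<Rightarrow> real^'n) \<Rightarrow> bool" where
  "L2_H10 \<Omega> T p g \<longleftrightarrow>
     (let Q = lebesgue_on (cylinder \<Omega> T) in
      p \<in> L2 Q \<and> g \<in> L2 Q \<and>
      (\<exists>\<phi>. (\<forall>k::nat. \<phi> k \<in> lateral_test \<Omega>) \<and>
         (\<lambda>k. L2_norm Q (\<lambda>z. \<phi> k z - p z)) \<longlonglongrightarrow> 0 \<and>
         (\<lambda>k. L2_norm Q (\<lambda>z. space_grad (\<phi> k) z - g z)) \<longlonglongrightarrow> 0))"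

text \<open>
  Weak solutions of \<open>p\<^sub>t + \<nu> \<Delta>p - a\<^sub>0 p = -q\<close> in \<open>Q\<close>, \<open>p = 0\<close> on \<open>\<Gamma> \<times> (0, T)\<close>, \<open>p(T) = 0\<close>. The identity
  is the equation multiplied by \<open>-\<phi>\<close> and integrated by parts in \<open>x\<close> and \<open>t\<close>. The boundary
  term at \<open>t = 0\<close> vanishes because \<open>\<phi>(0) = 0\<close>; the one at \<open>t = T\<close> vanishes because \<open>p(T) = 0\<close>, and
  since \<open>\<phi>(T)\<close> is arbitrary this is how the identity encodes the terminal condition.
\<close>

definition weak_solution ::
  "(real^'n) set \<Rightarrow> real \<Rightarrow> real \<Rightarrow> ((real^'n) \<times> real \<Rightarrow> real) \<Rightarrow> ((real^'n) \<times> real \<Rightarrow> real) \<Rightarrow>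
   ((real^'n) \<times> real \<Rightarrow> real) \<Rightarrow> bool" where
  "weak_solution \<Omega> T \<nu> a0 q p \<longleftrightarrow>
     (let Q = lebesgue_on (cylinder \<Omega> T) in
      \<exists>g. L2_H10 \<Omega> T p g \<and>
        (\<forall>\<phi>\<in>lateral_test \<Omega>. (\<forall>x. \<phi> (x, 0) = 0) \<longrightarrow>
           (LINT z|Q. p z * time_deriv \<phi> z + \<nu> * (g z \<bullet> space_grad \<phi> z) + a0 z * p z * \<phi> z)
             = (LINT z|Q. q z * \<phi> z)))"

text \<open>The solution \<open>p(q)\<close>. Uniqueness holds only up to null sets, hence \<open>SOME\<close> instead of \<open>THE\<close>.\<close>

definition adjoint_state ::
  "(real^'n) set \<Rightarrow> real \<Rightarrow> real \<Rightarrow> ((real^'n) \<times> real \<Rightarrow> real) \<Rightarrow> ((real^'n) \<times> real \<Rightarrow> real) \<Rightarrow>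
   (real^'n) \<times> real \<Rightarrow> real" where
  "adjoint_state \<Omega> T \<nu> a0 q = (SOME p. weak_solution \<Omega> T \<nu> a0 q p)"

definition admissible :: "'a measure \<Rightarrow> real \<Rightarrow> real \<Rightarrow> ('a \<Rightarrow> real) set" where
  "admissible M a b = {u \<in> L2 M. AE z in M. a \<le> u z \<and> u z \<le> b}"

definition Pr_C :: "real \<Rightarrow> real \<Rightarrow> ('a \<Rightarrow> real) \<Rightarrow> 'a \<Rightarrow> real" where
  "Pr_C a b v = (\<lambda>z. min b (max a (v z)))"

text \<open>As \<open>a \<le> 0 \<le> b\<close>, this truncation is the \<open>L\<^sup>2\<close> projection onto the admissible set, also if the
  measure is infinite.\<close>

lemma Pr_C_admissible:
  assumes "a \<le> 0" "0 \<le> b" "v \<in> L2 M"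
  shows "Pr_C a b v \<in> admissible M a b"
proof -
  have m: "v \<in> borel_measurable M" and i: "integrable M (\<lambda>z. (norm (v z))\<^sup>2)"
    using assms(3) by (auto simp: L2_def)
  have m': "Pr_C a b v \<in> borel_measurable M"
    using m unfolding Pr_C_def by measurable
  have "integrable M (\<lambda>z. (norm (Pr_C a b v z))\<^sup>2)"
  proof (rule Bochner_Integration.integrable_bound[OF i])
    show "(\<lambda>z. (norm (Pr_C a b v z))\<^sup>2) \<in> borel_measurable M"
      using m' by measurable
    have "\<bar>min b (max a x)\<bar> \<le> \<bar>x\<bar>" for x :: real
      using assms(1,2) by (auto simp: min_def max_def abs_if)
    then show "AE z in M. norm ((norm (Pr_C a b v z))\<^sup>2) \<le> norm ((norm (v z))\<^sup>2)"
      by (simp add: Pr_C_def flip: abs_le_square_iff)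
  qed
  then show ?thesis
    using m' assms(1,2) by (auto simp: admissible_def L2_def Pr_C_def)
qed

lemma Pr_C_closest:
  assumes "v \<in> L2 M" "u \<in> admissible M a b"
  shows "L2_norm M (\<lambda>z. v z - Pr_C a b v z) \<le> L2_norm M (\<lambda>z. v z - u z)"
proof -
  have m: "v \<in> borel_measurable M" "u \<in> borel_measurable M"
    and i: "integrable M (\<lambda>z. (v z)\<^sup>2)" "integrable M (\<lambda>z. (u z)\<^sup>2)"
    and ae: "AE z in M. a \<le> u z \<and> u z \<le> b"
    using assms by (auto simp: L2_def admissible_def)
  have "integrable M (\<lambda>z. 2 * (v z)\<^sup>2 + 2 * (u z)\<^sup>2)"
    using i by simp
  then have int: "integrable M (\<lambda>z. (v z - u z)\<^sup>2)"
  proof (rule Bochner_Integration.integrable_bound)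
    show "(\<lambda>z. (v z - u z)\<^sup>2) \<in> borel_measurable M"
      using m by measurable
    have "(x - y)\<^sup>2 \<le> 2 * x\<^sup>2 + 2 * y\<^sup>2" for x y :: real
      using zero_le_power2[of "x + y"] by (simp add: power2_eq_square algebra_simps)
    then show "AE z in M. norm ((v z - u z)\<^sup>2) \<le> norm (2 * (v z)\<^sup>2 + 2 * (u z)\<^sup>2)"
      by simp
  qed
  have "(LINT z|M. (v z - Pr_C a b v z)\<^sup>2) \<le> (LINT z|M. (v z - u z)\<^sup>2)"
  proof (rule integral_mono_AE')
    show "AE z in M. (v z - Pr_C a b v z)\<^sup>2 \<le> (v z - u z)\<^sup>2"
      using ae
    proof eventually_elim
      case (elim z)
      then have "\<bar>v z - Pr_C a b v z\<bar> \<le> \<bar>v z - u z\<bar>"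
        by (auto simp: Pr_C_def min_def max_def abs_if)
      then show ?case
        by (simp add: abs_le_square_iff)
    qed
  qed (use int in auto)
  then show ?thesis
    by (simp add: L2_norm_def)
qed

definition dual_cost ::
  "(real^'n) set \<Rightarrow> (real^'n) set \<Rightarrow> real \<Rightarrow> real \<Rightarrow> real \<Rightarrow> real \<Rightarrow> real \<Rightarrow>
   ((real^'n) \<times> real \<Rightarrow> real) \<Rightarrow> ((real^'n) \<times> real \<Rightarrow> real) \<Rightarrow> ((real^'n) \<times> real \<Rightarrow> real) \<Rightarrow> real" where
  "dual_cost \<Omega> \<O> T \<nu> \<gamma> a b a0 y\<^sub>d q =
     (let Q = lebesgue_on (cylinder \<Omega> T);
          QO = lebesgue_on (cylinder \<O> T);
          p = adjoint_state \<Omega> T \<nu> a0 q;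
          u = Pr_C a b (\<lambda>z. p z / \<gamma>)
      in L2_inner QO p u - \<gamma> / 2 * (L2_norm QO u)\<^sup>2 - L2_inner Q q y\<^sub>d + 1 / 2 * (L2_norm Q q)\<^sup>2)"

end

theory Submission
  imports Defs
begin

text \<open>
  A weak solution \<open>p\<close> exists by Lions' projection theorem: pairing a test function \<open>\<phi>\<close> that vanishes
  at \<open>t = 0\<close> with \<open>exp (-t) \<phi>\<close> gives coercivity of the adjoint form. Testing the weak formulation with
  \<open>P (x, t) = \<integral>\<^sub>0\<^sup>t exp (\<lambda>s) \<phi> (x, s) ds\<close>, where \<open>\<phi>\<close> approximates \<open>p\<close> itself and \<open>\<lambda>\<close> is large compared
  with \<open>a\<^sub>0\<close>, yields \<open>\<parallel>p\<parallel> \<le> C \<parallel>q\<parallel>\<close>. Hence \<open>q \<mapsto> p(q)\<close> is well defined almost everywhere, linear and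
  bounded. The first two terms of \<open>J\<close> are the integral of \<open>max {p u - \<gamma> u\<^sup>2 / 2 | a \<le> u \<le> b} \<ge> 0\<close>, a convex
  continuous functional of \<open>p\<close>. So \<open>J\<close> is continuous and bounded below, and the term \<open>\<parallel>q\<parallel>\<^sup>2 / 2\<close> makes it
  strongly convex: minimizing sequences are Cauchy in \<open>L\<^sup>2(Q)\<close> and the minimizer is unique.
\<close>

section \<open>The space \<open>L\<^sup>2\<close>\<close>

text \<open>The obstacle is how little is known of a weak solution. It lies in the closure of the
  test functions in the norm of value and spatial gradient, with no time derivative in L2 and no
  values at single times given, so it cannot be used as a test function in its own equation;
  besides, test functions must vanish at \<open>t = 0\<close>. Integration in time repairs both
  defects: the primitive of an approximation vanishes at \<open>t = 0\<close>, and its time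
  derivative returns the approximation. It commutes with the gradient in \<open>x\<close>, so the
  diffusion term integrates to a sum of nonnegative terms. Differentiating an exponentially weighted
  square produces a term without derivatives and of definite sign: in the existence proof it stands
  in for a Poincare inequality, which an unbounded domain may lack, and in the a priori bound it
  absorbs the potential. A second difficulty is that elements are functions and \<open>p(q)\<close>
  is an arbitrary choice among the weak solutions. Linearity of \<open>q \<mapsto> p(q)\<close>
  holds only up to null sets and is therefore expressed through L2 norms of differences.\<close>

lemma L2_measurable: "f \<in> L2 M \<Longrightarrow> f \<in> borel_measurable M"
  by (simp add: L2_def)

lemma L2_integrable_sq: "f \<in> L2 M \<Longrightarrow> integrable M (\<lambda>z. (norm (f z))\<^sup>2)"
  by (simp add: L2_def)

lemma L2_inner_integrable:
  assumes "f \<in> L2 M" "g \<in> L2 M"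
  shows "integrable M (\<lambda>z. f z \<bullet> g z)"
proof (rule Bochner_Integration.integrable_bound)
  show "integrable M (\<lambda>z. (norm (f z))\<^sup>2 + (norm (g z))\<^sup>2)"
    using assms by (intro Bochner_Integration.integrable_add L2_integrable_sq)
  show "(\<lambda>z. f z \<bullet> g z) \<in> borel_measurable M"
    using assms[THEN L2_measurable] by measurable
  have "\<bar>x \<bullet> y\<bar> \<le> (norm x)\<^sup>2 + (norm y)\<^sup>2" for x y :: 'b
  proof -
    have "\<bar>x \<bullet> y\<bar> \<le> norm x * norm y" by (rule Cauchy_Schwarz_ineq2)
    also have "\<dots> \<le> (norm x)\<^sup>2 + (norm y)\<^sup>2"
      using sum_squares_bound[of "norm x" "norm y"] mult_nonneg_nonneg[of "norm x" "norm y"]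
      unfolding mult.assoc using norm_ge_zero by (smt (verit, best))
    finally show ?thesis .
  qed
  then show "AE z in M. norm (f z \<bullet> g z) \<le> norm ((norm (f z))\<^sup>2 + (norm (g z))\<^sup>2)"
    by simp
qed

lemma L2_mult_integrable:
  fixes f g :: "'a \<Rightarrow> real"
  assumes "f \<in> L2 M" "g \<in> L2 M"
  shows "integrable M (\<lambda>z. f z * g z)"
  using L2_inner_integrable[OF assms] by simp

lemma L2_bounded_by:
  assumes "f \<in> borel_measurable M" "h \<in> L2 M" "AE z in M. norm (f z) \<le> c * norm (h z)"
  shows "f \<in> L2 M"
proof -
  have "integrable M (\<lambda>z. (norm (f z))\<^sup>2)"
  proof (rule Bochner_Integration.integrable_bound)
    show "integrable M (\<lambda>z. c\<^sup>2 * (norm (h z))\<^sup>2)"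
      using L2_integrable_sq[OF assms(2)] by simp
    show "(\<lambda>z. (norm (f z))\<^sup>2) \<in> borel_measurable M"
      using assms(1) by measurable
    show "AE z in M. norm ((norm (f z))\<^sup>2) \<le> norm (c\<^sup>2 * (norm (h z))\<^sup>2)"
      using assms(3)
    proof eventually_elim
      case (elim z)
      then have "(norm (f z))\<^sup>2 \<le> (c * norm (h z))\<^sup>2" by (intro power_mono) auto
      then show ?case by (simp add: power_mult_distrib)
    qed
  qed
  with assms(1) show ?thesis by (simp add: L2_def)
qed

lemma L2_scaleR: "f \<in> L2 M \<Longrightarrow> (\<lambda>z. c *\<^sub>R f z) \<in> L2 M"
  using L2_bounded_by[of "\<lambda>z. c *\<^sub>R f z" M f "\<bar>c\<bar>"] L2_measurable[of f M] by auto

lemma L2_add: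
  assumes "f \<in> L2 M" "g \<in> L2 M"
  shows "(\<lambda>z. f z + g z) \<in> L2 M"
proof -
  have "integrable M (\<lambda>z. (norm (f z))\<^sup>2 + (norm (g z))\<^sup>2 + 2 * (f z \<bullet> g z))"
    using assms by (intro Bochner_Integration.integrable_add Bochner_Integration.integrable_mult_right
        L2_integrable_sq L2_inner_integrable)
  moreover have "(norm (f z + g z))\<^sup>2 = (norm (f z))\<^sup>2 + (norm (g z))\<^sup>2 + 2 * (f z \<bullet> g z)" for z
    by (simp add: power2_norm_eq_inner algebra_simps inner_commute)
  ultimately show ?thesis
    using assms[THEN L2_measurable] by (simp add: L2_def)
qed

lemma L2_diff:
  assumes "f \<in> L2 M" "g \<in> L2 M"
  shows "(\<lambda>z. f z - g z) \<in> L2 M"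
  using L2_add[OF assms(1) L2_scaleR[OF assms(2), of "-1"]] by simp

lemma L2_inner_commute: "L2_inner M f g = L2_inner M g f"
  by (simp add: L2_inner_def inner_commute)

lemma L2_inner_add_left:
  assumes "f \<in> L2 M" "g \<in> L2 M" "h \<in> L2 M"
  shows "L2_inner M (\<lambda>z. f z + g z) h = L2_inner M f h + L2_inner M g h"
  using assms by (simp add: L2_inner_def inner_add_left L2_inner_integrable)

lemma L2_inner_diff_left:
  assumes "f \<in> L2 M" "g \<in> L2 M" "h \<in> L2 M"
  shows "L2_inner M (\<lambda>z. f z - g z) h = L2_inner M f h - L2_inner M g h"
  using assms by (simp add: L2_inner_def inner_diff_left L2_inner_integrable)

lemma L2_inner_scaleR_left: "L2_inner M (\<lambda>z. c *\<^sub>R f z) h = c * L2_inner M f h"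
  by (simp add: L2_inner_def)

lemma L2_inner_add_right:
  assumes "f \<in> L2 M" "g \<in> L2 M" "h \<in> L2 M"
  shows "L2_inner M h (\<lambda>z. f z + g z) = L2_inner M h f + L2_inner M h g"
  using L2_inner_add_left[OF assms] by (simp add: L2_inner_commute)

lemma L2_inner_diff_right:
  assumes "f \<in> L2 M" "g \<in> L2 M" "h \<in> L2 M"
  shows "L2_inner M h (\<lambda>z. f z - g z) = L2_inner M h f - L2_inner M h g"
  using L2_inner_diff_left[OF assms] by (simp add: L2_inner_commute)

lemma L2_inner_scaleR_right: "L2_inner M h (\<lambda>z. c *\<^sub>R f z) = c * L2_inner M h f"
  by (simp add: L2_inner_def)

lemma L2_norm_nonneg: "0 \<le> L2_norm M f"
  by (simp add: L2_norm_def)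

lemma L2_norm_power2: "(L2_norm M f)\<^sup>2 = (LINT z|M. (norm (f z))\<^sup>2)"
  by (simp add: L2_norm_def)

lemma L2_norm_eq_inner: "(L2_norm M f)\<^sup>2 = L2_inner M f f"
  by (simp add: L2_norm_power2 L2_inner_def power2_norm_eq_inner)

lemma L2_norm_scaleR: "L2_norm M (\<lambda>z. c *\<^sub>R f z) = \<bar>c\<bar> * L2_norm M f"
  by (simp add: L2_norm_def power_mult_distrib real_sqrt_mult)

lemma L2_norm_minus_commute: "L2_norm M (\<lambda>z. f z - g z) = L2_norm M (\<lambda>z. g z - f z)"
  by (simp add: L2_norm_def norm_minus_commute)

lemma L2_norm_cong_AE:
  assumes "AE z in M. f z = g z" "f \<in> borel_measurable M" "g \<in> borel_measurable M"
  shows "L2_norm M f = L2_norm M g"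
  unfolding L2_norm_def using assms
  by (intro arg_cong[where f=sqrt] integral_cong_AE) auto

lemma L2_norm_add_power2:
  assumes "f \<in> L2 M" "g \<in> L2 M"
  shows "(L2_norm M (\<lambda>z. f z + g z))\<^sup>2 = (L2_norm M f)\<^sup>2 + 2 * L2_inner M f g + (L2_norm M g)\<^sup>2"
  using assms
  by (simp add: L2_norm_eq_inner L2_inner_add_left L2_inner_add_right L2_add L2_inner_commute[of M g f])

lemma L2_norm_diff_power2:
  assumes "f \<in> L2 M" "g \<in> L2 M"
  shows "(L2_norm M (\<lambda>z. f z - g z))\<^sup>2 = (L2_norm M f)\<^sup>2 - 2 * L2_inner M f g + (L2_norm M g)\<^sup>2"
  using assms
  by (simp add: L2_norm_eq_inner L2_inner_diff_left L2_inner_diff_right L2_diff L2_inner_commute[of M g f])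

text \<open>The polynomial \<open>t \<mapsto> ||f + t g||^2\<close> is nonnegative, and the claim is
  the sign of its discriminant.\<close>

lemma L2_Cauchy_Schwarz:
  assumes "f \<in> L2 M" "g \<in> L2 M"
  shows "\<bar>L2_inner M f g\<bar> \<le> L2_norm M f * L2_norm M g"
proof -
  let ?a = "(L2_norm M f)\<^sup>2" and ?b = "L2_inner M f g" and ?c = "(L2_norm M g)\<^sup>2"
  have q: "0 \<le> ?a + 2 * t * ?b + t\<^sup>2 * ?c" for t
    using L2_norm_add_power2[OF assms(1) L2_scaleR[OF assms(2), of t]] zero_le_power2[of "L2_norm M (\<lambda>z. f z + t *\<^sub>R g z)"]
    by (simp add: L2_inner_scaleR_right L2_norm_scaleR power_mult_distrib)
  have "?b\<^sup>2 \<le> ?a * ?c"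
  proof (cases "?c = 0")
    case True
    have "?b = 0"
    proof (rule ccontr)
      assume "?b \<noteq> 0"
      \<comment> \<open>With \<open>?c = 0\<close> the polynomial is affine in \<open>t\<close>, and
        at this \<open>t\<close> it takes the value -1.\<close>
      then show False using q[of "- (?a + 1) / (2 * ?b)"] True by (simp add: field_simps)
    qed
    then show ?thesis using True by simp
  next
    case False
    then have c: "?c > 0" by simp
    have "0 \<le> c * (A + 2 * (- B / c) * B + (- B / c)\<^sup>2 * c) \<Longrightarrow> 0 < c \<Longrightarrow> B\<^sup>2 \<le> A * c" for A B c :: real
      by (simp add: field_simps power2_eq_square)
    from this[of ?c ?a ?b] show ?thesis
      using q[of "- ?b / ?c"] c by (simp only: mult_nonneg_nonneg less_imp_le)
  qed
  then have "?b\<^sup>2 \<le> (L2_norm M f * L2_norm M g)\<^sup>2"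
    by (simp add: power_mult_distrib)
  then show ?thesis
    using abs_le_square_iff[of ?b "L2_norm M f * L2_norm M g"] by (simp add: L2_norm_nonneg)
qed

lemma L2_norm_triangle:
  assumes "f \<in> L2 M" "g \<in> L2 M"
  shows "L2_norm M (\<lambda>z. f z + g z) \<le> L2_norm M f + L2_norm M g"
proof (rule power2_le_imp_le)
  show "(L2_norm M (\<lambda>z. f z + g z))\<^sup>2 \<le> (L2_norm M f + L2_norm M g)\<^sup>2"
    using L2_norm_add_power2[OF assms] L2_Cauchy_Schwarz[OF assms]
    by (simp add: power2_sum)
qed (simp add: L2_norm_nonneg)

lemma L2_norm_triangle_diff:
  assumes "f \<in> L2 M" "g \<in> L2 M" "h \<in> L2 M"
  shows "L2_norm M (\<lambda>z. f z - h z) \<le> L2_norm M (\<lambda>z. f z - g z) + L2_norm M (\<lambda>z. g z - h z)"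
  using L2_norm_triangle[OF L2_diff[OF assms(1,2)] L2_diff[OF assms(2,3)]] by simp

lemma L2_norm_abs_diff:
  assumes "f \<in> L2 M" "g \<in> L2 M"
  shows "\<bar>L2_norm M f - L2_norm M g\<bar> \<le> L2_norm M (\<lambda>z. f z - g z)"
  using L2_norm_triangle[OF L2_diff[OF assms] assms(2)]
    L2_norm_triangle[OF L2_diff[OF assms(2,1)] assms(1)]
  by (simp add: L2_norm_minus_commute[of M g f])

lemma L2_norm_eq_0_AE:
  assumes "f \<in> L2 M" "L2_norm M f = 0"
  shows "AE z in M. f z = 0"
proof -
  have "(LINT z|M. (norm (f z))\<^sup>2) = 0"
    using assms(2) by (simp flip: L2_norm_power2)
  then have "AE z in M. (norm (f z))\<^sup>2 = 0"
    using integral_nonneg_eq_0_iff_AE[OF L2_integrable_sq[OF assms(1)]] by simp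
  then show ?thesis by simp
qed

lemma L2_norm_tendsto:
  assumes "\<And>n. f n \<in> L2 M" "g \<in> L2 M" "(\<lambda>n. L2_norm M (\<lambda>z. f n z - g z)) \<longlonglongrightarrow> 0"
  shows "(\<lambda>n. L2_norm M (f n)) \<longlonglongrightarrow> L2_norm M g"
proof (rule LIM_zero_cancel, rule Lim_null_comparison[OF _ assms(3)])
  show "\<forall>\<^sub>F n in sequentially. norm (L2_norm M (f n) - L2_norm M g) \<le> L2_norm M (\<lambda>z. f n z - g z)"
    using L2_norm_abs_diff[OF assms(1,2)] by simp
qed

lemma L2_inner_tendsto:
  assumes "\<And>n. f n \<in> L2 M" "g \<in> L2 M" "h \<in> L2 M" "(\<lambda>n. L2_norm M (\<lambda>z. f n z - g z)) \<longlonglongrightarrow> 0"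
  shows "(\<lambda>n. L2_inner M (f n) h) \<longlonglongrightarrow> L2_inner M g h"
proof (rule LIM_zero_cancel, rule Lim_null_comparison)
  show "\<forall>\<^sub>F n in sequentially. norm (L2_inner M (f n) h - L2_inner M g h)
      \<le> L2_norm M (\<lambda>z. f n z - g z) * L2_norm M h"
    using L2_Cauchy_Schwarz[OF L2_diff[OF assms(1,2)] assms(3)]
    by (simp add: L2_inner_diff_left assms)
  show "(\<lambda>n. L2_norm M (\<lambda>z. f n z - g z) * L2_norm M h) \<longlonglongrightarrow> 0"
    using tendsto_mult_left_zero[OF assms(4)] .
qed

text \<open>Along a subsequence with \<open>L\<^sup>2\<close> gaps at most \<open>2\<^sup>-\<^sup>k\<close> the weighted sum \<open>\<Sum>k. 2\<^sup>k\<bar>f\<^sub>k\<^sub>+\<^sub>1 - f\<^sub>k\<bar>\<^sup>2\<close>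
  is integrable, hence finite almost everywhere, and dominates a geometric series.\<close>

lemma L2_fast_Cauchy_AE_convergent:
  fixes f :: "nat \<Rightarrow> 'a \<Rightarrow> 'b::euclidean_space"
  assumes f: "\<And>n. f n \<in> L2 M"
    and fast: "\<And>k. L2_norm M (\<lambda>z. f (Suc k) z - f k z) \<le> (1/2)^k"
  shows "AE z in M. convergent (\<lambda>k. f k z)"
proof -
  define d where "d k z = (norm (f (Suc k) z - f k z))\<^sup>2" for k z
  have d_int: "integrable M (d k)" for k
    unfolding d_def by (intro L2_integrable_sq L2_diff f)
  have d_meas[measurable]: "d k \<in> borel_measurable M" for k
    using d_int by auto
  have "(\<integral>\<^sup>+z. (\<Sum>k. ennreal (2^k * d k z)) \<partial>M) = (\<Sum>k. \<integral>\<^sup>+z. ennreal (2^k * d k z) \<partial>M)"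
    by (rule nn_integral_suminf) measurable
  also have "\<dots> \<le> (\<Sum>k. ennreal ((1/2)^k))"
  proof (rule suminf_le)
    fix k
    have "(\<integral>\<^sup>+z. ennreal (2^k * d k z) \<partial>M) = ennreal (LINT z|M. 2^k * d k z)"
      by (rule nn_integral_eq_integral) (auto simp: d_int, auto simp: d_def)
    also have "(LINT z|M. 2^k * d k z) = 2^k * (L2_norm M (\<lambda>z. f (Suc k) z - f k z))\<^sup>2"
      by (simp add: L2_norm_power2 d_def)
    also have "\<dots> \<le> 2^k * ((1/2)^k)\<^sup>2"
      by (intro mult_left_mono power_mono fast) (auto simp: L2_norm_nonneg)
    \<comment> \<open>The squared gap decays like \<open>4^(-k)\<close>. The weight
      \<open>2^k\<close> spends half of that decay: a summable \<open>2^(-k)\<close> is left here,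
      and the pointwise gaps will still decay like \<open>2^(-k/2)\<close>.\<close>
    also have "\<dots> = (1/2)^k"
      by (simp add: power2_eq_square power_one_over field_simps)
    finally show "(\<integral>\<^sup>+z. ennreal (2^k * d k z) \<partial>M) \<le> ennreal ((1/2)^k)"
      by (simp add: ennreal_leI)
  qed auto
  also have "\<dots> < \<infinity>"
    by (subst suminf_ennreal2) (auto intro: summable_geometric)
  finally have "AE z in M. (\<Sum>k. ennreal (2^k * d k z)) \<noteq> \<infinity>"
    by (intro nn_integral_noteq_infinite) auto
  then show ?thesis
  proof eventually_elim
    case (elim z)
    then have s: "summable (\<lambda>k. 2^k * d k z)"
      by (intro summable_suminf_not_top) (auto simp: d_def)
    define S where "S = (\<Sum>k. 2^k * d k z)"
    have le: "2^k * d k z \<le> S" for k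
      unfolding S_def using sum_le_suminf[OF s, of "{k}"] by (auto simp: d_def)
    have "norm (f (Suc k) z - f k z) \<le> sqrt S * (sqrt (1/2))^k" for k
    proof -
      have "norm (f (Suc k) z - f k z) = sqrt (d k z)" by (simp add: d_def)
      also have "\<dots> \<le> sqrt (S * (1/2)^k)"
        using le[of k] by (intro real_sqrt_le_mono) (simp add: field_simps)
      finally show ?thesis by (simp add: real_sqrt_mult real_sqrt_power)
    qed
    then have "summable (\<lambda>k. f (Suc k) z - f k z)"
      by (intro summable_comparison_test'[OF summable_mult[OF summable_geometric], where N=0])
        (use real_sqrt_lt_1_iff[of "1/2"] in auto)
    then have "convergent (\<lambda>n. \<Sum>k<n. f (Suc k) z - f k z)"
      by (simp add: summable_iff_convergent)
    then have "convergent (\<lambda>n. (\<Sum>k<n. f (Suc k) z - f k z) + f 0 z)"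
      by (intro convergent_add convergent_const)
    then show ?case using sum_lessThan_telescope[of "\<lambda>k. f k z"] by simp
  qed
qed

text \<open>Riesz-Fischer. Fatou's lemma along the almost everywhere convergent subsequence carries
  the Cauchy bound for \<open>f n - f (r j)\<close> over to \<open>f n - g\<close>; this one bound
  gives both membership of \<open>g\<close> in \<open>L2\<close> and convergence of the whole
  sequence.\<close>

theorem L2_complete:
  fixes f :: "nat \<Rightarrow> 'a \<Rightarrow> 'b::euclidean_space"
  assumes f: "\<And>n. f n \<in> L2 M"
    and cauchy: "\<And>e. 0 < e \<Longrightarrow> \<exists>N. \<forall>m\<ge>N. \<forall>n\<ge>N. L2_norm M (\<lambda>z. f m z - f n z) \<le> e"
  obtains g where "g \<in> L2 M" "(\<lambda>n. L2_norm M (\<lambda>z. f n z - g z)) \<longlonglongrightarrow> 0"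
proof -
  have "\<exists>N. \<forall>k. \<forall>m\<ge>N k. \<forall>n\<ge>N k. L2_norm M (\<lambda>z. f m z - f n z) \<le> (1/2)^k"
    using cauchy[of "(1/2)^k" for k] by (intro choice) auto
  then obtain N where N: "\<And>k m n. m \<ge> N k \<Longrightarrow> n \<ge> N k \<Longrightarrow> L2_norm M (\<lambda>z. f m z - f n z) \<le> (1/2)^k"
    by blast
  \<comment> \<open>The sum makes \<open>r\<close> nondecreasing with \<open>r k \<ge> N k\<close>,
    as fast convergence requires; the summand \<open>k\<close> makes \<open>r\<close> unbounded, so
    that \<open>r j \<ge> N k\<close> for all late \<open>j\<close>.\<close>
  define r where "r k = (\<Sum>j\<le>k. N j) + k" for k
  have r_ge: "r k \<ge> N k" for k
    unfolding r_def using member_le_sum[of k "{..k}" N] by (simp add: trans_le_add1)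
  have r_Suc: "r (Suc k) \<ge> r k" for k by (simp add: r_def)
  have r_k: "r k \<ge> k" for k by (simp add: r_def)
  have conv: "AE z in M. convergent (\<lambda>k. f (r k) z)"
    by (rule L2_fast_Cauchy_AE_convergent) (auto intro!: f N order.trans[OF r_ge r_Suc] r_ge)
  \<comment> \<open>On the null set without a limit \<open>lim\<close> has an unspecified value;
    \<open>g\<close> is measurable all the same.\<close>
  define g where "g z = lim (\<lambda>k. f (r k) z)" for z
  have [measurable]: "f n \<in> borel_measurable M" for n using f by (rule L2_measurable)
  have [measurable]: "g \<in> borel_measurable M"
    unfolding g_def by (rule borel_measurable_lim_metric) simp
  have est: "(\<integral>\<^sup>+z. ennreal ((norm (f n z - g z))\<^sup>2) \<partial>M) \<le> ennreal (((1/2)^k)\<^sup>2)" if "n \<ge> N k" for n k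
  proof -
    have "(\<integral>\<^sup>+z. ennreal ((norm (f n z - g z))\<^sup>2) \<partial>M)
        = (\<integral>\<^sup>+z. liminf (\<lambda>j. ennreal ((norm (f n z - f (r j) z))\<^sup>2)) \<partial>M)"
    proof (rule nn_integral_cong_AE)
      show "AE z in M. ennreal ((norm (f n z - g z))\<^sup>2)
          = liminf (\<lambda>j. ennreal ((norm (f n z - f (r j) z))\<^sup>2))"
        using conv
      proof eventually_elim
        case (elim z)
        then have "(\<lambda>j. f (r j) z) \<longlonglongrightarrow> g z"
          unfolding g_def by (simp add: convergent_LIMSEQ_iff)
        then have "(\<lambda>j. ennreal ((norm (f n z - f (r j) z))\<^sup>2)) \<longlonglongrightarrow> ennreal ((norm (f n z - g z))\<^sup>2)"
          by (intro tendsto_intros)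
        then show ?case by (intro lim_imp_Liminf[symmetric]) auto
      qed
    qed
    also have "\<dots> \<le> liminf (\<lambda>j. \<integral>\<^sup>+z. ennreal ((norm (f n z - f (r j) z))\<^sup>2) \<partial>M)"
      by (rule nn_integral_liminf) measurable
    also have "\<dots> \<le> liminf (\<lambda>j. ennreal (((1/2)^k)\<^sup>2))"
    proof (rule Liminf_mono)
      show "\<forall>\<^sub>F j in sequentially. (\<integral>\<^sup>+z. ennreal ((norm (f n z - f (r j) z))\<^sup>2) \<partial>M) \<le> ennreal (((1/2)^k)\<^sup>2)"
        using eventually_ge_at_top[of "N k"]
      proof eventually_elim
        case (elim j)
        have "(\<integral>\<^sup>+z. ennreal ((norm (f n z - f (r j) z))\<^sup>2) \<partial>M) = ennreal ((L2_norm M (\<lambda>z. f n z - f (r j) z))\<^sup>2)"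
          unfolding L2_norm_power2
          by (rule nn_integral_eq_integral) (auto intro!: L2_integrable_sq L2_diff f)
        also have "\<dots> \<le> ennreal (((1/2)^k)\<^sup>2)"
          using that elim r_k[of j] by (intro ennreal_leI power_mono N) (auto simp: L2_norm_nonneg)
        finally show ?case .
      qed
    qed
    also have "\<dots> = ennreal (((1/2)^k)\<^sup>2)" by (simp add: Liminf_const)
    finally show ?thesis .
  qed
  have diff: "(\<lambda>z. f n z - g z) \<in> L2 M" if "n \<ge> N k" for n k
  proof -
    have "integrable M (\<lambda>z. (norm (f n z - g z))\<^sup>2)"
    proof (rule integrableI_nonneg)
      show "(\<integral>\<^sup>+z. ennreal ((norm (f n z - g z))\<^sup>2) \<partial>M) < \<infinity>"
        using est[OF that] by (rule order.strict_trans1) simp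
    qed auto
    then show ?thesis by (simp add: L2_def)
  qed
  have g: "g \<in> L2 M"
    using L2_diff[OF f[of "N 0"] diff[of 0 "N 0"]] by simp
  have bd: "L2_norm M (\<lambda>z. f n z - g z) \<le> (1/2)^k" if "n \<ge> N k" for n k
  proof -
    have "ennreal ((L2_norm M (\<lambda>z. f n z - g z))\<^sup>2) = (\<integral>\<^sup>+z. ennreal ((norm (f n z - g z))\<^sup>2) \<partial>M)"
      unfolding L2_norm_power2
      by (rule nn_integral_eq_integral[symmetric]) (auto intro!: L2_integrable_sq L2_diff f g)
    then have "ennreal ((L2_norm M (\<lambda>z. f n z - g z))\<^sup>2) \<le> ennreal (((1/2)^k)\<^sup>2)"
      using est[OF that] by (simp only:)
    then have "(L2_norm M (\<lambda>z. f n z - g z))\<^sup>2 \<le> ((1/2)^k)\<^sup>2"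
      by (subst (asm) ennreal_le_iff) simp_all
    then show ?thesis by (rule power2_le_imp_le) simp
  qed
  have "(\<lambda>n. L2_norm M (\<lambda>z. f n z - g z)) \<longlonglongrightarrow> 0"
  proof (rule LIMSEQ_I)
    fix e :: real assume "e > 0"
    then obtain k where k: "(1/2)^k < e" using real_arch_pow_inv[of e "1/2"] by auto
    then have "norm (L2_norm M (\<lambda>z. f n z - g z) - 0) < e" if "n \<ge> N k" for n
      using bd[OF that] by (simp add: L2_norm_nonneg)
    then show "\<exists>no. \<forall>n\<ge>no. norm (L2_norm M (\<lambda>z. f n z - g z) - 0) < e" by blast
  qed
  with g show thesis by (rule that)
qed

section \<open>Linear combinations, restrictions, pairs and bounded multipliers in L2\<close>

lemma L2_inner_lincomb_right:
  assumes "f \<in> L2 M" "g \<in> L2 M" "h \<in> L2 M"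
  shows "L2_inner M h (\<lambda>z. s *\<^sub>R f z + t *\<^sub>R g z) = s * L2_inner M h f + t * L2_inner M h g"
  using L2_inner_add_right[OF L2_scaleR[OF assms(1)] L2_scaleR[OF assms(2)] assms(3)]
  by (simp add: L2_inner_scaleR_right)

lemma L2_norm_lincomb_power2:
  assumes "f \<in> L2 M" "g \<in> L2 M"
  shows "(L2_norm M (\<lambda>z. s *\<^sub>R f z + t *\<^sub>R g z))\<^sup>2
    = s\<^sup>2 * (L2_norm M f)\<^sup>2 + 2 * s * t * L2_inner M f g + t\<^sup>2 * (L2_norm M g)\<^sup>2"
  using L2_norm_add_power2[OF L2_scaleR[OF assms(1), of s] L2_scaleR[OF assms(2), of t]]
  by (simp add: L2_norm_scaleR L2_inner_scaleR_left L2_inner_scaleR_right power_mult_distrib)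

lemma L2_norm_mono:
  assumes "f \<in> L2 M" "h \<in> L2 M" "AE z in M. norm (f z) \<le> norm (h z)"
  shows "L2_norm M f \<le> L2_norm M h"
  unfolding L2_norm_def
proof (intro real_sqrt_le_mono integral_mono_AE)
  show "AE z in M. (norm (f z))\<^sup>2 \<le> (norm (h z))\<^sup>2"
    using assms(3) by eventually_elim (simp add: power_mono)
qed (use assms(1,2)[THEN L2_integrable_sq] in auto)

lemma L2_norm_vec:
  fixes f :: "'a \<Rightarrow> real^'n"
  assumes "\<And>i. (\<lambda>z. f z $ i) \<in> L2 M"
  shows "(L2_norm M f)\<^sup>2 = (\<Sum>i\<in>UNIV. (L2_norm M (\<lambda>z. f z $ i))\<^sup>2)"
proof -
  have "(norm (f z))\<^sup>2 = (\<Sum>i\<in>UNIV. (norm (f z $ i))\<^sup>2)" for z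
    unfolding power2_norm_eq_inner inner_vec_def ..
  then show ?thesis
    using assms[THEN L2_integrable_sq] by (simp add: L2_norm_power2)
qed

lemma L2_lincomb:
  "f \<in> L2 M \<Longrightarrow> g \<in> L2 M \<Longrightarrow> (\<lambda>z. s * f z + t * g z) \<in> L2 M" for f g :: "'z \<Rightarrow> real"
  using L2_add[OF L2_scaleR[of f M s] L2_scaleR[of g M t]] by simp

lemma
  fixes f :: "'a::euclidean_space \<Rightarrow> 'b::euclidean_space"
  assumes f: "f \<in> L2 (lebesgue_on S)" and S: "S \<in> sets lebesgue" "R \<in> sets lebesgue" "R \<subseteq> S"
  shows L2_subset: "f \<in> L2 (lebesgue_on R)"
    and L2_norm_subset: "L2_norm (lebesgue_on R) f \<le> L2_norm (lebesgue_on S) f"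
proof -
  have s: "S \<inter> space lebesgue \<in> sets lebesgue" "R \<inter> space lebesgue \<in> sets lebesgue" using S by simp_all
  have i: "integrable lebesgue (\<lambda>z. indicator S z *\<^sub>R (norm (f z))\<^sup>2)"
    using L2_integrable_sq[OF f] unfolding integrable_restrict_space[OF s(1)] .
  have eq: "indicator R z *\<^sub>R (indicator S z *\<^sub>R (norm (f z))\<^sup>2) = indicator R z *\<^sub>R (norm (f z))\<^sup>2" for z
    using S(3) by (auto simp: indicator_def)
  have iR: "integrable lebesgue (\<lambda>z. indicator R z *\<^sub>R (norm (f z))\<^sup>2)"
    using integrable_mult_indicator[OF S(2) i] unfolding eq .
  show "f \<in> L2 (lebesgue_on R)"
    using measurable_restrict_mono[OF L2_measurable[OF f] S(3)] iR
    by (simp add: L2_def integrable_restrict_space[OF s(2)])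
  show "L2_norm (lebesgue_on R) f \<le> L2_norm (lebesgue_on S) f"
    unfolding L2_norm_def integral_restrict_space[OF s(1)] integral_restrict_space[OF s(2)]
    using S(3) by (intro real_sqrt_le_mono integral_mono[OF iR i]) (auto simp: indicator_def)
qed

lemma L2_Pair:
  assumes "f \<in> L2 M" "g \<in> L2 M"
  shows "(\<lambda>z. (f z, g z)) \<in> L2 M"
  using assms by (simp add: L2_def norm_Pair borel_measurable_Pair)

lemma L2_fst:
  fixes v :: "'a \<Rightarrow> 'b::euclidean_space \<times> 'c::euclidean_space"
  assumes "v \<in> L2 M"
  shows "(\<lambda>z. fst (v z)) \<in> L2 M"
proof (rule L2_bounded_by[OF _ assms, where c=1])
  have "continuous_on UNIV (fst :: 'b \<times> 'c \<Rightarrow> _)" by (intro continuous_intros)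
  then show "(\<lambda>z. fst (v z)) \<in> borel_measurable M"
    by (rule borel_measurable_continuous_on[OF _ L2_measurable[OF assms]])
  have "norm (fst (v z)) \<le> 1 * norm (v z)" for z
    by (cases "v z") (simp add: norm_fst_le)
  then show "AE z in M. norm (fst (v z)) \<le> 1 * norm (v z)" by (rule AE_I2)
qed

lemma L2_snd:
  fixes v :: "'a \<Rightarrow> 'b::euclidean_space \<times> 'c::euclidean_space"
  assumes "v \<in> L2 M"
  shows "(\<lambda>z. snd (v z)) \<in> L2 M"
proof (rule L2_bounded_by[OF _ assms, where c=1])
  have "continuous_on UNIV (snd :: 'b \<times> 'c \<Rightarrow> _)" by (intro continuous_intros)
  then show "(\<lambda>z. snd (v z)) \<in> borel_measurable M"
    by (rule borel_measurable_continuous_on[OF _ L2_measurable[OF assms]])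
  have "norm (snd (v z)) \<le> 1 * norm (v z)" for z
    by (cases "v z") (simp add: norm_snd_le)
  then show "AE z in M. norm (snd (v z)) \<le> 1 * norm (v z)" by (rule AE_I2)
qed

lemma L2_norm_Pair:
  assumes "f \<in> L2 M" "g \<in> L2 M"
  shows "(L2_norm M (\<lambda>z. (f z, g z)))\<^sup>2 = (L2_norm M f)\<^sup>2 + (L2_norm M g)\<^sup>2"
  using assms by (simp add: L2_norm_power2 norm_Pair L2_integrable_sq)

lemma
  assumes "f \<in> L2 M" "g \<in> L2 M"
  shows L2_norm_Pair_ge1: "L2_norm M f \<le> L2_norm M (\<lambda>z. (f z, g z))"
    and L2_norm_Pair_ge2: "L2_norm M g \<le> L2_norm M (\<lambda>z. (f z, g z))"
    and L2_norm_Pair_le: "L2_norm M (\<lambda>z. (f z, g z)) \<le> L2_norm M f + L2_norm M g"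
proof -
  note e = L2_norm_Pair[OF assms] and n = L2_norm_nonneg[of M f] L2_norm_nonneg[of M g]
  show "L2_norm M f \<le> L2_norm M (\<lambda>z. (f z, g z))"
    by (rule power2_le_imp_le) (simp_all add: e L2_norm_nonneg)
  show "L2_norm M g \<le> L2_norm M (\<lambda>z. (f z, g z))"
    by (rule power2_le_imp_le) (simp_all add: e L2_norm_nonneg)
  show "L2_norm M (\<lambda>z. (f z, g z)) \<le> L2_norm M f + L2_norm M g"
    by (rule power2_le_imp_le) (use n in \<open>simp_all add: e power2_sum\<close>)
qed

lemma L2_mult_bounded:
  fixes f w :: "'a \<Rightarrow> real"
  assumes "f \<in> L2 M" "w \<in> borel_measurable M" "AE z in M. \<bar>w z\<bar> \<le> B"
  shows "(\<lambda>z. w z * f z) \<in> L2 M" "L2_norm M (\<lambda>z. w z * f z) \<le> B * L2_norm M f"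
proof -
  have le: "AE z in M. norm (w z * f z) \<le> B * norm (f z)"
    using assms(3) by eventually_elim (simp add: abs_mult mult_right_mono)
  have m: "(\<lambda>z. w z * f z) \<in> borel_measurable M"
    using assms(2) L2_measurable[OF assms(1)] by measurable
  show L: "(\<lambda>z. w z * f z) \<in> L2 M" by (rule L2_bounded_by[OF m assms(1) le])
  show "L2_norm M (\<lambda>z. w z * f z) \<le> B * L2_norm M f"
  proof (cases "0 \<le> B")
    case True
    have "(L2_norm M (\<lambda>z. w z * f z))\<^sup>2 \<le> (LINT z|M. B\<^sup>2 * (norm (f z))\<^sup>2)"
      unfolding L2_norm_power2
    proof (rule integral_mono_AE)
      show "AE z in M. (norm (w z * f z))\<^sup>2 \<le> B\<^sup>2 * (norm (f z))\<^sup>2"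
        using le
      proof eventually_elim
        case (elim z)
        then have "(norm (w z * f z))\<^sup>2 \<le> (B * norm (f z))\<^sup>2" by (intro power_mono) auto
        then show ?case by (simp only: power_mult_distrib)
      qed
    qed (use L2_integrable_sq[OF L] L2_integrable_sq[OF assms(1)] in auto)
    also have "\<dots> = (B * L2_norm M f)\<^sup>2"
      by (simp add: power_mult_distrib L2_norm_power2)
    finally show ?thesis by (rule power2_le_imp_le) (use True in \<open>simp add: L2_norm_nonneg\<close>)
  next
    \<comment> \<open>A negative \<open>B\<close> forces the measure to be null, because
      \<open>\<bar>w z\<bar> \<le> B\<close> then fails at every point.\<close>
    case False
    have z: "AE z in M. f z = 0"
      using assms(3) by eventually_elim (use False in auto)
    then have "AE z in M. w z * f z = 0" by eventually_elim simp
    then have "L2_norm M (\<lambda>z. w z * f z) = L2_norm M (\<lambda>z. 0::real)" "L2_norm M f = L2_norm M (\<lambda>z. 0::real)"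
      using z m L2_measurable[OF assms(1)] by (auto intro!: L2_norm_cong_AE)
    then show ?thesis by (simp add: L2_norm_def)
  qed
qed

section \<open>Minimizing sequences and Riesz representation\<close>

text \<open>Strong midpoint convexity: \<open>J m\<close> is at least the infimum, so
  \<open>c\<close> times the squared distance of \<open>w x\<close> and \<open>w y\<close> is at
  most the mean excess of \<open>J x\<close> and \<open>J y\<close> over the infimum, and minimizing
  sequences are Cauchy. The map \<open>w\<close> lets the same statement serve for pairs of a vector
  and a functional value in \<open>L2_Riesz\<close> and for plain functions in the final
  minimization.\<close>

lemma L2_minimizing_sequence:
  fixes w :: "'i \<Rightarrow> 'a \<Rightarrow> 'b::euclidean_space" and J :: "'i \<Rightarrow> real"
  assumes "X \<noteq> {}" and w: "\<And>x. x \<in> X \<Longrightarrow> w x \<in> L2 M"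
    and bdd: "bdd_below (J ` X)" and "0 < c"
    and mid: "\<And>x y. x \<in> X \<Longrightarrow> y \<in> X \<Longrightarrow>
      \<exists>m\<in>X. J m \<le> (J x + J y) / 2 - c * (L2_norm M (\<lambda>z. w x z - w y z))\<^sup>2"
  obtains x v where "\<And>n::nat. x n \<in> X" "(\<lambda>n. J (x n)) \<longlonglongrightarrow> (INF x\<in>X. J x)"
    "v \<in> L2 M" "(\<lambda>n. L2_norm M (\<lambda>z. w (x n) z - v z)) \<longlonglongrightarrow> 0"
proof -
  define I where "I = (INF x\<in>X. J x)"
  have I_le: "I \<le> J x" if "x \<in> X" for x
    unfolding I_def using bdd that by (rule cINF_lower)
  have "\<exists>x\<in>X. J x < I + inverse (real (Suc n))" for n
    using cINF_less_iff[OF \<open>X \<noteq> {}\<close> bdd, of "I + inverse (real (Suc n))"] by (simp add: I_def)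
  then obtain x where x: "\<And>n. x n \<in> X" and Jx: "\<And>n. J (x n) < I + inverse (real (Suc n))"
    by metis
  have lim: "(\<lambda>n. J (x n)) \<longlonglongrightarrow> I"
  proof (rule tendsto_sandwich[OF _ _ tendsto_const LIMSEQ_inverse_real_of_nat_add])
    show "\<forall>\<^sub>F n in sequentially. I \<le> J (x n)"
      using I_le[OF x] by simp
    show "\<forall>\<^sub>F n in sequentially. J (x n) \<le> I + inverse (real (Suc n))"
      using Jx by (intro always_eventually allI less_imp_le)
  qed
  have cau: "\<exists>N. \<forall>m\<ge>N. \<forall>n\<ge>N. L2_norm M (\<lambda>z. w (x m) z - w (x n) z) \<le> e" if e: "0 < e" for e
  proof -
    \<comment> \<open>For indices from \<open>N\<close> on, the mean of the two excesses is below
      \<open>inverse (real (Suc N))\<close>.\<close>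
    obtain N where N: "inverse (real (Suc N)) < c * e\<^sup>2"
      using reals_Archimedean[OF mult_pos_pos[OF \<open>0 < c\<close> zero_less_power[OF e, of 2]]] by blast
    have "L2_norm M (\<lambda>z. w (x m) z - w (x n) z) \<le> e" if "m \<ge> N" "n \<ge> N" for m n
    proof -
      obtain y where y: "y \<in> X"
        "J y \<le> (J (x m) + J (x n)) / 2 - c * (L2_norm M (\<lambda>z. w (x m) z - w (x n) z))\<^sup>2"
        using mid[OF x x] by blast
      have "inverse (real (Suc m)) \<le> inverse (real (Suc N))" "inverse (real (Suc n)) \<le> inverse (real (Suc N))"
        using that by (auto intro!: le_imp_inverse_le)
      then have "c * (L2_norm M (\<lambda>z. w (x m) z - w (x n) z))\<^sup>2 \<le> c * e\<^sup>2"
        using I_le[OF y(1)] y(2) Jx[of m] Jx[of n] N by argo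
      then have "(L2_norm M (\<lambda>z. w (x m) z - w (x n) z))\<^sup>2 \<le> e\<^sup>2"
        using \<open>0 < c\<close> by simp
      then show ?thesis using \<open>0 < e\<close> by (rule power2_le_imp_le[OF _ less_imp_le])
    qed
    then show ?thesis by blast
  qed
  obtain v where "v \<in> L2 M" "(\<lambda>n. L2_norm M (\<lambda>z. w (x n) z - v z)) \<longlonglongrightarrow> 0"
    by (rule L2_complete[OF w[OF x] cau])
  with x lim show thesis unfolding I_def by (rule that)
qed

text \<open>\<open>A\<close> is the graph of a bounded linear functional whose domain need not be closed.\<close>

lemma L2_Riesz:
  fixes A :: "(('a \<Rightarrow> 'b::euclidean_space) \<times> real) set"
  assumes "A \<noteq> {}"
    and lin: "\<And>u v c d s t. (u, c) \<in> A \<Longrightarrow> (v, d) \<in> A \<Longrightarrow>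
      (\<lambda>z. s *\<^sub>R u z + t *\<^sub>R v z, s * c + t * d) \<in> A"
    and L2: "\<And>u c. (u, c) \<in> A \<Longrightarrow> u \<in> L2 M"
    and bound: "\<And>u c. (u, c) \<in> A \<Longrightarrow> c \<le> C * L2_norm M u"
  obtains v x where "v \<in> L2 M" "\<And>n::nat. x n \<in> fst ` A"
    "(\<lambda>n. L2_norm M (\<lambda>z. x n z - v z)) \<longlonglongrightarrow> 0" "\<And>u c. (u, c) \<in> A \<Longrightarrow> L2_inner M v u = c"
proof -
  \<comment> \<open>The quadratic functional whose minimizer is the Riesz vector: its first
    variation at \<open>x\<close> in the direction \<open>(u, c)\<close> is
    \<open><x, u> - c\<close>.\<close>
  define J :: "('a \<Rightarrow> 'b) \<times> real \<Rightarrow> real" where "J = (\<lambda>(u, c). (L2_norm M u)\<^sup>2 / 2 - c)"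
  have J_lin: "J (\<lambda>z. s *\<^sub>R u z + t *\<^sub>R v z, s * c + t * d)
      = s\<^sup>2 * (L2_norm M u)\<^sup>2 / 2 + s * t * L2_inner M u v + t\<^sup>2 * (L2_norm M v)\<^sup>2 / 2 - s * c - t * d"
    if "u \<in> L2 M" "v \<in> L2 M" for u v c d s t
    using L2_norm_add_power2[OF L2_scaleR[OF that(1), of s] L2_scaleR[OF that(2), of t]]
    by (simp add: J_def L2_norm_scaleR L2_inner_scaleR_left L2_inner_scaleR_right power_mult_distrib
        field_simps)
  have bdd: "bdd_below (J ` A)"
  proof (rule bdd_belowI2[where m="- (C\<^sup>2 / 2)"])
    fix a assume "a \<in> A"
    then obtain u c where a: "a = (u, c)" "(u, c) \<in> A" by (cases a) auto
    have "0 \<le> (L2_norm M u - C)\<^sup>2" by simp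
    then show "- (C\<^sup>2 / 2) \<le> J a"
      using bound[OF a(2)] by (simp add: J_def a(1) power2_diff mult.commute)
  qed
  obtain x v where x: "\<And>n::nat. x n \<in> A" and lim: "(\<lambda>n. J (x n)) \<longlonglongrightarrow> (INF a\<in>A. J a)"
    and v: "v \<in> L2 M" and conv: "(\<lambda>n. L2_norm M (\<lambda>z. fst (x n) z - v z)) \<longlonglongrightarrow> 0"
  \<comment> \<open>By the parallelogram law the midpoint inequality is an equality for the constant
    1/8; the functional values enter linearly.\<close>
  proof (rule L2_minimizing_sequence[where w=fst and J=J and X=A and c="1/8" and M=M])
    fix a b assume ab: "a \<in> A" "b \<in> A"
    obtain u c where a: "a = (u, c)" by (cases a)
    obtain v d where b: "b = (v, d)" by (cases b)
    have uv: "u \<in> L2 M" "v \<in> L2 M" using ab L2 by (auto simp: a b)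
    show "\<exists>m\<in>A. J m \<le> (J a + J b) / 2 - 1/8 * (L2_norm M (\<lambda>z. fst a z - fst b z))\<^sup>2"
    proof (rule bexI)
      show "(\<lambda>z. (1/2) *\<^sub>R u z + (1/2) *\<^sub>R v z, (1/2) * c + (1/2) * d) \<in> A"
        using ab by (intro lin) (auto simp: a b)
      show "J (\<lambda>z. (1/2) *\<^sub>R u z + (1/2) *\<^sub>R v z, (1/2) * c + (1/2) * d)
          \<le> (J a + J b) / 2 - 1/8 * (L2_norm M (\<lambda>z. fst a z - fst b z))\<^sup>2"
        unfolding J_lin[OF uv] using L2_norm_diff_power2[OF uv]
        by (simp add: a b J_def power2_eq_square field_simps)
    qed
  qed (use assms(1) bdd L2 in auto)
  have "L2_inner M v u = c" if uc: "(u, c) \<in> A" for u c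
  proof -
    have u: "u \<in> L2 M" using L2[OF uc] .
    define d k where "d = L2_inner M v u - c" and "k = (L2_norm M u)\<^sup>2 / 2"
    \<comment> \<open>The limit \<open>v\<close> need not belong to the domain of the functional, so
      the variation is taken at \<open>x n\<close>: the infimum is compared with \<open>J\<close> at
      \<open>x n\<close> plus \<open>t\<close> times \<open>(u, c)\<close>, and then
      \<open>n\<close> tends to infinity.\<close>
    have "0 \<le> t * d + t\<^sup>2 * k" for t
    proof (rule LIMSEQ_le_const)
      have "(\<lambda>n. J (x n) + t * (L2_inner M (fst (x n)) u - c) + t\<^sup>2 * k - (INF a\<in>A. J a))
          \<longlonglongrightarrow> (INF a\<in>A. J a) + t * (L2_inner M v u - c) + t\<^sup>2 * k - (INF a\<in>A. J a)"
        using x L2 by (intro tendsto_intros lim L2_inner_tendsto[OF _ v u conv]) (metis prod.collapse)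
      then show "(\<lambda>n. J (x n) + t * (L2_inner M (fst (x n)) u - c) + t\<^sup>2 * k - (INF a\<in>A. J a))
          \<longlonglongrightarrow> t * d + t\<^sup>2 * k"
        by (simp add: d_def)
      show "\<exists>N. \<forall>n\<ge>N. 0 \<le> J (x n) + t * (L2_inner M (fst (x n)) u - c) + t\<^sup>2 * k - (INF a\<in>A. J a)"
      proof (intro exI allI impI)
        fix n
        obtain f e where f: "x n = (f, e)" by (cases "x n")
        then have fA: "(f, e) \<in> A" using x[of n] by simp
        have "(INF a\<in>A. J a) \<le> J (\<lambda>z. 1 *\<^sub>R f z + t *\<^sub>R u z, 1 * e + t * c)"
          by (rule cINF_lower[OF bdd lin[OF fA uc]])
        then show "0 \<le> J (x n) + t * (L2_inner M (fst (x n)) u - c) + t\<^sup>2 * k - (INF a\<in>A. J a)"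
          unfolding J_lin[OF L2[OF fA] u] by (simp add: f J_def k_def field_simps)
      qed
    qed
    note q = this
    have k: "k \<ge> 0" by (simp add: k_def)
    \<comment> \<open>At \<open>t = - d / (k + 1)\<close> the quadratic equals
      \<open>- d^2 / (k + 1)^2\<close>; the added 1 keeps the denominator positive when
      \<open>u\<close> has norm zero.\<close>
    have "0 \<le> (k + 1)\<^sup>2 * (- d / (k + 1) * d + (- d / (k + 1))\<^sup>2 * k)"
      by (intro mult_nonneg_nonneg q zero_le_power2)
    also have "\<dots> = - (d\<^sup>2)"
      using k by (simp add: power2_eq_square divide_simps) (simp add: algebra_simps)
    finally have "d = 0" by simp
    then show ?thesis by (simp add: d_def)
  qed
  moreover have "fst (x n) \<in> fst ` A" for n using x by simp
  ultimately show thesis using that[OF v _ conv] by blast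
qed

section \<open>Smooth functions and primitives in time\<close>

lemma C_k_Suc_imp: "C_k (Suc k) f \<Longrightarrow> C_k k f"
proof (induction k arbitrary: f)
  case 0
  then show ?case
    by (auto intro!: continuous_at_imp_continuous_on differentiable_imp_continuous_within)
next
  case (Suc k)
  then show ?case by (subst C_k.simps) (metis C_k.simps(2))
qed

lemma C_k_const: "C_k k (\<lambda>z. c)"
  by (induction k arbitrary: c) auto

lemma C_k_add: "C_k k f \<Longrightarrow> C_k k g \<Longrightarrow> C_k k (\<lambda>z. f z + g z)"
proof (induction k arbitrary: f g)
  case 0
  then show ?case by (auto intro: continuous_intros)
next
  case (Suc k)
  have d: "frechet_derivative (\<lambda>z. f z + g z) (at z)
      = (\<lambda>h. frechet_derivative f (at z) h + frechet_derivative g (at z) h)" for z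
    using Suc.prems
    by (intro frechet_derivative_at[symmetric] has_derivative_add)
      (simp_all add: frechet_derivative_works[symmetric])
  show ?case
    using Suc by (simp add: d)
qed

lemma C_k_mult: "C_k k f \<Longrightarrow> C_k k g \<Longrightarrow> C_k k (\<lambda>z. f z * g z)"
proof (induction k arbitrary: f g)
  case 0
  then show ?case by (auto intro: continuous_intros)
next
  case (Suc k)
  have d: "frechet_derivative (\<lambda>z. f z * g z) (at z)
      = (\<lambda>h. f z * frechet_derivative g (at z) h + frechet_derivative f (at z) h * g z)" for z
    using Suc.prems
    by (intro frechet_derivative_at[symmetric] has_derivative_mult)
      (simp_all add: frechet_derivative_works[symmetric])
  show ?case
    using Suc C_k_Suc_imp[OF Suc.prems(1)] C_k_Suc_imp[OF Suc.prems(2)] by (simp add: d C_k_add)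
qed

lemma C_k_exp_time: "C_k k (\<lambda>z::'a::euclidean_space \<times> real. exp (l * snd z))"
proof -
  have d: "((\<lambda>z::'a \<times> real. exp (l * snd z)) has_derivative (\<lambda>h. exp (l * snd z) * (l * snd h))) (at z)" for z
    by (auto intro!: derivative_eq_intros)
  then have df: "frechet_derivative (\<lambda>z::'a \<times> real. exp (l * snd z)) (at z)
      = (\<lambda>h. exp (l * snd z) * (l * snd h))" for z
    by (metis frechet_derivative_at)
  show ?thesis
  proof (induction k)
    case 0
    show ?case by (auto intro!: continuous_intros)
  next
    case (Suc k)
    have "C_k k (\<lambda>z::'a \<times> real. exp (l * snd z) * c)" for c
      by (rule C_k_mult[OF Suc.IH C_k_const])
    then show ?case using d by (auto simp: df differentiable_def)
  qed
qed

lemma C_infinity_mult: "C_infinity f \<Longrightarrow> C_infinity g \<Longrightarrow> C_infinity (\<lambda>z. f z * g z)"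
  by (simp add: C_infinity_def C_k_mult)

lemma C_infinity_deriv: "C_infinity f \<Longrightarrow> b \<in> Basis \<Longrightarrow> C_infinity (\<lambda>z. frechet_derivative f (at z) b)"
  unfolding C_infinity_def by (metis C_k.simps(2))

lemma C_infinity_differentiable: "C_infinity f \<Longrightarrow> f differentiable (at z)"
  unfolding C_infinity_def by (metis C_k.simps(2))

lemma C_infinity_continuous: "C_infinity f \<Longrightarrow> continuous_on UNIV f"
  unfolding C_infinity_def by (metis C_k.simps(1))

lemma C_infinity_has_derivative:
  "C_infinity f \<Longrightarrow> (f has_derivative frechet_derivative f (at z)) (at z)"
  using C_infinity_differentiable frechet_derivative_works by blast

text \<open>The integral of \<open>f (x, s)\<close> over \<open>s\<close> from \<open>0\<close> to \<open>t\<close>, rescaled to a fixed interval so that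
  differentiation under the integral sign applies to both arguments.\<close>

definition time_primitive :: "('a::euclidean_space \<times> real \<Rightarrow> real) \<Rightarrow> 'a \<times> real \<Rightarrow> real" where
  "time_primitive f z = snd z * integral (cbox 0 1) (\<lambda>s. f (fst z, s * snd z))"

lemma time_primitive_0: "time_primitive f (x, 0) = 0"
  by (simp add: time_primitive_def)

lemma continuous_on_time_primitive:
  assumes "continuous_on UNIV f"
  shows "continuous_on UNIV (time_primitive f)"
proof -
  have "continuous_on UNIV (\<lambda>z. integral (cbox 0 1) (\<lambda>s. f (fst z, s * snd z)))"
    by (intro integral_continuous_on_param)
      (auto simp: split_beta intro!: continuous_intros continuous_on_compose2[OF assms])
  then show ?thesis
    unfolding time_primitive_def[abs_def] by (intro continuous_intros)
qed

lemma has_derivative_scaled_time: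
  fixes f :: "'a::euclidean_space \<times> real \<Rightarrow> real"
  assumes "f differentiable (at (x, s * t))"
  shows "((\<lambda>z. f (fst z, s * snd z)) has_derivative
    (\<lambda>h. frechet_derivative f (at (x, s * t)) (fst h, s * snd h))) (at (x, t))"
proof -
  have "((\<lambda>z. (fst z, s * snd z)) has_derivative (\<lambda>h. (fst h, s * snd h))) (at (x, t))"
    by (auto intro!: derivative_eq_intros)
  then show ?thesis
    using has_derivative_compose[of "\<lambda>z. (fst z, s * snd z)" _ "(x, t)" UNIV f]
      frechet_derivative_works assms by auto
qed

lemma linear_frechet_split:
  fixes f :: "'a::euclidean_space \<times> real \<Rightarrow> real"
  assumes "f differentiable (at w)"
  shows "frechet_derivative f (at w) (v, r)
    = frechet_derivative f (at w) (v, 0) + r * frechet_derivative f (at w) (0, 1)"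
proof -
  have l: "linear (frechet_derivative f (at w))"
    using assms linear_frechet_derivative by blast
  have "(v, r) = (v, 0) + r *\<^sub>R (0, 1)" by simp
  then show ?thesis using linear_add[OF l] linear_scale[OF l] by (metis real_scaleR_def)
qed

text \<open>Differentiation under the integral over a fixed interval. Spatial derivatives simply
  pass inside. In the time direction two terms arise, one from the factor \<open>snd z\<close> and
  one from the integrand, and they recombine to \<open>f z\<close> by the fundamental theorem of
  calculus.\<close>

lemma time_primitive_has_derivative:
  fixes f :: "'a::euclidean_space \<times> real \<Rightarrow> real"
  assumes diff: "\<And>z. f differentiable (at z)"
    and cont: "\<And>b. b \<in> Basis \<Longrightarrow> continuous_on UNIV (\<lambda>z. frechet_derivative f (at z) b)"
  shows "time_primitive f differentiable (at z)"
    and "frechet_derivative (time_primitive f) (at z) (v, 0)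
      = time_primitive (\<lambda>z. frechet_derivative f (at z) (v, 0)) z"
    and "frechet_derivative (time_primitive f) (at z) (0, 1) = f z"
proof -
  let ?D = "\<lambda>z. frechet_derivative f (at z)"
  \<comment> \<open>\<open>leibniz_rule\<close> asks for the derivative of the integrand as a
    continuous family of bounded linear maps; continuity is checked direction by direction, from the
    partial derivatives.\<close>
  define F where "F z s = Blinfun (\<lambda>h. ?D (fst z, s * snd z) (fst h, s * snd h))" for z s
  have F: "blinfun_apply (F z s) = (\<lambda>h. ?D (fst z, s * snd z) (fst h, s * snd h))" for z s
    unfolding F_def
    using has_derivative_bounded_linear[OF has_derivative_scaled_time[OF diff, where s=s and x="fst z" and t="snd z"]]
    by (simp add: bounded_linear_Blinfun_apply)
  define d where "d w = ?D w (0, 1)" for w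
  have D0: "?D w (0, r) = r * d w" for w r
    unfolding d_def using linear_frechet_split[OF diff, of w 0 r] linear_0[OF linear_frechet_derivative[OF diff]]
    by (simp add: zero_prod_def)
  have fcont: "continuous_on UNIV f"
    using diff by (simp add: continuous_at_imp_continuous_on differentiable_imp_continuous_within)
  have c01: "continuous_on UNIV (\<lambda>z. ?D z (0, 1))"
    by (rule cont) (simp add: Basis_prod_def)
  have cv: "continuous_on UNIV (\<lambda>z. ?D z (v, 0))" for v
  proof -
    have "?D z (v, 0) = (\<Sum>b\<in>Basis. (v \<bullet> b) * ?D z (b, 0))" for z
    proof -
      have l: "linear (?D z)"
        using diff linear_frechet_derivative by blast
      have "(v, 0::real) = (\<Sum>b\<in>Basis. (v \<bullet> b) *\<^sub>R (b, 0))"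
        by (simp add: prod_eq_iff fst_sum snd_sum euclidean_representation)
      then have "?D z (v, 0) = ?D z (\<Sum>b\<in>Basis. (v \<bullet> b) *\<^sub>R (b, 0))" by (rule arg_cong)
      then show ?thesis by (simp only: linear_sum[OF l] linear_scale[OF l] real_scaleR_def)
    qed
    then show ?thesis
      by (auto simp: Basis_prod_def intro!: continuous_intros cont)
  qed
  have Fcont: "continuous_on (UNIV \<times> cbox 0 1) (\<lambda>(z, s). F z s)"
  proof (rule continuous_on_blinfun_componentwise)
    fix i :: "'a \<times> real"
    have "continuous_on (UNIV \<times> cbox 0 1) (\<lambda>y. ?D (fst (fst y), snd y * snd (fst y)) (fst i, 0)
        + snd y * snd i * ?D (fst (fst y), snd y * snd (fst y)) (0, 1))"
      by (intro continuous_intros continuous_on_compose2[OF c01] continuous_on_compose2[OF cv]) auto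
    then show "continuous_on (UNIV \<times> cbox 0 1) (\<lambda>y. blinfun_apply (case y of (z, s) \<Rightarrow> F z s) i)"
      by (simp add: split_beta F linear_frechet_split[OF diff, of _ "fst i" "_ * _"])
  qed
  define G where "G z = integral (cbox 0 1) (\<lambda>s. f (fst z, s * snd z))" for z
  have G: "(G has_derivative blinfun_apply (integral (cbox 0 1) (F z))) (at z)" for z
    unfolding G_def
  proof (rule leibniz_rule[where U=UNIV])
    fix y :: "'a \<times> real" and s :: real
    show "((\<lambda>z. f (fst z, s * snd z)) has_derivative blinfun_apply (F y s)) (at y)"
      unfolding F using has_derivative_scaled_time[OF diff, where s=s and x="fst y" and t="snd y"] by simp
    show "(\<lambda>s. f (fst y, s * snd y)) integrable_on cbox 0 1"
      by (intro integrable_continuous continuous_intros continuous_on_compose2[OF fcont]) auto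
  qed (use Fcont in auto)
  have Fint: "F z integrable_on cbox 0 1" for z
    by (intro integrable_continuous continuous_on_compose2[OF Fcont, where f="\<lambda>s. (z, s)", simplified])
      (auto intro!: continuous_intros)
  have P: "(time_primitive f has_derivative
      (\<lambda>h. snd z * integral (cbox 0 1) (\<lambda>s. F z s h) + snd h * G z)) (at z)" for z
    using has_derivative_mult[OF has_derivative_snd[OF has_derivative_ident] G[of z]]
    by (simp add: time_primitive_def[abs_def] G_def blinfun_apply_integral[OF Fint] del: box_real)
  then show "time_primitive f differentiable (at z)"
    unfolding differentiable_def by blast
  have fd: "frechet_derivative (time_primitive f) (at z)
      = (\<lambda>h. snd z * integral (cbox 0 1) (\<lambda>s. F z s h) + snd h * G z)" for z
    by (rule frechet_derivative_at[OF P, symmetric])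
  show "frechet_derivative (time_primitive f) (at z) (v, 0)
      = time_primitive (\<lambda>z. frechet_derivative f (at z) (v, 0)) z"
    by (simp add: fd F time_primitive_def)
  obtain x t where z: "z = (x, t)" by (cases z)
  have cs: "continuous_on (cbox 0 1) (\<lambda>s. d (x, s * t))" "continuous_on (cbox 0 1) (\<lambda>s. f (x, s * t))"
    by (auto intro!: continuous_intros continuous_on_compose2[OF c01[folded d_def]] continuous_on_compose2[OF fcont])
  \<comment> \<open>Product rule for \<open>s \<mapsto> s * f (x, s * t)\<close>: its derivative is
    the integrand of the time derivative of \<open>time_primitive f\<close>, and its end values are
    \<open>0\<close> and \<open>f (x, t)\<close>.\<close>
  have "((\<lambda>s. t * (s * d (x, s * t)) + f (x, s * t)) has_integral (1 * f (x, 1 * t) - 0 * f (x, 0 * t))) {0..1}"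
  proof (rule fundamental_theorem_of_calculus)
    fix s :: real
    have "((\<lambda>s. (x, s * t)) has_derivative (\<lambda>h. (0, h * t))) (at s)"
      by (auto intro!: derivative_eq_intros)
    then have "((\<lambda>s. f (x, s * t)) has_derivative (\<lambda>h. ?D (x, s * t) (0, h * t))) (at s)"
      using has_derivative_compose[OF _ frechet_derivative_works[THEN iffD1, OF diff]] by blast
    then have "((\<lambda>s. f (x, s * t)) has_vector_derivative t * d (x, s * t)) (at s)"
      unfolding has_vector_derivative_def
      by (simp add: D0 mult.assoc)
    from has_vector_derivative_mult[OF has_vector_derivative_id this]
    show "((\<lambda>s. s * f (x, s * t)) has_vector_derivative (t * (s * d (x, s * t)) + f (x, s * t)))
        (at s within {0..1})"
      by (simp add: has_vector_derivative_at_within mult.left_commute)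
  qed simp
  then have "integral {0..1} (\<lambda>s. t * (s * d (x, s * t)) + f (x, s * t)) = f (x, t)"
    by (simp add: integral_unique)
  moreover have "integral {0..1} (\<lambda>s. t * (s * d (x, s * t)) + f (x, s * t))
      = t * integral {0..1} (\<lambda>s. s * d (x, s * t)) + integral {0..1} (\<lambda>s. f (x, s * t))"
    using cs by (subst Henstock_Kurzweil_Integration.integral_add)
      (auto intro!: integrable_continuous_interval continuous_intros)
  ultimately show "frechet_derivative (time_primitive f) (at z) (0, 1) = f z"
    by (simp add: fd F z G_def D0)
qed

text \<open>A spatial derivative of the primitive is the primitive of a spatial derivative, to which
  the induction hypothesis applies (hence the generalization over \<open>f\<close>); the time
  derivative is \<open>f\<close> itself.\<close>

lemma C_k_time_primitive: "C_k k f \<Longrightarrow> C_k k (time_primitive f)"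
proof (induction k arbitrary: f)
  case 0
  then show ?case by (simp add: continuous_on_time_primitive)
next
  case (Suc k)
  have diff: "\<And>z. f differentiable (at z)" and Ck: "\<And>b. b \<in> Basis \<Longrightarrow> C_k k (\<lambda>z. frechet_derivative f (at z) b)"
    using Suc.prems by auto
  have C0: "C_k k f \<Longrightarrow> continuous_on UNIV f" for f :: "'a \<times> real \<Rightarrow> real"
    by (induction k) (auto dest: C_k_Suc_imp simp del: C_k.simps(2))
  note * = time_primitive_has_derivative[OF diff C0[OF Ck]]
  show ?case
    using * Ck Suc.IH C_k_Suc_imp[OF Suc.prems] by (auto simp: Basis_prod_def)
qed

lemma
  fixes f :: "'a::euclidean_space \<times> real \<Rightarrow> real"
  assumes "C_infinity f"
  shows C_infinity_time_primitive: "C_infinity (time_primitive f)"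
    and time_primitive_space_deriv: "frechet_derivative (time_primitive f) (at z) (v, 0)
      = time_primitive (\<lambda>z. frechet_derivative f (at z) (v, 0)) z"
    and time_primitive_time_deriv: "frechet_derivative (time_primitive f) (at z) (0, 1) = f z"
proof -
  show "C_infinity (time_primitive f)"
    using assms by (simp add: C_infinity_def C_k_time_primitive)
  note * = time_primitive_has_derivative[OF C_infinity_differentiable C_infinity_continuous[OF C_infinity_deriv],
      OF assms assms]
  show "frechet_derivative (time_primitive f) (at z) (v, 0)
      = time_primitive (\<lambda>z. frechet_derivative f (at z) (v, 0)) z"
    "frechet_derivative (time_primitive f) (at z) (0, 1) = f z"
    using *(2,3) by blast+
qed

section \<open>Energy estimates for test functions\<close>

text \<open>One class for test functions, their derivatives and weighted products. Its members are
  integrable over the cylinder even if \<open>\<Omega>\<close> is unbounded, and it contains every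
  continuous function that vanishes wherever some member does.\<close>

definition lateral_continuous ::
  "'a::euclidean_space set \<Rightarrow> ('a \<times> real \<Rightarrow> 'b::euclidean_space) \<Rightarrow> bool" where
  "lateral_continuous \<Omega> f \<longleftrightarrow> continuous_on UNIV f \<and>
     (\<exists>K. compact K \<and> K \<subseteq> \<Omega> \<and> (\<forall>x t. x \<notin> K \<longrightarrow> f (x, t) = 0))"

lemma lateral_continuous_comp:
  assumes "lateral_continuous \<Omega> f" "continuous_on UNIV h" "\<And>x t. f (x, t) = 0 \<Longrightarrow> h (x, t) = 0"
  shows "lateral_continuous \<Omega> h"
  using assms unfolding lateral_continuous_def by blast

lemma open_cylinder: "open \<Omega> \<Longrightarrow> open (cylinder \<Omega> T)"
  by (simp add: cylinder_def open_Times)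

lemma sets_lebesgue_cylinder: "open \<Omega> \<Longrightarrow> cylinder (\<Omega>::'a::euclidean_space set) T \<in> sets lebesgue"
  by (rule sets_completionI_sets) (simp add: borel_open open_cylinder)

lemma lateral_continuous_integrable_lborel:
  fixes f :: "'a::euclidean_space \<times> real \<Rightarrow> real"
  assumes "open \<Omega>" "lateral_continuous \<Omega> f"
  shows "integrable lborel (\<lambda>z. indicator (cylinder \<Omega> T) z *\<^sub>R f z)"
proof -
  obtain K where K: "compact K" and f0: "\<And>x t. x \<notin> K \<Longrightarrow> f (x, t) = 0" and cont: "continuous_on UNIV f"
    using assms(2) unfolding lateral_continuous_def by blast
  have c: "compact (K \<times> {0..T})" using K by (intro compact_Times) auto
  have "compact (f ` (K \<times> {0..T}))"
    by (rule compact_continuous_image[OF continuous_on_subset[OF cont] c]) auto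
  then obtain B where B: "\<And>z. z \<in> K \<times> {0..T} \<Longrightarrow> \<bar>f z\<bar> \<le> B"
    using compact_imp_bounded bounded_iff[of "f ` (K \<times> {0..T})"] by auto
  have [measurable]: "f \<in> borel_measurable borel"
    using cont by (rule borel_measurable_continuous_onI)
  have [measurable]: "cylinder \<Omega> T \<in> sets borel"
    using open_cylinder[OF assms(1)] by (rule borel_open)
  show ?thesis
  proof (rule Bochner_Integration.integrable_bound)
    show "integrable lborel (\<lambda>z. B * indicator (K \<times> {0..T}) z)"
      using compact_imp_closed[OF c] emeasure_bounded_finite[OF compact_imp_bounded[OF c]] by (simp add: borel_closed)
    show "(\<lambda>z. indicator (cylinder \<Omega> T) z *\<^sub>R f z) \<in> borel_measurable lborel"
      by simp
    have "norm (indicator (cylinder \<Omega> T) z *\<^sub>R f z) \<le> norm (B * indicator (K \<times> {0..T}) z)" for z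
    proof (cases z)
      case (Pair x t)
      show ?thesis
      proof (cases "x \<in> K \<and> 0 < t \<and> t < T")
        case True
        then show ?thesis using B[of z] Pair by (auto simp: indicator_def)
      next
        case False
        then show ?thesis using f0[of x t] Pair by (auto simp: indicator_def cylinder_def)
      qed
    qed
    then show "AE z in lborel. norm (indicator (cylinder \<Omega> T) z *\<^sub>R f z) \<le> norm (B * indicator (K \<times> {0..T}) z)"
      by simp
  qed
qed

lemma borel_measurable_lebesgue_on_continuous:
  fixes f :: "'a::euclidean_space \<Rightarrow> 'b::euclidean_space"
  assumes "continuous_on UNIV f"
  shows "f \<in> borel_measurable (lebesgue_on S)"
  using borel_measurable_continuous_onI[OF assms]
  by (intro measurable_restrict_space1 measurable_completion) simp

text \<open>Fubini below works with products of Lebesgue measure on the Borel sets, whereas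
  \<open>lebesgue_on\<close> comes from its completion; for these integrands the two integrals
  agree.\<close>

lemma lateral_continuous_integral:
  fixes f :: "'a::euclidean_space \<times> real \<Rightarrow> real"
  assumes "open \<Omega>" "lateral_continuous \<Omega> f"
  shows lateral_continuous_integrable: "integrable (lebesgue_on (cylinder \<Omega> T)) f"
    and "(LINT z|lebesgue_on (cylinder \<Omega> T). f z) = (LINT z|lborel. indicator (cylinder \<Omega> T) z *\<^sub>R f z)"
proof -
  note i = lateral_continuous_integrable_lborel[OF assms, of T]
  have m: "(\<lambda>z. indicator (cylinder \<Omega> T) z *\<^sub>R f z) \<in> borel_measurable lborel"
    using i by (rule borel_measurable_integrable)
  have s: "cylinder \<Omega> T \<inter> space lebesgue \<in> sets lebesgue"
    using sets_lebesgue_cylinder[OF assms(1)] by simp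
  show "integrable (lebesgue_on (cylinder \<Omega> T)) f"
    using i unfolding integrable_restrict_space[OF s] integrable_completion[OF m] .
  show "(LINT z|lebesgue_on (cylinder \<Omega> T). f z) = (LINT z|lborel. indicator (cylinder \<Omega> T) z *\<^sub>R f z)"
    unfolding integral_restrict_space[OF s] integral_completion[OF m] ..
qed

lemma lateral_continuous_L2:
  fixes f :: "'a::euclidean_space \<times> real \<Rightarrow> 'b::euclidean_space"
  assumes "open \<Omega>" "lateral_continuous \<Omega> f"
  shows "f \<in> L2 (lebesgue_on (cylinder \<Omega> T))"
proof -
  have c: "continuous_on UNIV f" using assms(2) by (simp add: lateral_continuous_def)
  have "lateral_continuous \<Omega> (\<lambda>z. (norm (f z))\<^sup>2)"
    by (rule lateral_continuous_comp[OF assms(2)]) (auto intro!: continuous_intros c)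
  then show ?thesis
    using borel_measurable_lebesgue_on_continuous[OF c] lateral_continuous_integrable[OF assms(1)]
    by (simp add: L2_def)
qed

text \<open>All energy estimates below are instances of this with \<open>\<psi>\<close> a weighted square.\<close>

lemma integral_time_derivative_nonneg:
  fixes \<psi> \<psi>' :: "'a::euclidean_space \<times> real \<Rightarrow> real"
  assumes "open \<Omega>" "0 < T" and lat: "lateral_continuous \<Omega> \<psi>'"
    and deriv: "\<And>x t. ((\<lambda>s. \<psi> (x, s)) has_real_derivative \<psi>' (x, t)) (at t)"
    and "\<And>x. \<psi> (x, 0) = 0" "\<And>x. 0 \<le> \<psi> (x, T)"
  shows "0 \<le> (LINT z|lebesgue_on (cylinder \<Omega> T). \<psi>' z)"
proof -
  define h where "h z = indicator (cylinder \<Omega> T) z *\<^sub>R \<psi>' z" for z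
  have cont: "continuous_on UNIV \<psi>'" using lat by (simp add: lateral_continuous_def)
  have i: "integrable (lborel \<Otimes>\<^sub>M lborel) h"
    unfolding h_def lborel_prod by (rule lateral_continuous_integrable_lborel[OF assms(1) lat])
  have "(LINT z|lebesgue_on (cylinder \<Omega> T). \<psi>' z) = integral\<^sup>L (lborel \<Otimes>\<^sub>M lborel) h"
    unfolding h_def lborel_prod by (rule lateral_continuous_integral[OF assms(1) lat])
  also have "\<dots> = (LINT x|lborel. LINT s|lborel. h (x, s))"
    by (rule lborel_pair.integral_fst'[OF i, symmetric])
  also have "0 \<le> \<dots>"
  proof (rule Bochner_Integration.integral_nonneg)
    fix x :: 'a
    show "0 \<le> (LINT s|lborel. h (x, s))"
    proof (cases "x \<in> \<Omega>")
      case True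
      have c: "continuous_on UNIV (\<lambda>s. \<psi>' (x, s))"
        by (intro continuous_on_compose2[OF cont] continuous_intros) auto
      have [measurable]: "(\<lambda>s. \<psi>' (x, s)) \<in> borel_measurable borel"
        using c by (rule borel_measurable_continuous_onI)
      \<comment> \<open>The cylinder uses an open time interval, the fundamental theorem of calculus
        a closed one; the two end points form a null set.\<close>
      have "(LINT s|lborel. h (x, s)) = (LINT s|lborel. \<psi>' (x, s) * indicator {0..T} s)"
      proof (rule integral_cong_AE)
        show "AE s in lborel. h (x, s) = \<psi>' (x, s) * indicator {0..T} s"
          using AE_lborel_singleton[of 0] AE_lborel_singleton[of T]
        proof eventually_elim
          case (elim s)
          then show ?case using True by (auto simp: h_def cylinder_def indicator_def)
        qed
        have "h (x, s) = indicator {0<..<T} s * \<psi>' (x, s)" for s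
          using True by (auto simp: h_def cylinder_def indicator_def)
        then show "(\<lambda>s. h (x, s)) \<in> borel_measurable lborel" by simp
      qed simp
      also have "\<dots> = \<psi> (x, T) - \<psi> (x, 0)"
        using \<open>0 < T\<close> c by (intro integral_FTC_Icc_real)
          (auto simp: continuous_on_eq_continuous_at intro: deriv)
      finally show ?thesis using assms(5,6) by simp
    next
      case False
      then show ?thesis by (simp add: h_def cylinder_def)
    qed
  qed
  finally show ?thesis .
qed

section \<open>Test functions and their derivatives\<close>

lemma frechet_derivative_zero_outside:
  fixes f :: "'a::euclidean_space \<times> real \<Rightarrow> real"
  assumes "compact K" "\<And>x t. x \<notin> K \<Longrightarrow> f (x, t) = 0" "x \<notin> K"
  shows "frechet_derivative f (at (x, t)) = (\<lambda>h. 0)"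
proof -
  have "open ((- K) \<times> (UNIV::real set))"
    using assms(1) by (intro open_Times) (auto dest: compact_imp_closed)
  then have "(f has_derivative (\<lambda>h. 0)) (at (x, t))"
    by (rule has_derivative_transform_within_open[OF has_derivative_const[of 0]]) (use assms in auto)
  then show ?thesis by (rule frechet_derivative_at[symmetric])
qed

lemma lateral_test_C_infinity: "\<phi> \<in> lateral_test \<Omega> \<Longrightarrow> C_infinity \<phi>"
  by (simp add: lateral_test_def)

lemma lateral_continuous_test: "\<phi> \<in> lateral_test \<Omega> \<Longrightarrow> lateral_continuous \<Omega> \<phi>"
  by (auto simp: lateral_test_def lateral_continuous_def C_infinity_continuous)

lemma lateral_continuous_deriv:
  assumes "\<phi> \<in> lateral_test \<Omega>" "b \<in> Basis"
  shows "lateral_continuous \<Omega> (\<lambda>z. frechet_derivative \<phi> (at z) b)"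
proof -
  obtain K where "compact K" "K \<subseteq> \<Omega>" "\<And>x t. x \<notin> K \<Longrightarrow> \<phi> (x, t) = 0"
    using assms(1) by (auto simp: lateral_test_def)
  then show ?thesis
    unfolding lateral_continuous_def
    using C_infinity_continuous[OF C_infinity_deriv[OF lateral_test_C_infinity[OF assms(1)] assms(2)]]
      frechet_derivative_zero_outside[of K \<phi>] by (auto intro!: exI[of _ K])
qed

lemma lateral_continuous_time_deriv:
  "\<phi> \<in> lateral_test \<Omega> \<Longrightarrow> lateral_continuous \<Omega> (time_deriv \<phi>)"
  using lateral_continuous_deriv[of \<phi> \<Omega> "(0, 1)"]
  by (simp add: time_deriv_def[abs_def] Basis_prod_def)

lemma lateral_continuous_space_grad:
  assumes "\<phi> \<in> lateral_test \<Omega>"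
  shows "lateral_continuous \<Omega> (space_grad \<phi>)"
proof -
  obtain K where K: "compact K" "K \<subseteq> \<Omega>" "\<And>x t. x \<notin> K \<Longrightarrow> \<phi> (x, t) = 0"
    using assms(1) by (auto simp: lateral_test_def)
  have "continuous_on UNIV (\<lambda>z. frechet_derivative \<phi> (at z) (axis i 1, 0))" for i
    using lateral_continuous_deriv[OF assms, of "(axis i 1, 0)"]
    by (simp add: lateral_continuous_def Basis_prod_def axis_in_Basis_iff)
  then have "continuous_on UNIV (space_grad \<phi>)"
    unfolding space_grad_def[abs_def] by (rule continuous_on_vec_lambda)
  then show ?thesis
    unfolding lateral_continuous_def
    using K frechet_derivative_zero_outside[of K \<phi>]
    by (auto intro!: exI[of _ K] simp: space_grad_def vec_eq_iff)
qed

lemma lateral_test_mult: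
  assumes "C_infinity w" "\<phi> \<in> lateral_test \<Omega>"
  shows "(\<lambda>z. w z * \<phi> z) \<in> lateral_test \<Omega>"
  using assms unfolding lateral_test_def mem_Collect_eq by (metis C_infinity_mult mult_zero_right)

lemma lateral_test_lincomb:
  assumes "\<phi> \<in> lateral_test \<Omega>" "\<psi> \<in> lateral_test \<Omega>"
  shows "(\<lambda>z. s * \<phi> z + t * \<psi> z) \<in> lateral_test \<Omega>"
proof -
  obtain K L where "compact K" "K \<subseteq> \<Omega>" "\<And>x t. x \<notin> K \<Longrightarrow> \<phi> (x, t) = 0"
      "compact L" "L \<subseteq> \<Omega>" "\<And>x t. x \<notin> L \<Longrightarrow> \<psi> (x, t) = 0"
    using assms unfolding lateral_test_def by auto
  then have "compact (K \<union> L) \<and> K \<union> L \<subseteq> \<Omega> \<and> (\<forall>x u. x \<notin> K \<union> L \<longrightarrow> s * \<phi> (x, u) + t * \<psi> (x, u) = 0)"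
    by auto
  then show ?thesis
    using assms by (auto simp: lateral_test_def C_infinity_def C_k_add C_k_mult C_k_const)
qed

lemma lateral_test_time_primitive:
  assumes "\<phi> \<in> lateral_test \<Omega>"
  shows "time_primitive \<phi> \<in> lateral_test \<Omega>"
proof -
  obtain K where "compact K" "K \<subseteq> \<Omega>" "\<And>x t. x \<notin> K \<Longrightarrow> \<phi> (x, t) = 0"
    using assms unfolding lateral_test_def by auto
  then show ?thesis
    using assms C_infinity_time_primitive[of \<phi>] unfolding lateral_test_def
    by (auto simp: time_primitive_def intro!: exI[of _ K])
qed

lemma
  assumes "C_infinity \<phi>" "C_infinity \<psi>"
  shows time_deriv_lincomb: "time_deriv (\<lambda>z. s * \<phi> z + t * \<psi> z) z = s * time_deriv \<phi> z + t * time_deriv \<psi> z"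
    and space_grad_lincomb:
      "space_grad (\<lambda>z. s * \<phi> z + t * \<psi> z) z = s *\<^sub>R space_grad \<phi> z + t *\<^sub>R space_grad \<psi> z"
proof -
  have "frechet_derivative (\<lambda>z. s * \<phi> z + t * \<psi> z) (at z)
      = (\<lambda>h. s * frechet_derivative \<phi> (at z) h + t * frechet_derivative \<psi> (at z) h)"
    using assms by (intro frechet_derivative_at[symmetric] has_derivative_add has_derivative_mult_right
        C_infinity_has_derivative)
  then show "time_deriv (\<lambda>z. s * \<phi> z + t * \<psi> z) z = s * time_deriv \<phi> z + t * time_deriv \<psi> z"
    "space_grad (\<lambda>z. s * \<phi> z + t * \<psi> z) z = s *\<^sub>R space_grad \<phi> z + t *\<^sub>R space_grad \<psi> z"
    by (simp_all add: time_deriv_def space_grad_def vec_eq_iff)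
qed

lemma C_infinity_exp_time: "C_infinity (\<lambda>z::'a::euclidean_space \<times> real. exp (l * snd z))"
  by (simp add: C_infinity_def C_k_exp_time)

lemma space_grad_exp:
  fixes \<phi> :: "(real^'n) \<times> real \<Rightarrow> real"
  assumes "C_infinity \<phi>"
  shows "space_grad (\<lambda>z. exp (l * snd z) * \<phi> z) z = exp (l * snd z) *\<^sub>R space_grad \<phi> z"
proof -
  have e: "((\<lambda>z::(real^'n) \<times> real. exp (l * snd z)) has_derivative (\<lambda>h. exp (l * snd z) * (l * snd h))) (at z)"
    by (auto intro!: derivative_eq_intros)
  have "frechet_derivative (\<lambda>z. exp (l * snd z) * \<phi> z) (at z)
      = (\<lambda>h. exp (l * snd z) * frechet_derivative \<phi> (at z) h + exp (l * snd z) * (l * snd h) * \<phi> z)"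
    by (rule frechet_derivative_at[OF has_derivative_mult[OF e C_infinity_has_derivative[OF assms]], symmetric])
  then show ?thesis
    by (simp add: space_grad_def vec_eq_iff)
qed

lemma C_infinity_time_derivative:
  assumes "C_infinity f"
  shows "((\<lambda>s. f (x, s)) has_real_derivative frechet_derivative f (at (x, t)) (0, 1)) (at t)"
proof -
  have "((\<lambda>s. (x, s)) has_derivative (\<lambda>h. (0, h))) (at t)"
    by (auto intro!: derivative_eq_intros)
  from has_derivative_compose[OF this C_infinity_has_derivative[OF assms]]
  have "((\<lambda>s. f (x, s)) has_derivative (\<lambda>h. frechet_derivative f (at (x, t)) (0, h))) (at t)" .
  moreover have "(\<lambda>h. frechet_derivative f (at (x, t)) (0, h)) = (*) (frechet_derivative f (at (x, t)) (0, 1))"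
  proof
    fix h :: real
    have "frechet_derivative f (at (x, t)) (h *\<^sub>R (0, 1)) = h *\<^sub>R frechet_derivative f (at (x, t)) (0, 1)"
      by (rule linear_scale[OF linear_frechet_derivative[OF C_infinity_differentiable[OF assms]]])
    moreover have "h *\<^sub>R (0::'a, 1::real) = (0, h)" by simp
    ultimately show "frechet_derivative f (at (x, t)) (0, h) = frechet_derivative f (at (x, t)) (0, 1) * h"
      by (metis real_scaleR_def mult.commute)
  qed
  ultimately show ?thesis
    by (simp only: has_field_derivative_def)
qed

lemma lateral_test_deriv:
  assumes "\<phi> \<in> lateral_test \<Omega>" "b \<in> Basis"
  shows "(\<lambda>z. frechet_derivative \<phi> (at z) b) \<in> lateral_test \<Omega>"
  using lateral_continuous_deriv[OF assms] C_infinity_deriv[OF lateral_test_C_infinity[OF assms(1)] assms(2)]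
  by (simp add: lateral_test_def lateral_continuous_def)

lemma lateral_test_exp: "\<phi> \<in> lateral_test \<Omega> \<Longrightarrow> (\<lambda>z. exp (l * snd z) * \<phi> z) \<in> lateral_test \<Omega>"
  by (rule lateral_test_mult[OF C_infinity_exp_time])

lemma lateral_continuous_continuous: "lateral_continuous \<Omega> f \<Longrightarrow> continuous_on UNIV f"
  by (simp add: lateral_continuous_def)

section \<open>Weighted energy inequalities\<close>

text \<open>The time derivative of \<open>exp (- l t) \<phi>^2\<close> consists of the two
  integrands. Its integral over time is the value at \<open>T\<close>, which is nonnegative, since
  the value at \<open>0\<close> vanishes.\<close>

lemma weighted_energy:
  fixes \<phi> :: "(real^'n) \<times> real \<Rightarrow> real"
  assumes "open \<Omega>" "0 < T" and \<phi>: "\<phi> \<in> lateral_test \<Omega>" and 0: "\<And>x. \<phi> (x, 0) = 0"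
  shows "l * (LINT z|lebesgue_on (cylinder \<Omega> T). exp (- l * snd z) * (\<phi> z)\<^sup>2)
    \<le> 2 * (LINT z|lebesgue_on (cylinder \<Omega> T). exp (- l * snd z) * (\<phi> z * time_deriv \<phi> z))"
proof -
  have cexp: "continuous_on UNIV (\<lambda>z::(real^'n) \<times> real. exp (- l * snd z))"
    by (intro continuous_intros)
  note c = lateral_continuous_continuous[OF lateral_continuous_test[OF \<phi>]]
    lateral_continuous_continuous[OF lateral_continuous_time_deriv[OF \<phi>]]
  have l1: "lateral_continuous \<Omega> (\<lambda>z. exp (- l * snd z) * (\<phi> z)\<^sup>2)"
    by (rule lateral_continuous_comp[OF lateral_continuous_test[OF \<phi>]])
      (auto intro!: continuous_intros cexp c)
  have l2: "lateral_continuous \<Omega> (\<lambda>z. exp (- l * snd z) * (\<phi> z * time_deriv \<phi> z))"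
    by (rule lateral_continuous_comp[OF lateral_continuous_test[OF \<phi>]])
      (auto intro!: continuous_intros cexp c)
  note i = lateral_continuous_integrable[OF \<open>open \<Omega>\<close> l1, of T] lateral_continuous_integrable[OF \<open>open \<Omega>\<close> l2, of T]
  have "0 \<le> (LINT z|lebesgue_on (cylinder \<Omega> T).
      2 * (exp (- l * snd z) * (\<phi> z * time_deriv \<phi> z)) - l * (exp (- l * snd z) * (\<phi> z)\<^sup>2))"
  proof (rule integral_time_derivative_nonneg[OF assms(1,2), where \<psi>="\<lambda>z. exp (- l * snd z) * (\<phi> z)\<^sup>2"])
    show "lateral_continuous \<Omega> (\<lambda>z. 2 * (exp (- l * snd z) * (\<phi> z * time_deriv \<phi> z)) - l * (exp (- l * snd z) * (\<phi> z)\<^sup>2))"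
      by (rule lateral_continuous_comp[OF lateral_continuous_test[OF \<phi>]])
        (auto intro!: continuous_intros cexp c)
    fix x t
    show "((\<lambda>s. exp (- l * snd (x, s)) * (\<phi> (x, s))\<^sup>2) has_real_derivative
      2 * (exp (- l * snd (x, t)) * (\<phi> (x, t) * time_deriv \<phi> (x, t))) - l * (exp (- l * snd (x, t)) * (\<phi> (x, t))\<^sup>2)) (at t)"
      using C_infinity_time_derivative[OF lateral_test_C_infinity[OF \<phi>], of x t]
      by (auto intro!: derivative_eq_intros simp: time_deriv_def algebra_simps)
  qed (simp_all add: 0)
  then show ?thesis using i by simp
qed

text \<open>The coefficient \<open>l / 4\<close> is half of the \<open>l / 2\<close> that
  \<open>weighted_energy\<close> provides, so the second term can be absorbed there.\<close>

lemma weighted_Young: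
  fixes l w x y :: real
  assumes "0 < l" "0 < w"
  shows "\<bar>x * y\<bar> \<le> (1 / l) * (w * x\<^sup>2) + (l / 4) * (inverse w * y\<^sup>2)"
proof -
  have "0 \<le> (2 * w * \<bar>x\<bar> - l * \<bar>y\<bar>)\<^sup>2 / (4 * l * w)"
    using assms by simp
  also have "\<dots> = (1 / l) * (w * \<bar>x\<bar>\<^sup>2) + (l / 4) * (inverse w * \<bar>y\<bar>\<^sup>2) - \<bar>x\<bar> * \<bar>y\<bar>"
    using assms by (simp add: field_simps power2_eq_square del: abs_mult_self_eq)
  finally show ?thesis by (simp add: abs_mult)
qed

text \<open>The weighted primitive \<open>P\<close> of a test function \<open>\<phi>\<close> vanishes at \<open>t = 0\<close> and is therefore an
  admissible test function, although \<open>\<phi>\<close> is not.\<close>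

definition weighted_primitive :: "real \<Rightarrow> ('a::euclidean_space \<times> real \<Rightarrow> real) \<Rightarrow> 'a \<times> real \<Rightarrow> real" where
  "weighted_primitive l \<phi> = time_primitive (\<lambda>z. exp (l * snd z) * \<phi> z)"

lemma lateral_test_weighted_primitive:
  "\<phi> \<in> lateral_test \<Omega> \<Longrightarrow> weighted_primitive l \<phi> \<in> lateral_test \<Omega>"
  unfolding weighted_primitive_def by (intro lateral_test_time_primitive lateral_test_exp)

lemma weighted_primitive_0: "weighted_primitive l \<phi> (x, 0) = 0"
  by (simp add: weighted_primitive_def time_primitive_0)

lemma
  fixes \<phi> :: "(real^'n) \<times> real \<Rightarrow> real"
  assumes "\<phi> \<in> lateral_test \<Omega>"
  shows time_deriv_weighted_primitive: "time_deriv (weighted_primitive l \<phi>) z = exp (l * snd z) * \<phi> z"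
    and space_grad_weighted_primitive:
      "space_grad (weighted_primitive l \<phi>) z $ i
        = weighted_primitive l (\<lambda>z. frechet_derivative \<phi> (at z) (axis i 1, 0)) z"
proof -
  have C: "C_infinity (\<lambda>z. exp (l * snd z) * \<phi> z)"
    using lateral_test_C_infinity[OF lateral_test_exp[OF assms]] .
  show "time_deriv (weighted_primitive l \<phi>) z = exp (l * snd z) * \<phi> z"
    using time_primitive_time_deriv[OF C] by (simp add: time_deriv_def weighted_primitive_def)
  have "frechet_derivative (\<lambda>z. exp (l * snd z) * \<phi> z) (at z) (axis i 1, 0)
      = exp (l * snd z) * frechet_derivative \<phi> (at z) (axis i 1, 0)" for z
    using space_grad_exp[OF lateral_test_C_infinity[OF assms], of l z]
    by (simp add: space_grad_def vec_eq_iff)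
  then show "space_grad (weighted_primitive l \<phi>) z $ i
        = weighted_primitive l (\<lambda>z. frechet_derivative \<phi> (at z) (axis i 1, 0)) z"
    using time_primitive_space_deriv[OF C] by (simp add: space_grad_def weighted_primitive_def)
qed

lemma lateral_L2:
  assumes "open \<Omega>" "\<phi> \<in> lateral_test \<Omega>"
  shows "\<phi> \<in> L2 (lebesgue_on (cylinder \<Omega> T))"
    and "time_deriv \<phi> \<in> L2 (lebesgue_on (cylinder \<Omega> T))"
    and "space_grad \<phi> \<in> L2 (lebesgue_on (cylinder \<Omega> T))"
  using assms by (auto intro: lateral_continuous_L2 lateral_continuous_test
      lateral_continuous_time_deriv lateral_continuous_space_grad)

text \<open>The time derivative of \<open>P\<close> carries the weight \<open>exp (l t)\<close> and
  the energy inequality for \<open>P\<close> the inverse weight, so \<open>P\<close> times its time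
  derivative becomes the unweighted product \<open>\<phi> P\<close>. This gives its sign; Young's
  inequality and absorption give the bounds.\<close>

lemma
  fixes \<phi> :: "(real^'n) \<times> real \<Rightarrow> real"
  assumes "open \<Omega>" "0 < T" "0 < l" and \<phi>: "\<phi> \<in> lateral_test \<Omega>"
  defines "Q \<equiv> lebesgue_on (cylinder \<Omega> T)" and "P \<equiv> weighted_primitive l \<phi>"
  shows weighted_primitive_nonneg: "0 \<le> (LINT z|Q. \<phi> z * P z)"
    and weighted_primitive_bound:
      "l / 4 * (LINT z|Q. exp (- l * snd z) * (P z)\<^sup>2) \<le> (LINT z|Q. exp (l * snd z) * (\<phi> z)\<^sup>2) / l"
    and weighted_primitive_L2_norm: "L2_norm Q P \<le> 2 * exp (l * T) / l * L2_norm Q \<phi>"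
proof -
  have P: "P \<in> lateral_test \<Omega>"
    unfolding P_def by (rule lateral_test_weighted_primitive[OF \<phi>])
  note c = lateral_continuous_continuous[OF lateral_continuous_test[OF \<phi>]]
    lateral_continuous_continuous[OF lateral_continuous_test[OF P]]
  have L: "lateral_continuous \<Omega> (\<lambda>z. exp (- l * snd z) * (P z)\<^sup>2)"
    "lateral_continuous \<Omega> (\<lambda>z. exp (l * snd z) * (\<phi> z)\<^sup>2)"
    "lateral_continuous \<Omega> (\<lambda>z. \<phi> z * P z)" "lateral_continuous \<Omega> (\<lambda>z. (\<phi> z)\<^sup>2)" "lateral_continuous \<Omega> (\<lambda>z. (P z)\<^sup>2)"
    subgoal by (rule lateral_continuous_comp[OF lateral_continuous_test[OF P]]) (auto intro!: continuous_intros c)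
    subgoal by (rule lateral_continuous_comp[OF lateral_continuous_test[OF \<phi>]]) (auto intro!: continuous_intros c)
    subgoal by (rule lateral_continuous_comp[OF lateral_continuous_test[OF \<phi>]]) (auto intro!: continuous_intros c)
    subgoal by (rule lateral_continuous_comp[OF lateral_continuous_test[OF \<phi>]]) (auto intro!: continuous_intros c)
    subgoal by (rule lateral_continuous_comp[OF lateral_continuous_test[OF P]]) (auto intro!: continuous_intros c)
    done
  note i = L[THEN lateral_continuous_integrable[OF \<open>open \<Omega>\<close>, of _ T], folded Q_def]
  define X Y where "X = (LINT z|Q. exp (l * snd z) * (\<phi> z)\<^sup>2)" and "Y = (LINT z|Q. exp (- l * snd z) * (P z)\<^sup>2)"
  have e: "exp (- l * snd z) * (P z * time_deriv P z) = \<phi> z * P z" for z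
    by (simp add: P_def time_deriv_weighted_primitive[OF \<phi>] flip: exp_add mult.assoc)
  have en: "l * Y \<le> 2 * (LINT z|Q. \<phi> z * P z)"
    using weighted_energy[OF assms(1,2) P, of l] unfolding e Q_def Y_def
    by (simp only: P_def weighted_primitive_0 simp_thms)
  have "0 \<le> Y" unfolding Y_def by (rule Bochner_Integration.integral_nonneg) simp
  then show "0 \<le> (LINT z|Q. \<phi> z * P z)" using en \<open>0 < l\<close> by (smt (verit) mult_nonneg_nonneg)
  have "(LINT z|Q. \<phi> z * P z) \<le> (LINT z|Q. (1 / l) * (exp (l * snd z) * (\<phi> z)\<^sup>2) + (l / 4) * (exp (- l * snd z) * (P z)\<^sup>2))"
  proof (rule integral_mono)
    fix z
    show "\<phi> z * P z \<le> (1 / l) * (exp (l * snd z) * (\<phi> z)\<^sup>2) + (l / 4) * (exp (- l * snd z) * (P z)\<^sup>2)"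
      using weighted_Young[of l "exp (l * snd z)" "\<phi> z" "P z"] \<open>0 < l\<close> by (auto simp: exp_minus)
  qed (use i in auto)
  also have "\<dots> = X / l + l / 4 * Y" using i by (simp add: X_def Y_def)
  finally have bd: "l / 4 * Y \<le> X / l" using en by argo
  then show "l / 4 * (LINT z|Q. exp (- l * snd z) * (P z)\<^sup>2) \<le> (LINT z|Q. exp (l * snd z) * (\<phi> z)\<^sup>2) / l"
    by (simp add: X_def Y_def)
  have sp: "0 < snd z \<and> snd z < T" if "z \<in> space Q" for z
    using that by (auto simp: Q_def cylinder_def)
  have "exp (- l * T) * (LINT z|Q. (P z)\<^sup>2) = (LINT z|Q. exp (- l * T) * (P z)\<^sup>2)" by simp
  also have "\<dots> \<le> Y"
    unfolding Y_def using i \<open>0 < l\<close> sp by (intro integral_mono mult_right_mono) (auto dest!: sp)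
  finally have Y: "exp (- l * T) * (L2_norm Q P)\<^sup>2 \<le> Y" by (simp add: L2_norm_power2)
  have "X \<le> (LINT z|Q. exp (l * T) * (\<phi> z)\<^sup>2)"
    unfolding X_def using i \<open>0 < l\<close> sp by (intro integral_mono mult_right_mono) (auto dest!: sp)
  then have X: "X \<le> exp (l * T) * (L2_norm Q \<phi>)\<^sup>2" by (simp add: L2_norm_power2)
  \<comment> \<open>Removing the weight of \<open>P\<close> costs a factor \<open>exp (l T)\<close>,
    removing that of \<open>\<phi>\<close> another one, and \<open>bd\<close> contributes
    \<open>4 / l^2\<close>; the root of the product is the claimed constant.\<close>
  have "(L2_norm Q P)\<^sup>2 = exp (l * T) * (exp (- l * T) * (L2_norm Q P)\<^sup>2)"
    by (simp add: exp_minus)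
  also have "\<dots> \<le> exp (l * T) * Y" using Y by simp
  also have "\<dots> \<le> exp (l * T) * (4 / l\<^sup>2 * X)"
    using bd \<open>0 < l\<close> by (simp add: field_simps power2_eq_square)
  also have "\<dots> \<le> exp (l * T) * (4 / l\<^sup>2 * (exp (l * T) * (L2_norm Q \<phi>)\<^sup>2))"
    using X by (intro mult_left_mono) auto
  also have "\<dots> = (2 * exp (l * T) / l * L2_norm Q \<phi>)\<^sup>2"
    by (simp add: power_mult_distrib power_divide) (simp add: power2_eq_square)
  finally show "L2_norm Q P \<le> 2 * exp (l * T) / l * L2_norm Q \<phi>"
    by (rule power2_le_imp_le) (use \<open>0 < l\<close> in \<open>simp add: L2_norm_nonneg\<close>)
qed

section \<open>Existence and uniqueness of weak solutions\<close>

locale parabolic_problem =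
  fixes \<Omega> :: "(real^'n) set" and T \<nu> :: real and a0 :: "(real^'n) \<times> real \<Rightarrow> real"
  assumes open_\<Omega>: "open \<Omega>" and T: "0 < T" and \<nu>: "0 < \<nu>"
    and a0: "a0 \<in> Linfty (lebesgue_on (cylinder \<Omega> T))"
    and a0_nonneg: "AE z in lebesgue_on (cylinder \<Omega> T). 0 \<le> a0 z"
begin

abbreviation "Q \<equiv> lebesgue_on (cylinder \<Omega> T)"

lemma space_Q: "z \<in> space Q \<Longrightarrow> 0 < snd z \<and> snd z < T"
  by (auto simp: cylinder_def)

text \<open>Value and spatial gradient in one vector: the L2 norm of a jet is the norm of the energy
  space, so completeness and Riesz representation in a single L2 space apply to it.\<close>

definition jet :: "((real^'n) \<times> real \<Rightarrow> real) \<Rightarrow> (real^'n) \<times> real \<Rightarrow> real \<times> (real^'n)" where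
  "jet \<phi> z = (\<phi> z, space_grad \<phi> z)"

text \<open>The left-hand side of the weak formulation is the \<open>L\<^sup>2\<close> inner product of \<open>(p, \<nabla>p)\<close> with
  \<open>dual_jet \<phi>\<close>.\<close>

definition dual_jet :: "((real^'n) \<times> real \<Rightarrow> real) \<Rightarrow> (real^'n) \<times> real \<Rightarrow> real \<times> (real^'n)" where
  "dual_jet \<phi> z = (time_deriv \<phi> z + a0 z * \<phi> z, \<nu> *\<^sub>R space_grad \<phi> z)"

definition initial_test :: "((real^'n) \<times> real \<Rightarrow> real) set" where
  "initial_test = {\<phi> \<in> lateral_test \<Omega>. \<forall>x. \<phi> (x, 0) = 0}"

lemma a0_bound:
  obtains B where "0 \<le> B" "AE z in Q. \<bar>a0 z\<bar> \<le> B"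
proof -
  obtain B where "AE z in Q. \<bar>a0 z\<bar> \<le> B" using a0 by (auto simp: Linfty_def)
  then have "AE z in Q. \<bar>a0 z\<bar> \<le> max B 0" by eventually_elim simp
  then show thesis by (intro that[of "max B 0"]) auto
qed

lemma a0_measurable: "a0 \<in> borel_measurable Q"
  using a0 by (simp add: Linfty_def)

lemmas test_L2 = lateral_L2[OF open_\<Omega>, where T=T]

lemma a0_L2:
  assumes "f \<in> L2 Q"
  shows "(\<lambda>z. a0 z * f z) \<in> L2 Q"
proof -
  obtain B where "AE z in Q. \<bar>a0 z\<bar> \<le> B" by (rule a0_bound)
  then show ?thesis by (rule L2_mult_bounded(1)[OF assms a0_measurable])
qed

lemma jet_L2: "\<phi> \<in> lateral_test \<Omega> \<Longrightarrow> jet \<phi> \<in> L2 Q"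
  unfolding jet_def[abs_def] by (rule L2_Pair[OF test_L2(1) test_L2(3)])

lemma dual_jet_L2: "\<phi> \<in> lateral_test \<Omega> \<Longrightarrow> dual_jet \<phi> \<in> L2 Q"
  unfolding dual_jet_def[abs_def]
  by (rule L2_Pair[OF L2_add[OF test_L2(2) a0_L2[OF test_L2(1)]] L2_scaleR[OF test_L2(3)]])

lemma jet_lincomb:
  assumes "\<phi> \<in> lateral_test \<Omega>" "\<psi> \<in> lateral_test \<Omega>"
  shows "jet (\<lambda>z. s * \<phi> z + t * \<psi> z) = (\<lambda>z. s *\<^sub>R jet \<phi> z + t *\<^sub>R jet \<psi> z)"
  by (rule ext) (simp add: jet_def space_grad_lincomb[OF assms[THEN lateral_test_C_infinity]])

lemma dual_jet_lincomb:
  assumes "\<phi> \<in> lateral_test \<Omega>" "\<psi> \<in> lateral_test \<Omega>"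
  shows "dual_jet (\<lambda>z. s * \<phi> z + t * \<psi> z) = (\<lambda>z. s *\<^sub>R dual_jet \<phi> z + t *\<^sub>R dual_jet \<psi> z)"
  by (rule ext) (simp add: dual_jet_def space_grad_lincomb[OF assms[THEN lateral_test_C_infinity]]
      time_deriv_lincomb[OF assms[THEN lateral_test_C_infinity]] algebra_simps)

lemma dual_jet_inner:
  "L2_inner Q (\<lambda>z. (p z, g z)) (dual_jet \<phi>)
    = (LINT z|Q. p z * time_deriv \<phi> z + \<nu> * (g z \<bullet> space_grad \<phi> z) + a0 z * p z * \<phi> z)"
  by (simp add: L2_inner_def dual_jet_def algebra_simps)

section \<open>The energy space as a closed set of pairs\<close>

definition jet_closure :: "((real^'n) \<times> real \<Rightarrow> real \<times> (real^'n)) set" where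
  "jet_closure = {v \<in> L2 Q. \<exists>\<phi>. (\<forall>k::nat. \<phi> k \<in> lateral_test \<Omega>) \<and>
     (\<lambda>k. L2_norm Q (\<lambda>z. jet (\<phi> k) z - v z)) \<longlonglongrightarrow> 0}"

lemma jet_closure_L2: "v \<in> jet_closure \<Longrightarrow> v \<in> L2 Q"
  by (simp add: jet_closure_def)

lemma jet_in_closure: "\<phi> \<in> lateral_test \<Omega> \<Longrightarrow> jet \<phi> \<in> jet_closure"
  by (auto simp: jet_closure_def jet_L2 L2_norm_def intro!: exI[of _ "\<lambda>_. \<phi>"])

lemma jet_closure_iff: "(\<lambda>z. (p z, g z)) \<in> jet_closure \<longleftrightarrow> L2_H10 \<Omega> T p g"
proof
  assume v: "(\<lambda>z. (p z, g z)) \<in> jet_closure"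
  then obtain \<phi> where \<phi>: "\<And>k::nat. \<phi> k \<in> lateral_test \<Omega>"
    and lim: "(\<lambda>k. L2_norm Q (\<lambda>z. jet (\<phi> k) z - (p z, g z))) \<longlonglongrightarrow> 0"
    unfolding jet_closure_def by auto
  have pg: "p \<in> L2 Q" "g \<in> L2 Q"
    using L2_fst[OF jet_closure_L2[OF v]] L2_snd[OF jet_closure_L2[OF v]] by simp_all
  have e: "jet (\<phi> k) z - (p z, g z) = (\<phi> k z - p z, space_grad (\<phi> k) z - g z)" for k z
    by (simp add: jet_def)
  have d: "(\<lambda>z. \<phi> k z - p z) \<in> L2 Q" "(\<lambda>z. space_grad (\<phi> k) z - g z) \<in> L2 Q" for k
    by (intro L2_diff test_L2 \<phi> pg)+
  have "(\<lambda>k. L2_norm Q (\<lambda>z. \<phi> k z - p z)) \<longlonglongrightarrow> 0"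
    by (rule Lim_null_comparison[OF _ lim])
      (use L2_norm_Pair_ge1[OF d] in \<open>simp add: e L2_norm_nonneg\<close>)
  moreover have "(\<lambda>k. L2_norm Q (\<lambda>z. space_grad (\<phi> k) z - g z)) \<longlonglongrightarrow> 0"
    by (rule Lim_null_comparison[OF _ lim])
      (use L2_norm_Pair_ge2[OF d] in \<open>simp add: e L2_norm_nonneg\<close>)
  ultimately show "L2_H10 \<Omega> T p g"
    using \<phi> pg by (auto simp: L2_H10_def Let_def)
next
  assume "L2_H10 \<Omega> T p g"
  then obtain \<phi> where \<phi>: "\<And>k::nat. \<phi> k \<in> lateral_test \<Omega>" and pg: "p \<in> L2 Q" "g \<in> L2 Q"
    and lim: "(\<lambda>k. L2_norm Q (\<lambda>z. \<phi> k z - p z)) \<longlonglongrightarrow> 0" "(\<lambda>k. L2_norm Q (\<lambda>z. space_grad (\<phi> k) z - g z)) \<longlonglongrightarrow> 0"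
    unfolding L2_H10_def Let_def by blast
  have e: "jet (\<phi> k) z - (p z, g z) = (\<phi> k z - p z, space_grad (\<phi> k) z - g z)" for k z
    by (simp add: jet_def)
  have d: "(\<lambda>z. \<phi> k z - p z) \<in> L2 Q" "(\<lambda>z. space_grad (\<phi> k) z - g z) \<in> L2 Q" for k
    by (intro L2_diff test_L2 \<phi> pg)+
  have "(\<lambda>k. L2_norm Q (\<lambda>z. jet (\<phi> k) z - (p z, g z))) \<longlonglongrightarrow> 0"
    by (rule Lim_null_comparison[OF _ tendsto_add_zero[OF lim]])
      (use L2_norm_Pair_le[OF d] in \<open>simp add: e L2_norm_nonneg\<close>)
  then show "(\<lambda>z. (p z, g z)) \<in> jet_closure"
    using \<phi> L2_Pair[OF pg] by (auto simp: jet_closure_def)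
qed

lemma jet_closure_lincomb:
  assumes "u \<in> jet_closure" "v \<in> jet_closure"
  shows "(\<lambda>z. s *\<^sub>R u z + t *\<^sub>R v z) \<in> jet_closure"
proof -
  obtain \<phi> \<psi> where \<phi>: "\<And>k::nat. \<phi> k \<in> lateral_test \<Omega>" "(\<lambda>k. L2_norm Q (\<lambda>z. jet (\<phi> k) z - u z)) \<longlonglongrightarrow> 0"
    and \<psi>: "\<And>k::nat. \<psi> k \<in> lateral_test \<Omega>" "(\<lambda>k. L2_norm Q (\<lambda>z. jet (\<psi> k) z - v z)) \<longlonglongrightarrow> 0"
    using assms unfolding jet_closure_def by auto
  note uv = assms[THEN jet_closure_L2]
  define \<xi> where "\<xi> k z = s * \<phi> k z + t * \<psi> k z" for k z
  have \<xi>: "\<xi> k \<in> lateral_test \<Omega>" for k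
    unfolding \<xi>_def[abs_def] by (intro lateral_test_lincomb \<phi> \<psi>)
  have "L2_norm Q (\<lambda>z. jet (\<xi> k) z - (s *\<^sub>R u z + t *\<^sub>R v z))
      \<le> \<bar>s\<bar> * L2_norm Q (\<lambda>z. jet (\<phi> k) z - u z) + \<bar>t\<bar> * L2_norm Q (\<lambda>z. jet (\<psi> k) z - v z)" for k
  proof -
    have "jet (\<xi> k) z - (s *\<^sub>R u z + t *\<^sub>R v z) = s *\<^sub>R (jet (\<phi> k) z - u z) + t *\<^sub>R (jet (\<psi> k) z - v z)" for z
      unfolding \<xi>_def[abs_def] jet_lincomb[OF \<phi>(1) \<psi>(1)] by (simp add: algebra_simps)
    then show ?thesis
      using L2_norm_triangle[OF L2_scaleR[OF L2_diff[OF jet_L2[OF \<phi>(1)] uv(1)], of s] L2_scaleR[OF L2_diff[OF jet_L2[OF \<psi>(1)] uv(2)], of t]]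
      by (simp add: L2_norm_scaleR)
  qed
  then have "(\<lambda>k. L2_norm Q (\<lambda>z. jet (\<xi> k) z - (s *\<^sub>R u z + t *\<^sub>R v z))) \<longlonglongrightarrow> 0"
    by (intro Lim_null_comparison[OF always_eventually
          tendsto_add_zero[OF tendsto_mult_right_zero[OF \<phi>(2)] tendsto_mult_right_zero[OF \<psi>(2)]]])
      (auto simp: L2_norm_nonneg)
  then show ?thesis
    using \<xi> L2_add[OF L2_scaleR[OF uv(1)] L2_scaleR[OF uv(2)]] by (auto simp: jet_closure_def)
qed

text \<open>A diagonal choice: for each \<open>n\<close> a jet within \<open>1 / (n + 1)\<close> of
  \<open>x n\<close>.\<close>

lemma jet_closure_closed:
  assumes x: "\<And>n::nat. x n \<in> jet_closure" and v: "v \<in> L2 Q"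
    and lim: "(\<lambda>n. L2_norm Q (\<lambda>z. x n z - v z)) \<longlonglongrightarrow> 0"
  shows "v \<in> jet_closure"
proof -
  have ex: "\<exists>\<phi>\<in>lateral_test \<Omega>. L2_norm Q (\<lambda>z. jet \<phi> z - x n z) < inverse (real (Suc n))" for n
  proof -
    obtain \<phi> where \<phi>: "\<And>k::nat. \<phi> k \<in> lateral_test \<Omega>" "(\<lambda>k. L2_norm Q (\<lambda>z. jet (\<phi> k) z - x n z)) \<longlonglongrightarrow> 0"
      using x[of n] unfolding jet_closure_def by auto
    have "eventually (\<lambda>k. L2_norm Q (\<lambda>z. jet (\<phi> k) z - x n z) < inverse (real (Suc n))) sequentially"
      using order_tendstoD(2)[OF \<phi>(2)] by simp
    then show ?thesis using \<phi>(1) eventually_happens'[OF sequentially_bot] by blast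
  qed
  have "\<exists>\<phi>. \<forall>n. \<phi> n \<in> lateral_test \<Omega> \<and> L2_norm Q (\<lambda>z. jet (\<phi> n) z - x n z) < inverse (real (Suc n))"
    using ex by (intro choice allI) blast
  then obtain \<phi> where \<phi>: "\<And>n. \<phi> n \<in> lateral_test \<Omega>"
    "\<And>n. L2_norm Q (\<lambda>z. jet (\<phi> n) z - x n z) < inverse (real (Suc n))"
    by blast
  have "(\<lambda>n. L2_norm Q (\<lambda>z. jet (\<phi> n) z - v z)) \<longlonglongrightarrow> 0"
  proof (rule Lim_null_comparison[OF _ tendsto_add_zero[OF LIMSEQ_inverse_real_of_nat lim]])
    show "\<forall>\<^sub>F n in sequentially. norm (L2_norm Q (\<lambda>z. jet (\<phi> n) z - v z))
        \<le> inverse (real (Suc n)) + L2_norm Q (\<lambda>z. x n z - v z)"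
    proof (intro always_eventually allI)
      fix n
      show "norm (L2_norm Q (\<lambda>z. jet (\<phi> n) z - v z)) \<le> inverse (real (Suc n)) + L2_norm Q (\<lambda>z. x n z - v z)"
        using L2_norm_triangle_diff[OF jet_L2[OF \<phi>(1)] jet_closure_L2[OF x] v, of n n] \<phi>(2)[of n]
        by (simp add: L2_norm_nonneg)
    qed
  qed
  then show ?thesis using \<phi>(1) v by (auto simp: jet_closure_def)
qed

text \<open>Density of the jets and continuity of the inner product. This later exchanges a Riesz
  representative for the \<open>dual_jet\<close> that it represents.\<close>

lemma jet_closure_inner_eq:
  assumes "v \<in> jet_closure" "w \<in> L2 Q" "k \<in> L2 Q"
    and "\<And>\<eta>. \<eta> \<in> lateral_test \<Omega> \<Longrightarrow> L2_inner Q (jet \<eta>) w = L2_inner Q (jet \<eta>) k"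
  shows "L2_inner Q v w = L2_inner Q v k"
proof -
  obtain \<phi> where \<phi>: "\<And>k::nat. \<phi> k \<in> lateral_test \<Omega>" "(\<lambda>k. L2_norm Q (\<lambda>z. jet (\<phi> k) z - v z)) \<longlonglongrightarrow> 0"
    using assms(1) unfolding jet_closure_def by auto
  note l = L2_inner_tendsto[OF jet_L2[OF \<phi>(1)] jet_closure_L2[OF assms(1)] _ \<phi>(2)]
  show ?thesis
    using l[OF assms(2)] l[OF assms(3)] unfolding assms(4)[OF \<phi>(1)] by (rule LIMSEQ_unique)
qed

lemma initial_test_lateral: "\<phi> \<in> initial_test \<Longrightarrow> \<phi> \<in> lateral_test \<Omega>"
  by (simp add: initial_test_def)

lemma weak_solution_iff:
  "weak_solution \<Omega> T \<nu> a0 q p \<longleftrightarrow> (\<exists>g. (\<lambda>z. (p z, g z)) \<in> jet_closure \<and>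
     (\<forall>\<phi>\<in>initial_test. L2_inner Q (\<lambda>z. (p z, g z)) (dual_jet \<phi>) = L2_inner Q q \<phi>))"
  unfolding weak_solution_def jet_closure_iff dual_jet_inner Let_def
  by (auto simp: initial_test_def L2_inner_def)

section \<open>Coercivity and existence\<close>

lemma jet_exp:
  assumes "\<phi> \<in> lateral_test \<Omega>"
  shows "jet (\<lambda>z. exp (l * snd z) * \<phi> z) z = exp (l * snd z) *\<^sub>R jet \<phi> z"
  using space_grad_exp[OF lateral_test_C_infinity[OF assms], of l z] by (simp add: jet_def)

text \<open>Coercivity in the sense of Lions: the form need not be coercive on the diagonal, but pairing
  \<open>\<phi>\<close> with \<open>exp (-t) \<phi>\<close> controls \<open>\<phi>\<close> itself, since the weight produces a term \<open>\<phi>\<^sup>2 / 2\<close>.\<close>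

lemma dual_jet_coercive:
  assumes "\<phi> \<in> initial_test"
  defines "\<eta> \<equiv> \<lambda>z. exp (- 1 * snd z) * \<phi> z"
  shows "exp (- T) * min (1 / 2) \<nu> * (L2_norm Q (jet \<phi>))\<^sup>2 \<le> L2_inner Q (jet \<eta>) (dual_jet \<phi>)"
    and "L2_norm Q (jet \<eta>) \<le> L2_norm Q (jet \<phi>)"
proof -
  note \<phi> = initial_test_lateral[OF assms(1)]
  have \<eta>: "\<eta> \<in> lateral_test \<Omega>" unfolding \<eta>_def by (rule lateral_test_exp[OF \<phi>])
  have grad\<eta>: "space_grad \<eta> z = exp (- 1 * snd z) *\<^sub>R space_grad \<phi> z" for z
    unfolding \<eta>_def by (rule space_grad_exp[OF lateral_test_C_infinity[OF \<phi>]])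
  have i1: "integrable Q (\<lambda>z. \<eta> z * time_deriv \<phi> z)"
    by (rule L2_mult_integrable[OF test_L2(1)[OF \<eta>] test_L2(2)[OF \<phi>]])
  have i2: "integrable Q (\<lambda>z. \<eta> z * (a0 z * \<phi> z))"
    by (rule L2_mult_integrable[OF test_L2(1)[OF \<eta>] a0_L2[OF test_L2(1)[OF \<phi>]]])
  have i3: "integrable Q (\<lambda>z. space_grad \<eta> z \<bullet> space_grad \<phi> z)"
    by (rule L2_inner_integrable[OF test_L2(3)[OF \<eta>] test_L2(3)[OF \<phi>]])
  have i4: "integrable Q (\<lambda>z. \<eta> z * \<phi> z)"
    by (rule L2_mult_integrable[OF test_L2(1)[OF \<eta>] test_L2(1)[OF \<phi>]])
  have S: "L2_inner Q (jet \<eta>) (dual_jet \<phi>) = (LINT z|Q. \<eta> z * time_deriv \<phi> z)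
      + (LINT z|Q. \<eta> z * (a0 z * \<phi> z)) + \<nu> * (LINT z|Q. space_grad \<eta> z \<bullet> space_grad \<phi> z)"
    unfolding L2_inner_def jet_def dual_jet_def using i1 i2 i3 by (simp add: distrib_left)
  have en: "(LINT z|Q. \<eta> z * \<phi> z) \<le> 2 * (LINT z|Q. \<eta> z * time_deriv \<phi> z)"
    using weighted_energy[OF open_\<Omega> T \<phi>, of 1] assms(1)
    by (simp add: \<eta>_def initial_test_def power2_eq_square mult.assoc)
  let ?m = "exp (- T) * min (1 / 2) \<nu>"
  have "?m * (L2_norm Q (jet \<phi>))\<^sup>2 = (LINT z|Q. ?m * (norm (jet \<phi> z))\<^sup>2)"
    by (simp add: L2_norm_power2)
  also have "\<dots> \<le> (LINT z|Q. (\<eta> z * \<phi> z) / 2 + \<eta> z * (a0 z * \<phi> z) + \<nu> * (space_grad \<eta> z \<bullet> space_grad \<phi> z))"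
  proof (rule integral_mono_AE)
    show "integrable Q (\<lambda>z. ?m * (norm (jet \<phi> z))\<^sup>2)"
      using L2_integrable_sq[OF jet_L2[OF \<phi>]] by simp
    show "integrable Q (\<lambda>z. (\<eta> z * \<phi> z) / 2 + \<eta> z * (a0 z * \<phi> z) + \<nu> * (space_grad \<eta> z \<bullet> space_grad \<phi> z))"
      using i2 i3 i4 by simp
    show "AE z in Q. ?m * (norm (jet \<phi> z))\<^sup>2
        \<le> (\<eta> z * \<phi> z) / 2 + \<eta> z * (a0 z * \<phi> z) + \<nu> * (space_grad \<eta> z \<bullet> space_grad \<phi> z)"
      using a0_nonneg AE_space
    proof eventually_elim
      case (elim z)
      define e where "e = exp (- 1 * snd z)"
      have e: "exp (- T) \<le> e" "0 < e" using space_Q[OF elim(2)] by (auto simp: e_def)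
      have "?m * (norm (jet \<phi> z))\<^sup>2 = exp (- T) * (min (1 / 2) \<nu> * (\<phi> z)\<^sup>2 + min (1 / 2) \<nu> * (norm (space_grad \<phi> z))\<^sup>2)"
        by (simp add: jet_def norm_Pair algebra_simps)
      also have "\<dots> \<le> e * ((1 / 2) * (\<phi> z)\<^sup>2 + \<nu> * (norm (space_grad \<phi> z))\<^sup>2)"
        using e \<nu> by (intro mult_mono add_mono mult_right_mono) auto
      \<comment> \<open>The potential term may be added because \<open>0 \<le> a0\<close> almost
        everywhere.\<close>
      also have "\<dots> \<le> e * ((1 / 2) * (\<phi> z)\<^sup>2 + \<nu> * (norm (space_grad \<phi> z))\<^sup>2) + e * (a0 z * (\<phi> z)\<^sup>2)"
        using e elim(1) by simp
      also have "\<dots> = (\<eta> z * \<phi> z) / 2 + \<eta> z * (a0 z * \<phi> z) + \<nu> * (space_grad \<eta> z \<bullet> space_grad \<phi> z)"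
        unfolding grad\<eta> unfolding \<eta>_def e_def[symmetric]
        by (simp add: power2_norm_eq_inner power2_eq_square[of "\<phi> z"] algebra_simps)
      finally show ?case .
    qed
  qed
  also have "\<dots> \<le> L2_inner Q (jet \<eta>) (dual_jet \<phi>)"
    unfolding S using i2 i3 i4 en by simp
  finally show "?m * (L2_norm Q (jet \<phi>))\<^sup>2 \<le> L2_inner Q (jet \<eta>) (dual_jet \<phi>)" .
  show "L2_norm Q (jet \<eta>) \<le> L2_norm Q (jet \<phi>)"
  proof (rule L2_norm_mono[OF jet_L2[OF \<eta>] jet_L2[OF \<phi>]])
    show "AE z in Q. norm (jet \<eta> z) \<le> norm (jet \<phi> z)"
      using AE_space
    proof eventually_elim
      case (elim z)
      then show ?case
        using space_Q[OF elim] mult_right_mono[of "exp (- 1 * snd z)" 1 "norm (jet \<phi> z)"]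
        unfolding \<eta>_def jet_exp[OF \<phi>] by simp
    qed
  qed
qed

text \<open>\<open>dual_jet \<phi>\<close> need not lie in the closure of the jets; \<open>w\<close>
  is its orthogonal projection there. A solution obtained as a limit of such vectors stays in the
  energy space and thus keeps the Dirichlet condition.\<close>

lemma dual_jet_Riesz:
  assumes "\<phi> \<in> lateral_test \<Omega>"
  obtains w where "w \<in> jet_closure"
    "\<And>\<eta>. \<eta> \<in> lateral_test \<Omega> \<Longrightarrow> L2_inner Q (jet \<eta>) w = L2_inner Q (jet \<eta>) (dual_jet \<phi>)"
proof -
  define A where "A = (\<lambda>\<eta>. (jet \<eta>, L2_inner Q (jet \<eta>) (dual_jet \<phi>))) ` lateral_test \<Omega>"
  have ne: "A \<noteq> {}" using assms by (auto simp: A_def)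
  have L2: "u \<in> L2 Q" if "(u, c) \<in> A" for u c using that by (auto simp: A_def jet_L2)
  have lin: "(\<lambda>z. s *\<^sub>R u z + t *\<^sub>R v z, s * c + t * d) \<in> A" if uv: "(u, c) \<in> A" "(v, d) \<in> A" for u v c d s t
  proof -
    obtain \<eta> \<xi> where \<eta>: "\<eta> \<in> lateral_test \<Omega>" "u = jet \<eta>" "c = L2_inner Q (jet \<eta>) (dual_jet \<phi>)"
      and \<xi>: "\<xi> \<in> lateral_test \<Omega>" "v = jet \<xi>" "d = L2_inner Q (jet \<xi>) (dual_jet \<phi>)"
      using uv by (auto simp: A_def)
    have "L2_inner Q (\<lambda>z. s *\<^sub>R jet \<eta> z + t *\<^sub>R jet \<xi> z) (dual_jet \<phi>) = s * c + t * d"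
      using \<eta> \<xi> assms by (simp add: L2_inner_add_left L2_inner_scaleR_left L2_scaleR jet_L2 dual_jet_L2)
    then show ?thesis
      unfolding A_def image_iff
      using lateral_test_lincomb[OF \<eta>(1) \<xi>(1), of s t] jet_lincomb[OF \<eta>(1) \<xi>(1), of s t] \<eta>(2) \<xi>(2)
      by (auto intro!: bexI[where x="\<lambda>z. s * \<eta> z + t * \<xi> z"])
  qed
  have bd: "c \<le> L2_norm Q (dual_jet \<phi>) * L2_norm Q u" if "(u, c) \<in> A" for u c
    using that L2_Cauchy_Schwarz[OF jet_L2 dual_jet_L2[OF assms]]
    by (force simp: A_def mult.commute)
  obtain w x where w: "w \<in> L2 Q" and x: "\<And>n::nat. x n \<in> fst ` A" and lim: "(\<lambda>n. L2_norm Q (\<lambda>z. x n z - w z)) \<longlonglongrightarrow> 0"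
    and inner: "\<And>u c. (u, c) \<in> A \<Longrightarrow> L2_inner Q w u = c"
    by (rule L2_Riesz[OF ne lin L2 bd]) (assumption+, rule that, blast+)
  \<comment> \<open>The approximants supplied by \<open>L2_Riesz\<close> come from its domain, here
    the jets themselves, so their limit lies in the closure.\<close>
  have "x n \<in> jet_closure" for n
    using x[of n] by (auto simp: A_def jet_in_closure)
  from jet_closure_closed[OF this w lim] have "w \<in> jet_closure" .
  moreover have "L2_inner Q (jet \<eta>) w = L2_inner Q (jet \<eta>) (dual_jet \<phi>)" if "\<eta> \<in> lateral_test \<Omega>" for \<eta>
    using inner[of "jet \<eta>"] that by (auto simp: A_def L2_inner_commute[of Q "jet \<eta>" w])
  ultimately show thesis by (rule that)
qed

text \<open>On the representatives \<open>w\<close> of the \<open>dual_jet \<phi>\<close> consider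
  the functional \<open>w \<mapsto> <q, \<phi>>\<close>. Coercivity gives
  \<open>m ||jet \<phi>|| \<le> ||w||\<close>, which makes it bounded, and the vector representing
  it is a solution paired with its gradient.\<close>

theorem weak_solution_exists:
  assumes q: "q \<in> L2 Q"
  shows "\<exists>p. weak_solution \<Omega> T \<nu> a0 q p"
proof -
  define R where "R w \<phi> \<longleftrightarrow> w \<in> jet_closure \<and> \<phi> \<in> initial_test \<and>
    (\<forall>\<eta>\<in>lateral_test \<Omega>. L2_inner Q (jet \<eta>) w = L2_inner Q (jet \<eta>) (dual_jet \<phi>))" for w \<phi>
  \<comment> \<open>Kept as a relation, so that no \<open>\<phi>\<close> has to be chosen for a
    given \<open>w\<close>; linearity and the bound \<open>bd\<close> make the value depend on
    \<open>w\<close> alone.\<close>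
  define A where "A = {(w, L2_inner Q q \<phi>) | w \<phi>. R w \<phi>}"
  have A_cases: "\<exists>\<phi>. R u \<phi> \<and> c = L2_inner Q q \<phi>" if "(u, c) \<in> A" for u c
    using that by (simp add: A_def) blast
  have A_I: "(w, L2_inner Q q \<phi>) \<in> A" if "R w \<phi>" for w \<phi>
    using that by (simp add: A_def) blast
  have R_ex: "\<exists>w. R w \<phi>" if \<phi>: "\<phi> \<in> initial_test" for \<phi>
  proof -
    obtain w where "w \<in> jet_closure"
      "\<And>\<eta>. \<eta> \<in> lateral_test \<Omega> \<Longrightarrow> L2_inner Q (jet \<eta>) w = L2_inner Q (jet \<eta>) (dual_jet \<phi>)"
      by (rule dual_jet_Riesz[OF initial_test_lateral[OF \<phi>]]) (rule that, blast+)
    then show ?thesis unfolding R_def using \<phi> by blast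
  qed
  define m where "m = exp (- T) * min (1 / 2) \<nu>"
  have m: "0 < m" using \<nu> by (simp add: m_def)
  have "(\<lambda>z. 0) \<in> lateral_test \<Omega>"
    by (auto simp: lateral_test_def C_infinity_def C_k_const intro!: exI[of _ "{}"])
  then have "(\<lambda>z. 0) \<in> initial_test" by (simp add: initial_test_def)
  then have ne: "A \<noteq> {}" using R_ex A_I by blast
  have L2: "u \<in> L2 Q" if "(u, c) \<in> A" for u c
    using A_cases[OF that] jet_closure_L2 unfolding R_def by blast
  have lin: "(\<lambda>z. s *\<^sub>R u z + t *\<^sub>R v z, s * c + t * d) \<in> A" if uv: "(u, c) \<in> A" "(v, d) \<in> A" for u v c d s t
  proof -
    obtain \<phi> where u: "R u \<phi>" "c = L2_inner Q q \<phi>" using A_cases[OF uv(1)] by blast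
    obtain \<psi> where v: "R v \<psi>" "d = L2_inner Q q \<psi>" using A_cases[OF uv(2)] by blast
    have c: "u \<in> jet_closure" "v \<in> jet_closure" and i: "\<phi> \<in> initial_test" "\<psi> \<in> initial_test"
      using u(1) v(1) by (simp_all add: R_def)
    note L = i[THEN initial_test_lateral]
    define \<xi> where "\<xi> = (\<lambda>z. s * \<phi> z + t * \<psi> z)"
    have \<xi>: "\<xi> \<in> initial_test"
      using lateral_test_lincomb[OF L] i by (simp add: \<xi>_def initial_test_def)
    have e: "L2_inner Q q \<xi> = s * c + t * d"
      using L2_inner_lincomb_right[OF test_L2(1)[OF L(1)] test_L2(1)[OF L(2)] q, of s t]
      by (simp add: \<xi>_def u(2) v(2))
    have "L2_inner Q (jet \<eta>) (\<lambda>z. s *\<^sub>R u z + t *\<^sub>R v z) = L2_inner Q (jet \<eta>) (dual_jet \<xi>)"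
      if \<eta>: "\<eta> \<in> lateral_test \<Omega>" for \<eta>
    proof -
      have "L2_inner Q (jet \<eta>) u = L2_inner Q (jet \<eta>) (dual_jet \<phi>)"
        "L2_inner Q (jet \<eta>) v = L2_inner Q (jet \<eta>) (dual_jet \<psi>)"
        using u(1) v(1) \<eta> unfolding R_def by blast+
      then show ?thesis
        unfolding \<xi>_def dual_jet_lincomb[OF L]
          L2_inner_lincomb_right[OF c[THEN jet_closure_L2] jet_L2[OF \<eta>]]
          L2_inner_lincomb_right[OF dual_jet_L2[OF L(1)] dual_jet_L2[OF L(2)] jet_L2[OF \<eta>]]
        by (simp only:)
    qed
    then have "R (\<lambda>z. s *\<^sub>R u z + t *\<^sub>R v z) \<xi>"
      unfolding R_def using jet_closure_lincomb[OF c, of s t] \<xi> by blast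
    from A_I[OF this] show ?thesis unfolding e .
  qed
  have bd: "c \<le> L2_norm Q q / m * L2_norm Q u" if uc: "(u, c) \<in> A" for u c
  proof -
    obtain \<phi> where u: "u \<in> jet_closure" "\<phi> \<in> initial_test" "c = L2_inner Q q \<phi>"
        "\<And>\<eta>. \<eta> \<in> lateral_test \<Omega> \<Longrightarrow> L2_inner Q (jet \<eta>) u = L2_inner Q (jet \<eta>) (dual_jet \<phi>)"
      using A_cases[OF uc] unfolding R_def by blast
    note \<phi> = initial_test_lateral[OF u(2)]
    define \<eta> where "\<eta> = (\<lambda>z. exp (- 1 * snd z) * \<phi> z)"
    have \<eta>: "\<eta> \<in> lateral_test \<Omega>" unfolding \<eta>_def by (rule lateral_test_exp[OF \<phi>])
    have "m * (L2_norm Q (jet \<phi>))\<^sup>2 \<le> L2_inner Q (jet \<eta>) (dual_jet \<phi>)"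
      unfolding m_def \<eta>_def by (rule dual_jet_coercive(1)[OF u(2)])
    also have "\<dots> = L2_inner Q (jet \<eta>) u" using u(4)[OF \<eta>] by simp
    also have "\<dots> \<le> L2_norm Q (jet \<eta>) * L2_norm Q u"
      using L2_Cauchy_Schwarz[OF jet_L2[OF \<eta>] jet_closure_L2[OF u(1)]] by simp
    also have "\<dots> \<le> L2_norm Q (jet \<phi>) * L2_norm Q u"
      unfolding \<eta>_def by (intro mult_right_mono dual_jet_coercive(2)[OF u(2)] L2_norm_nonneg)
    finally have *: "m * L2_norm Q (jet \<phi>) * L2_norm Q (jet \<phi>) \<le> L2_norm Q u * L2_norm Q (jet \<phi>)"
      by (simp add: power2_eq_square mult_ac)
    have "m * L2_norm Q (jet \<phi>) \<le> L2_norm Q u"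
    proof (cases "L2_norm Q (jet \<phi>) = 0")
      case False
      then show ?thesis using * L2_norm_nonneg[of Q "jet \<phi>"] by (simp add: mult_le_cancel_right)
    qed (simp add: L2_norm_nonneg)
    moreover have "L2_norm Q \<phi> \<le> L2_norm Q (jet \<phi>)"
      unfolding jet_def[abs_def] by (rule L2_norm_Pair_ge1[OF test_L2(1)[OF \<phi>] test_L2(3)[OF \<phi>]])
    ultimately have "L2_norm Q \<phi> \<le> L2_norm Q u / m"
      using m by (simp add: pos_le_divide_eq) (smt (verit) mult.commute mult_left_mono)
    then have "L2_norm Q q * L2_norm Q \<phi> \<le> L2_norm Q q * (L2_norm Q u / m)"
      by (intro mult_left_mono L2_norm_nonneg)
    then show ?thesis
      using L2_Cauchy_Schwarz[OF q test_L2(1)[OF \<phi>]] by (simp add: u(3))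
  qed
  obtain v x where v: "v \<in> L2 Q" and x: "\<And>n::nat. x n \<in> fst ` A" and lim: "(\<lambda>n. L2_norm Q (\<lambda>z. x n z - v z)) \<longlonglongrightarrow> 0"
    and inner: "\<And>u c. (u, c) \<in> A \<Longrightarrow> L2_inner Q v u = c"
    by (rule L2_Riesz[OF ne lin L2 bd]) (assumption+, rule that, blast+)
  have "x n \<in> jet_closure" for n
    using x[of n] A_cases unfolding R_def by fastforce
  from jet_closure_closed[OF this v lim] have vc: "v \<in> jet_closure" .
  have "L2_inner Q v (dual_jet \<phi>) = L2_inner Q q \<phi>" if \<phi>: "\<phi> \<in> initial_test" for \<phi>
  proof -
    obtain w where w: "R w \<phi>" using R_ex[OF \<phi>] by blast
    then have wc: "w \<in> jet_closure" by (simp add: R_def)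
    \<comment> \<open>Since \<open>v\<close> is in the closure of the jets, it cannot distinguish
      \<open>w\<close> from \<open>dual_jet \<phi>\<close>.\<close>
    have "L2_inner Q v w = L2_inner Q v (dual_jet \<phi>)"
      by (rule jet_closure_inner_eq[OF vc jet_closure_L2[OF wc] dual_jet_L2[OF initial_test_lateral[OF \<phi>]]])
        (use w in \<open>simp add: R_def\<close>)
    then show ?thesis using inner[OF A_I[OF w]] by simp
  qed
  then have "weak_solution \<Omega> T \<nu> a0 q (\<lambda>z. fst (v z))"
    unfolding weak_solution_iff using vc by (intro exI[of _ "\<lambda>z. snd (v z)"]) simp
  then show ?thesis by blast
qed

section \<open>A priori bound for weak solutions\<close>

lemma space_deriv_test:
  "\<phi> \<in> lateral_test \<Omega> \<Longrightarrow> (\<lambda>z. frechet_derivative \<phi> (at z) (axis i 1, 0)) \<in> lateral_test \<Omega>"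
  by (rule lateral_test_deriv) (simp_all add: Basis_prod_def axis_in_Basis_iff)

text \<open>Spatial derivatives commute with the weighted primitive, so each component of the
  gradient is an instance of \<open>weighted_primitive_nonneg\<close>.\<close>

lemma weighted_primitive_grad_nonneg:
  assumes "0 < l" and \<phi>: "\<phi> \<in> lateral_test \<Omega>"
  shows "0 \<le> (LINT z|Q. space_grad \<phi> z \<bullet> space_grad (weighted_primitive l \<phi>) z)"
proof -
  define D where "D i = (\<lambda>z. frechet_derivative \<phi> (at z) (axis i 1, 0))" for i
  have D: "D i \<in> lateral_test \<Omega>" for i unfolding D_def by (rule space_deriv_test[OF \<phi>])
  have i: "integrable Q (\<lambda>z. D i z * weighted_primitive l (D i) z)" for i
    by (rule L2_mult_integrable[OF test_L2(1)[OF D] test_L2(1)[OF lateral_test_weighted_primitive[OF D]]])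
  have "space_grad \<phi> z \<bullet> space_grad (weighted_primitive l \<phi>) z = (\<Sum>i\<in>UNIV. D i z * weighted_primitive l (D i) z)" for z
    by (simp add: inner_vec_def space_grad_weighted_primitive[OF \<phi>] D_def) (simp add: space_grad_def)
  then have "(LINT z|Q. space_grad \<phi> z \<bullet> space_grad (weighted_primitive l \<phi>) z)
      = (\<Sum>i\<in>UNIV. LINT z|Q. D i z * weighted_primitive l (D i) z)"
    using i by simp
  also have "0 \<le> \<dots>"
    by (intro sum_nonneg weighted_primitive_nonneg[OF open_\<Omega> T \<open>0 < l\<close> D])
  finally show ?thesis .
qed

lemma weighted_primitive_grad_norm:
  assumes "0 < l" and \<phi>: "\<phi> \<in> lateral_test \<Omega>"
  shows "L2_norm Q (space_grad (weighted_primitive l \<phi>)) \<le> 2 * exp (l * T) / l * L2_norm Q (space_grad \<phi>)"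
proof -
  let ?c = "2 * exp (l * T) / l"
  define D where "D i = (\<lambda>z. frechet_derivative \<phi> (at z) (axis i 1, 0))" for i
  have D: "D i \<in> lateral_test \<Omega>" for i unfolding D_def by (rule space_deriv_test[OF \<phi>])
  have g1: "(\<lambda>z. space_grad (weighted_primitive l \<phi>) z $ i) = weighted_primitive l (D i)" for i
    by (rule ext) (simp add: space_grad_weighted_primitive[OF \<phi>] D_def)
  have g2: "(\<lambda>z. space_grad \<phi> z $ i) = D i" for i
    by (rule ext) (simp add: space_grad_def D_def)
  have "(L2_norm Q (space_grad (weighted_primitive l \<phi>)))\<^sup>2 = (\<Sum>i\<in>UNIV. (L2_norm Q (weighted_primitive l (D i)))\<^sup>2)"
    using L2_norm_vec[of "space_grad (weighted_primitive l \<phi>)" Q] test_L2(1)[OF lateral_test_weighted_primitive[OF D]]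
    unfolding g1 by blast
  also have "\<dots> \<le> (\<Sum>i\<in>UNIV. (?c * L2_norm Q (D i))\<^sup>2)"
    by (intro sum_mono power_mono weighted_primitive_L2_norm[OF open_\<Omega> T \<open>0 < l\<close> D] L2_norm_nonneg)
  also have "\<dots> = (?c * L2_norm Q (space_grad \<phi>))\<^sup>2"
    using L2_norm_vec[of "space_grad \<phi>" Q] test_L2(1)[OF D] unfolding g2
    by (simp only: power_mult_distrib sum_distrib_left)
  finally show ?thesis
    by (rule power2_le_imp_le) (use \<open>0 < l\<close> in \<open>simp add: L2_norm_nonneg\<close>)
qed

text \<open>The time derivative of the primitive contributes \<open>X\<close>, the weighted square
  of \<open>\<phi>\<close>; the diffusion term is nonnegative. The potential term is at least
  \<open>- (2 B / l) X\<close> by Young's inequality and \<open>weighted_primitive_bound\<close>,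
  and \<open>l\<close> is large enough for half of \<open>X\<close> to survive.\<close>

lemma weighted_primitive_coercive:
  assumes B: "0 \<le> B" "AE z in Q. \<bar>a0 z\<bar> \<le> B" and l: "l = 4 * (B + 1)" and \<phi>: "\<phi> \<in> lateral_test \<Omega>"
  shows "(L2_norm Q \<phi>)\<^sup>2 / 2 \<le> L2_inner Q (jet \<phi>) (dual_jet (weighted_primitive l \<phi>))"
proof -
  have l0: "0 < l" using B(1) l by simp
  define P where "P = weighted_primitive l \<phi>"
  have P: "P \<in> lateral_test \<Omega>" unfolding P_def by (rule lateral_test_weighted_primitive[OF \<phi>])
  define X Y where "X = (LINT z|Q. exp (l * snd z) * (\<phi> z)\<^sup>2)" and "Y = (LINT z|Q. exp (- l * snd z) * (P z)\<^sup>2)"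
  note L = lateral_test_exp[OF \<phi>, of l] lateral_test_exp[OF P, of "- l"]
  have iX: "integrable Q (\<lambda>z. exp (l * snd z) * (\<phi> z)\<^sup>2)"
    using L2_mult_integrable[OF test_L2(1)[OF L(1)] test_L2(1)[OF \<phi>]] by (simp add: power2_eq_square mult.assoc)
  have iY: "integrable Q (\<lambda>z. exp (- l * snd z) * (P z)\<^sup>2)"
    using L2_mult_integrable[OF test_L2(1)[OF L(2)] test_L2(1)[OF P]] by (simp add: power2_eq_square mult.assoc)
  have ia: "integrable Q (\<lambda>z. \<phi> z * (a0 z * P z))"
    by (rule L2_mult_integrable[OF test_L2(1)[OF \<phi>] a0_L2[OF test_L2(1)[OF P]]])
  have ig: "integrable Q (\<lambda>z. space_grad \<phi> z \<bullet> space_grad P z)"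
    by (rule L2_inner_integrable[OF test_L2(3)[OF \<phi>] test_L2(3)[OF P]])
  have e: "jet \<phi> z \<bullet> dual_jet P z
      = exp (l * snd z) * (\<phi> z)\<^sup>2 + \<phi> z * (a0 z * P z) + \<nu> * (space_grad \<phi> z \<bullet> space_grad P z)" for z
    unfolding P_def by (simp add: jet_def dual_jet_def time_deriv_weighted_primitive[OF \<phi>] power2_eq_square algebra_simps)
  have S: "L2_inner Q (jet \<phi>) (dual_jet P)
      = X + (LINT z|Q. \<phi> z * (a0 z * P z)) + \<nu> * (LINT z|Q. space_grad \<phi> z \<bullet> space_grad P z)"
    unfolding L2_inner_def e X_def using iX ia ig by simp
  have g: "0 \<le> \<nu> * (LINT z|Q. space_grad \<phi> z \<bullet> space_grad P z)"
    unfolding P_def using \<nu> weighted_primitive_grad_nonneg[OF l0 \<phi>] by simp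
  have "(LINT z|Q. - (B / l * (exp (l * snd z) * (\<phi> z)\<^sup>2) + B * (l / 4) * (exp (- l * snd z) * (P z)\<^sup>2)))
      \<le> (LINT z|Q. \<phi> z * (a0 z * P z))"
  proof (rule integral_mono_AE)
    show "integrable Q (\<lambda>z. - (B / l * (exp (l * snd z) * (\<phi> z)\<^sup>2) + B * (l / 4) * (exp (- l * snd z) * (P z)\<^sup>2)))"
      using iX iY by (intro Bochner_Integration.integrable_minus Bochner_Integration.integrable_add
          Bochner_Integration.integrable_mult_right)
    show "AE z in Q. - (B / l * (exp (l * snd z) * (\<phi> z)\<^sup>2) + B * (l / 4) * (exp (- l * snd z) * (P z)\<^sup>2))
        \<le> \<phi> z * (a0 z * P z)"
      using B(2)
    proof eventually_elim
      case (elim z)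
      have "\<bar>\<phi> z * (a0 z * P z)\<bar> = \<bar>a0 z\<bar> * \<bar>\<phi> z * P z\<bar>" by (simp add: abs_mult)
      also have "\<dots> \<le> B * ((1 / l) * (exp (l * snd z) * (\<phi> z)\<^sup>2) + (l / 4) * (inverse (exp (l * snd z)) * (P z)\<^sup>2))"
        by (intro mult_mono elim weighted_Young l0 exp_gt_zero B(1)) simp
      also have "\<dots> = B / l * (exp (l * snd z) * (\<phi> z)\<^sup>2) + B * (l / 4) * (exp (- l * snd z) * (P z)\<^sup>2)"
        by (simp add: exp_minus distrib_left)
      finally show ?case by linarith
    qed
  qed (rule ia)
  then have a: "- (B / l * X + B * (l / 4 * Y)) \<le> (LINT z|Q. \<phi> z * (a0 z * P z))"
    using iX iY by (simp add: X_def Y_def mult.assoc)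
  have "l / 4 * Y \<le> X / l"
    unfolding X_def Y_def P_def by (rule weighted_primitive_bound[OF open_\<Omega> T l0 \<phi>])
  then have "B * (l / 4 * Y) \<le> B * (X / l)" using B(1) by (rule mult_left_mono)
  moreover have "X \<ge> 0" unfolding X_def by (rule Bochner_Integration.integral_nonneg) simp
  \<comment> \<open>For \<open>l = 4 (B + 1)\<close> the quotient \<open>2 B / l\<close> is at most
    1/2.\<close>
  then have "2 * (B / l * X) \<le> X / 2"
    using l l0 B(1) mult_right_mono[of "2 * B / l" "1 / 2" X] by (simp add: field_simps)
  ultimately have "X / 2 \<le> L2_inner Q (jet \<phi>) (dual_jet P)"
    unfolding S using a g times_divide_eq_right[of B X l] times_divide_eq_left[of B l X] by linarith
  moreover have "(L2_norm Q \<phi>)\<^sup>2 \<le> X"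
    unfolding L2_norm_power2 X_def
  proof (rule integral_mono[OF L2_integrable_sq[OF test_L2(1)[OF \<phi>]] iX])
    fix z assume "z \<in> space Q"
    then have "1 \<le> exp (l * snd z)" using l0 space_Q[of z] by simp
    then show "(norm (\<phi> z))\<^sup>2 \<le> exp (l * snd z) * (\<phi> z)\<^sup>2"
      using mult_right_mono[of 1 "exp (l * snd z)" "(\<phi> z)\<^sup>2"] by simp
  qed
  ultimately show ?thesis unfolding P_def by simp
qed

text \<open>Controls the error made when the jet of an approximation replaces the solution. The
  gradient of the primitive occurs on the left, hence the full jet on the right.\<close>

lemma weighted_primitive_dual_jet_norm:
  assumes B: "0 \<le> B" "AE z in Q. \<bar>a0 z\<bar> \<le> B" and l0: "0 < l" and \<phi>: "\<phi> \<in> lateral_test \<Omega>"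
  defines "c \<equiv> 2 * exp (l * T) / l"
  shows "L2_norm Q (dual_jet (weighted_primitive l \<phi>)) \<le> (exp (l * T) + B * c + \<nu> * c) * L2_norm Q (jet \<phi>)"
proof -
  define P where "P = weighted_primitive l \<phi>"
  have P: "P \<in> lateral_test \<Omega>" unfolding P_def by (rule lateral_test_weighted_primitive[OF \<phi>])
  have c: "0 < c" using l0 by (simp add: c_def)
  have j: "L2_norm Q \<phi> \<le> L2_norm Q (jet \<phi>)" "L2_norm Q (space_grad \<phi>) \<le> L2_norm Q (jet \<phi>)"
    unfolding jet_def[abs_def]
    by (rule L2_norm_Pair_ge1[OF test_L2(1)[OF \<phi>] test_L2(3)[OF \<phi>]] L2_norm_Pair_ge2[OF test_L2(1)[OF \<phi>] test_L2(3)[OF \<phi>]])+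
  have "L2_norm Q (dual_jet P) \<le> L2_norm Q (\<lambda>z. time_deriv P z + a0 z * P z) + L2_norm Q (\<lambda>z. \<nu> *\<^sub>R space_grad P z)"
    unfolding dual_jet_def[abs_def]
    by (rule L2_norm_Pair_le[OF L2_add[OF test_L2(2)[OF P] a0_L2[OF test_L2(1)[OF P]]] L2_scaleR[OF test_L2(3)[OF P]]])
  also have "\<dots> \<le> (L2_norm Q (time_deriv P) + L2_norm Q (\<lambda>z. a0 z * P z)) + \<nu> * L2_norm Q (space_grad P)"
    using L2_norm_triangle[OF test_L2(2)[OF P] a0_L2[OF test_L2(1)[OF P]]] \<nu> by (simp add: L2_norm_scaleR)
  also have "L2_norm Q (time_deriv P) \<le> exp (l * T) * L2_norm Q \<phi>"
  proof -
    have "time_deriv P = (\<lambda>z. exp (l * snd z) * \<phi> z)"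
      by (rule ext) (simp add: P_def time_deriv_weighted_primitive[OF \<phi>])
    moreover have "L2_norm Q (\<lambda>z. exp (l * snd z) * \<phi> z) \<le> L2_norm Q (\<lambda>z. exp (l * T) *\<^sub>R \<phi> z)"
    proof (rule L2_norm_mono[OF test_L2(1)[OF lateral_test_exp[OF \<phi>]] L2_scaleR[OF test_L2(1)[OF \<phi>]]])
      show "AE z in Q. norm (exp (l * snd z) * \<phi> z) \<le> norm (exp (l * T) *\<^sub>R \<phi> z)"
        using AE_space
      proof eventually_elim
        case (elim z)
        then show ?case using space_Q[OF elim] l0 by (simp add: abs_mult mult_right_mono)
      qed
    qed
    ultimately show ?thesis by (simp only: L2_norm_scaleR abs_exp_cancel)
  qed
  also have "L2_norm Q (\<lambda>z. a0 z * P z) \<le> B * (c * L2_norm Q \<phi>)"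
  proof (rule order.trans[OF L2_mult_bounded(2)[OF test_L2(1)[OF P] a0_measurable B(2)]])
    show "B * L2_norm Q P \<le> B * (c * L2_norm Q \<phi>)"
      unfolding P_def c_def by (intro mult_left_mono weighted_primitive_L2_norm[OF open_\<Omega> T l0 \<phi>] B(1))
  qed
  also have "\<nu> * L2_norm Q (space_grad P) \<le> \<nu> * (c * L2_norm Q (space_grad \<phi>))"
    unfolding P_def c_def using \<nu> by (intro mult_left_mono weighted_primitive_grad_norm[OF l0 \<phi>]) simp
  also have "exp (l * T) * L2_norm Q \<phi> + B * (c * L2_norm Q \<phi>) + \<nu> * (c * L2_norm Q (space_grad \<phi>))
      \<le> exp (l * T) * L2_norm Q (jet \<phi>) + B * (c * L2_norm Q (jet \<phi>)) + \<nu> * (c * L2_norm Q (jet \<phi>))"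
    using j B(1) c \<nu> by (intro add_mono mult_left_mono) auto
  also have "\<dots> = (exp (l * T) + B * c + \<nu> * c) * L2_norm Q (jet \<phi>)"
    by (simp add: algebra_simps)
  finally show ?thesis by (simp add: P_def)
qed

text \<open>Testing with the weighted primitives of approximations of the solution itself gives
  uniqueness and continuous dependence without any regularity of the solution in time.\<close>

theorem weak_solution_bound:
  obtains C where "0 \<le> C"
    "\<And>q p. q \<in> L2 Q \<Longrightarrow> weak_solution \<Omega> T \<nu> a0 q p \<Longrightarrow> L2_norm Q p \<le> C * L2_norm Q q"
proof -
  obtain B where B: "0 \<le> B" "AE z in Q. \<bar>a0 z\<bar> \<le> B" by (rule a0_bound)
  define l where "l = 4 * (B + 1)"
  have l0: "0 < l" using B(1) by (simp add: l_def)
  define c where "c = 2 * exp (l * T) / l"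
  define D where "D = exp (l * T) + B * c + \<nu> * c"
  have c: "0 < c" using l0 by (simp add: c_def)
  have "L2_norm Q p \<le> 2 * c * L2_norm Q q" if q: "q \<in> L2 Q" and sol: "weak_solution \<Omega> T \<nu> a0 q p" for q p
  proof -
    obtain g where v: "(\<lambda>z. (p z, g z)) \<in> jet_closure"
      and weak: "\<And>\<phi>. \<phi> \<in> initial_test \<Longrightarrow> L2_inner Q (\<lambda>z. (p z, g z)) (dual_jet \<phi>) = L2_inner Q q \<phi>"
      using sol unfolding weak_solution_iff by blast
    define v where "v = (\<lambda>z. (p z, g z))"
    have vL: "v \<in> L2 Q" unfolding v_def by (rule jet_closure_L2[OF v])
    have pg: "p \<in> L2 Q" "g \<in> L2 Q"
      using L2_fst[OF vL] L2_snd[OF vL] by (simp_all add: v_def)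
    obtain \<phi> where \<phi>: "\<And>k::nat. \<phi> k \<in> lateral_test \<Omega>" and lim: "(\<lambda>k. L2_norm Q (\<lambda>z. jet (\<phi> k) z - v z)) \<longlonglongrightarrow> 0"
      using v unfolding jet_closure_def v_def by blast
    have "(\<lambda>k. L2_norm Q (\<lambda>z. \<phi> k z - p z)) \<longlonglongrightarrow> 0"
    proof (rule Lim_null_comparison[OF _ lim], rule always_eventually, rule allI)
      fix k
      show "norm (L2_norm Q (\<lambda>z. \<phi> k z - p z)) \<le> L2_norm Q (\<lambda>z. jet (\<phi> k) z - v z)"
        using L2_norm_Pair_ge1[OF L2_diff[OF test_L2(1)[OF \<phi>] pg(1)] L2_diff[OF test_L2(3)[OF \<phi>] pg(2)], of k k]
        by (simp add: L2_norm_nonneg jet_def v_def)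
    qed
    then have limp: "(\<lambda>k. L2_norm Q (\<phi> k)) \<longlonglongrightarrow> L2_norm Q p"
      by (rule L2_norm_tendsto[OF test_L2(1)[OF \<phi>] pg(1)])
    have limj: "(\<lambda>k. L2_norm Q (jet (\<phi> k))) \<longlonglongrightarrow> L2_norm Q v"
      by (rule L2_norm_tendsto[OF jet_L2[OF \<phi>] vL lim])
    \<comment> \<open>The weak identity holds for \<open>v\<close>, coercivity for jets. Exchanging
      one for the other leaves the first term, which vanishes in the limit because the norms of the
      jets stay bounded.\<close>
    have est: "(L2_norm Q (\<phi> k))\<^sup>2 / 2 \<le> L2_norm Q (\<lambda>z. jet (\<phi> k) z - v z) * (D * L2_norm Q (jet (\<phi> k)))
        + L2_norm Q q * (c * L2_norm Q (\<phi> k))" for k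
    proof -
      define P where "P = weighted_primitive l (\<phi> k)"
      have P: "P \<in> lateral_test \<Omega>" unfolding P_def by (rule lateral_test_weighted_primitive[OF \<phi>])
      then have Pi: "P \<in> initial_test" by (simp add: initial_test_def P_def weighted_primitive_0)
      have "(L2_norm Q (\<phi> k))\<^sup>2 / 2 \<le> L2_inner Q (jet (\<phi> k)) (dual_jet P)"
        unfolding P_def by (rule weighted_primitive_coercive[OF B l_def \<phi>])
      also have "\<dots> = L2_inner Q (\<lambda>z. jet (\<phi> k) z - v z) (dual_jet P) + L2_inner Q v (dual_jet P)"
        by (simp add: L2_inner_diff_left[OF jet_L2[OF \<phi>] vL dual_jet_L2[OF P]])
      also have "L2_inner Q v (dual_jet P) = L2_inner Q q P"
        unfolding v_def by (rule weak[OF Pi])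
      also have "L2_inner Q (\<lambda>z. jet (\<phi> k) z - v z) (dual_jet P)
          \<le> L2_norm Q (\<lambda>z. jet (\<phi> k) z - v z) * L2_norm Q (dual_jet P)"
        using L2_Cauchy_Schwarz[OF L2_diff[OF jet_L2[OF \<phi>] vL] dual_jet_L2[OF P]] by (rule abs_le_D1)
      also have "L2_norm Q (\<lambda>z. jet (\<phi> k) z - v z) * L2_norm Q (dual_jet P)
          \<le> L2_norm Q (\<lambda>z. jet (\<phi> k) z - v z) * (D * L2_norm Q (jet (\<phi> k)))"
        unfolding D_def c_def P_def
        by (intro mult_left_mono weighted_primitive_dual_jet_norm[OF B l0 \<phi>] L2_norm_nonneg)
      also have "L2_inner Q q P \<le> L2_norm Q q * L2_norm Q P"
        using L2_Cauchy_Schwarz[OF q test_L2(1)[OF P]] by (rule abs_le_D1)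
      also have "L2_norm Q q * L2_norm Q P \<le> L2_norm Q q * (c * L2_norm Q (\<phi> k))"
        unfolding c_def P_def
        by (intro mult_left_mono weighted_primitive_L2_norm[OF open_\<Omega> T l0 \<phi>] L2_norm_nonneg)
      finally show ?thesis by simp
    qed
    have "(L2_norm Q p)\<^sup>2 / 2 \<le> 0 * (D * L2_norm Q v) + L2_norm Q q * (c * L2_norm Q p)"
    proof (rule LIMSEQ_le)
      show "(\<lambda>k. (L2_norm Q (\<phi> k))\<^sup>2 / 2) \<longlonglongrightarrow> (L2_norm Q p)\<^sup>2 / 2"
        using limp by (intro tendsto_intros) simp_all
      show "(\<lambda>k. L2_norm Q (\<lambda>z. jet (\<phi> k) z - v z) * (D * L2_norm Q (jet (\<phi> k)))
          + L2_norm Q q * (c * L2_norm Q (\<phi> k))) \<longlonglongrightarrow> 0 * (D * L2_norm Q v) + L2_norm Q q * (c * L2_norm Q p)"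
        by (intro tendsto_intros lim limj limp)
    qed (use est in blast)
    then have *: "L2_norm Q p * L2_norm Q p \<le> (2 * c * L2_norm Q q) * L2_norm Q p"
      by (simp add: power2_eq_square mult_ac)
    show ?thesis
    proof (cases "L2_norm Q p = 0")
      case True
      then show ?thesis using c by (simp add: L2_norm_nonneg)
    next
      case False
      then have "0 < L2_norm Q p" using L2_norm_nonneg[of Q p] by simp
      with * show ?thesis by (simp only: mult_le_cancel_right_pos)
    qed
  qed
  then show thesis using c by (intro that[of "2 * c"]) auto
qed

end

section \<open>The dual cost functional\<close>

text \<open>The pointwise integrand of the first two terms of \<open>J\<close>. It is \<open>max {p u - \<gamma> u\<^sup>2 / 2 | a \<le> u \<le> b}\<close>,
  which makes it convex in \<open>p\<close>, and nonnegative because \<open>u = 0\<close> is allowed.\<close>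

definition truncated_quadratic :: "real \<Rightarrow> real \<Rightarrow> real \<Rightarrow> real \<Rightarrow> real" where
  "truncated_quadratic \<gamma> a b p = p * min b (max a (p / \<gamma>)) - \<gamma> / 2 * (min b (max a (p / \<gamma>)))\<^sup>2"

text \<open>Completing the square, \<open>p u - \<gamma> u^2 / 2\<close> is
  \<open>p^2 / (2 \<gamma>)\<close> minus \<open>\<gamma> / 2\<close> times the squared distance of
  \<open>u\<close> from \<open>p / \<gamma>\<close>, and truncation yields the point of
  \<open>[a, b]\<close> nearest to \<open>p / \<gamma>\<close>.\<close>

lemma truncated_quadratic_ge:
  assumes "0 < \<gamma>" "a \<le> u" "u \<le> b"
  shows "p * u - \<gamma> / 2 * u\<^sup>2 \<le> truncated_quadratic \<gamma> a b p"
proof -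
  define c where "c = min b (max a (p / \<gamma>))"
  have "\<bar>p / \<gamma> - c\<bar> \<le> \<bar>p / \<gamma> - u\<bar>"
    using assms by (auto simp: c_def min_def max_def abs_if)
  then have "(p / \<gamma> - c)\<^sup>2 \<le> (p / \<gamma> - u)\<^sup>2" by (simp add: abs_le_square_iff)
  then have "c\<^sup>2 - 2 * (p / \<gamma>) * c \<le> u\<^sup>2 - 2 * (p / \<gamma>) * u" by (simp add: power2_diff)
  then have "\<gamma> / 2 * (c\<^sup>2 - 2 * (p / \<gamma>) * c) \<le> \<gamma> / 2 * (u\<^sup>2 - 2 * (p / \<gamma>) * u)"
    using assms(1) by (intro mult_left_mono) auto
  moreover have "\<gamma> / 2 * (x\<^sup>2 - 2 * (p / \<gamma>) * x) = \<gamma> / 2 * x\<^sup>2 - p * x" for x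
    using assms(1) by (simp add: field_simps)
  ultimately show ?thesis unfolding truncated_quadratic_def c_def[symmetric] by simp
qed

context
  fixes \<gamma> a b :: real
  assumes \<gamma>: "0 < \<gamma>" and a: "a \<le> 0" and b: "0 \<le> b"
begin

lemma truncated_quadratic_nonneg: "0 \<le> truncated_quadratic \<gamma> a b p"
  using truncated_quadratic_ge[OF \<gamma> a b, of p] by simp

lemma truncation_bounds:
  "a \<le> min b (max a x)" "min b (max a x) \<le> b" "\<bar>min b (max a x)\<bar> \<le> \<bar>x\<bar>"
  using a b by (auto simp: min_def max_def)

text \<open>A maximum of affine functions of the state: the maximizer \<open>u\<close> at the
  midpoint competes at both end points.\<close>

lemma truncated_quadratic_midpoint:
  "truncated_quadratic \<gamma> a b ((1/2) * p + (1/2) * q) \<le> (truncated_quadratic \<gamma> a b p + truncated_quadratic \<gamma> a b q) / 2"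
proof -
  define u where "u = min b (max a (((1/2) * p + (1/2) * q) / \<gamma>))"
  have u: "a \<le> u" "u \<le> b" unfolding u_def by (rule truncation_bounds)+
  have "truncated_quadratic \<gamma> a b ((1/2) * p + (1/2) * q) = ((p * u - \<gamma> / 2 * u\<^sup>2) + (q * u - \<gamma> / 2 * u\<^sup>2)) / 2"
    unfolding truncated_quadratic_def u_def[symmetric] by (simp add: field_simps)
  also have "\<dots> \<le> (truncated_quadratic \<gamma> a b p + truncated_quadratic \<gamma> a b q) / 2"
    using truncated_quadratic_ge[OF \<gamma> u, of p] truncated_quadratic_ge[OF \<gamma> u, of q] by simp
  finally show ?thesis .
qed

text \<open>The maximizer at \<open>p\<close> competes at \<open>q\<close>. It is estimated by
  \<open>\<bar>p\<bar> / \<gamma>\<close> and not by a constant, because the cylinder may have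
  infinite measure: the product of two L2 functions is integrable, a constant times one need not
  be.\<close>

lemma truncated_quadratic_Lipschitz:
  "truncated_quadratic \<gamma> a b p - truncated_quadratic \<gamma> a b q \<le> \<bar>p - q\<bar> * \<bar>p\<bar> / \<gamma>"
proof -
  define u where "u = min b (max a (p / \<gamma>))"
  have u: "a \<le> u" "u \<le> b" "\<bar>u\<bar> \<le> \<bar>p / \<gamma>\<bar>" unfolding u_def by (rule truncation_bounds)+
  have "truncated_quadratic \<gamma> a b p - truncated_quadratic \<gamma> a b q \<le> (p - q) * u"
    using truncated_quadratic_ge[OF \<gamma> u(1,2), of q]
    unfolding truncated_quadratic_def[of \<gamma> a b p] u_def[symmetric] by (simp add: left_diff_distrib)
  also have "\<dots> \<le> \<bar>p - q\<bar> * \<bar>u\<bar>" by (metis abs_ge_self abs_mult)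
  also have "\<dots> \<le> \<bar>p - q\<bar> * \<bar>p / \<gamma>\<bar>" by (intro mult_left_mono u(3)) simp
  also have "\<dots> = \<bar>p - q\<bar> * \<bar>p\<bar> / \<gamma>" using \<gamma> by simp
  finally show ?thesis .
qed

lemma
  assumes "p \<in> L2 M"
  shows truncated_quadratic_integrable: "integrable M (\<lambda>z. truncated_quadratic \<gamma> a b (p z))"
    and truncated_quadratic_integral: "L2_inner M p (Pr_C a b (\<lambda>z. p z / \<gamma>)) - \<gamma> / 2 * (L2_norm M (Pr_C a b (\<lambda>z. p z / \<gamma>)))\<^sup>2
      = (LINT z|M. truncated_quadratic \<gamma> a b (p z))"
proof -
  define u where "u = Pr_C a b (\<lambda>z. p z / \<gamma>)"
  have "(\<lambda>z. p z / \<gamma>) \<in> L2 M"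
    using L2_scaleR[OF assms, of "1 / \<gamma>"] by simp
  then have u: "u \<in> L2 M"
    using Pr_C_admissible[OF a b, of "\<lambda>z. p z / \<gamma>" M] by (simp add: admissible_def u_def)
  have e: "truncated_quadratic \<gamma> a b (p z) = p z * u z - \<gamma> / 2 * (norm (u z))\<^sup>2" for z
    by (simp add: truncated_quadratic_def u_def Pr_C_def)
  have i: "integrable M (\<lambda>z. p z * u z)" "integrable M (\<lambda>z. \<gamma> / 2 * (norm (u z))\<^sup>2)"
    using L2_mult_integrable[OF assms u] L2_integrable_sq[OF u] by simp_all
  show "integrable M (\<lambda>z. truncated_quadratic \<gamma> a b (p z))"
    unfolding e using i by (rule Bochner_Integration.integrable_diff)
  show "L2_inner M p u - \<gamma> / 2 * (L2_norm M u)\<^sup>2 = (LINT z|M. truncated_quadratic \<gamma> a b (p z))"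
    unfolding e Bochner_Integration.integral_diff[OF i] L2_norm_power2 L2_inner_def by simp
qed

lemma truncated_quadratic_integral_diff:
  assumes p: "p \<in> L2 M" and q: "q \<in> L2 M"
  shows "(LINT z|M. truncated_quadratic \<gamma> a b (p z)) - (LINT z|M. truncated_quadratic \<gamma> a b (q z))
    \<le> L2_norm M (\<lambda>z. p z - q z) * L2_norm M p / \<gamma>"
proof -
  note i = truncated_quadratic_integrable[OF p] truncated_quadratic_integrable[OF q]
  have abs: "(\<lambda>z. \<bar>f z\<bar>) \<in> L2 M" "L2_norm M (\<lambda>z. \<bar>f z\<bar>) = L2_norm M f" if "f \<in> L2 M" for f :: "'a \<Rightarrow> real"
    using that by (auto simp: L2_def L2_norm_def)
  note d = L2_diff[OF p q]
  have "(LINT z|M. truncated_quadratic \<gamma> a b (p z)) - (LINT z|M. truncated_quadratic \<gamma> a b (q z))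
      = (LINT z|M. truncated_quadratic \<gamma> a b (p z) - truncated_quadratic \<gamma> a b (q z))"
    using i by simp
  also have "\<dots> \<le> (LINT z|M. \<bar>p z - q z\<bar> * \<bar>p z\<bar> / \<gamma>)"
    using i L2_mult_integrable[OF abs(1)[OF d] abs(1)[OF p]]
    by (intro integral_mono truncated_quadratic_Lipschitz) auto
  also have "\<dots> = L2_inner M (\<lambda>z. \<bar>p z - q z\<bar>) (\<lambda>z. \<bar>p z\<bar>) / \<gamma>"
    by (simp add: L2_inner_def)
  also have "\<dots> \<le> (L2_norm M (\<lambda>z. p z - q z) * L2_norm M p) / \<gamma>"
    using L2_Cauchy_Schwarz[OF abs(1)[OF d] abs(1)[OF p]] \<gamma> unfolding abs(2)[OF d] abs(2)[OF p]
    by (intro divide_right_mono) auto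
  finally show ?thesis .
qed

lemma truncated_quadratic_integral_continuous:
  assumes p: "\<And>n. p n \<in> L2 M" and q: "q \<in> L2 M" and lim: "(\<lambda>n. L2_norm M (\<lambda>z. p n z - q z)) \<longlonglongrightarrow> 0"
  shows "(\<lambda>n. LINT z|M. truncated_quadratic \<gamma> a b (p n z)) \<longlonglongrightarrow> (LINT z|M. truncated_quadratic \<gamma> a b (q z))"
proof (rule LIM_zero_cancel, rule Lim_null_comparison)
  show "\<forall>\<^sub>F n in sequentially. norm ((LINT z|M. truncated_quadratic \<gamma> a b (p n z)) - (LINT z|M. truncated_quadratic \<gamma> a b (q z)))
      \<le> L2_norm M (\<lambda>z. p n z - q z) * (L2_norm M (p n) + L2_norm M q) / \<gamma>"
  proof (intro always_eventually allI)
    fix n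
    let ?d = "L2_norm M (\<lambda>z. p n z - q z)"
    have "0 \<le> ?d * L2_norm M (p n) / \<gamma>" "0 \<le> ?d * L2_norm M q / \<gamma>"
      using \<gamma> by (simp_all add: L2_norm_nonneg)
    then show "norm ((LINT z|M. truncated_quadratic \<gamma> a b (p n z)) - (LINT z|M. truncated_quadratic \<gamma> a b (q z)))
      \<le> ?d * (L2_norm M (p n) + L2_norm M q) / \<gamma>"
      using truncated_quadratic_integral_diff[OF p q, of n] truncated_quadratic_integral_diff[OF q p, of n]
      unfolding L2_norm_minus_commute[of M q "p n"] by (simp add: distrib_left add_divide_distrib)
  qed
  have "(\<lambda>n. L2_norm M (\<lambda>z. p n z - q z) * (L2_norm M (p n) + L2_norm M q) / \<gamma>)
      \<longlonglongrightarrow> 0 * (L2_norm M q + L2_norm M q) / \<gamma>"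
    using \<gamma> by (intro tendsto_intros lim L2_norm_tendsto[OF p q lim]) simp
  then show "(\<lambda>n. L2_norm M (\<lambda>z. p n z - q z) * (L2_norm M (p n) + L2_norm M q) / \<gamma>) \<longlonglongrightarrow> 0"
    by simp
qed

end

section \<open>The map from data to adjoint states\<close>

context parabolic_problem
begin

lemma weak_solution_L2:
  assumes "weak_solution \<Omega> T \<nu> a0 q p"
  shows "p \<in> L2 Q"
proof -
  obtain g where "(\<lambda>z. (p z, g z)) \<in> jet_closure" using assms unfolding weak_solution_iff by blast
  then show ?thesis using L2_fst[OF jet_closure_L2] by fastforce
qed

lemma weak_solution_lincomb:
  assumes q: "q \<in> L2 Q" "q' \<in> L2 Q"
    and p: "weak_solution \<Omega> T \<nu> a0 q p" "weak_solution \<Omega> T \<nu> a0 q' p'"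
  shows "weak_solution \<Omega> T \<nu> a0 (\<lambda>z. s * q z + t * q' z) (\<lambda>z. s * p z + t * p' z)"
proof -
  obtain g where g: "(\<lambda>z. (p z, g z)) \<in> jet_closure"
      "\<And>\<phi>. \<phi> \<in> initial_test \<Longrightarrow> L2_inner Q (\<lambda>z. (p z, g z)) (dual_jet \<phi>) = L2_inner Q q \<phi>"
    using p(1) unfolding weak_solution_iff by blast
  obtain g' where g': "(\<lambda>z. (p' z, g' z)) \<in> jet_closure"
      "\<And>\<phi>. \<phi> \<in> initial_test \<Longrightarrow> L2_inner Q (\<lambda>z. (p' z, g' z)) (dual_jet \<phi>) = L2_inner Q q' \<phi>"
    using p(2) unfolding weak_solution_iff by blast
  have e: "(\<lambda>z. (s * p z + t * p' z, s *\<^sub>R g z + t *\<^sub>R g' z)) = (\<lambda>z. s *\<^sub>R (p z, g z) + t *\<^sub>R (p' z, g' z))"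
    by simp
  have "L2_inner Q (\<lambda>z. s *\<^sub>R (p z, g z) + t *\<^sub>R (p' z, g' z)) (dual_jet \<phi>) = L2_inner Q (\<lambda>z. s * q z + t * q' z) \<phi>"
    if \<phi>: "\<phi> \<in> initial_test" for \<phi>
  proof -
    note L = initial_test_lateral[OF \<phi>]
    have "L2_inner Q (dual_jet \<phi>) (\<lambda>z. s *\<^sub>R (p z, g z) + t *\<^sub>R (p' z, g' z))
        = s * L2_inner Q q \<phi> + t * L2_inner Q q' \<phi>"
      unfolding L2_inner_lincomb_right[OF jet_closure_L2[OF g(1)] jet_closure_L2[OF g'(1)] dual_jet_L2[OF L]]
      unfolding L2_inner_commute[of Q "dual_jet \<phi>"] g(2)[OF \<phi>] g'(2)[OF \<phi>] ..
    also have "\<dots> = L2_inner Q \<phi> (\<lambda>z. s *\<^sub>R q z + t *\<^sub>R q' z)"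
      unfolding L2_inner_lincomb_right[OF q test_L2(1)[OF L]] L2_inner_commute[of Q \<phi>] ..
    finally show ?thesis by (simp add: L2_inner_commute[of Q \<phi>] L2_inner_commute[of Q "dual_jet \<phi>"])
  qed
  then show ?thesis
    unfolding weak_solution_iff using jet_closure_lincomb[OF g(1) g'(1), of s t]
    by (intro exI[of _ "\<lambda>z. s *\<^sub>R g z + t *\<^sub>R g' z"]) (simp only: e, blast)
qed

abbreviation "state \<equiv> adjoint_state \<Omega> T \<nu> a0"

lemma weak_solution_state: "q \<in> L2 Q \<Longrightarrow> weak_solution \<Omega> T \<nu> a0 q (state q)"
  unfolding adjoint_state_def by (rule someI_ex[OF weak_solution_exists])

lemma state_L2: "q \<in> L2 Q \<Longrightarrow> state q \<in> L2 Q"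
  by (rule weak_solution_L2[OF weak_solution_state])

text \<open>The difference of two chosen states need not be the state chosen for
  \<open>q - q'\<close>, but it is a weak solution for these data, and the a priori bound holds for
  every weak solution.\<close>

lemma state_Lipschitz:
  obtains C where "\<And>q q'. q \<in> L2 Q \<Longrightarrow> q' \<in> L2 Q \<Longrightarrow>
    L2_norm Q (\<lambda>z. state q z - state q' z) \<le> C * L2_norm Q (\<lambda>z. q z - q' z)"
proof -
  obtain C where C: "\<And>q p. q \<in> L2 Q \<Longrightarrow> weak_solution \<Omega> T \<nu> a0 q p \<Longrightarrow> L2_norm Q p \<le> C * L2_norm Q q"
    by (rule weak_solution_bound) blast
  have "L2_norm Q (\<lambda>z. state q z - state q' z) \<le> C * L2_norm Q (\<lambda>z. q z - q' z)" if "q \<in> L2 Q" "q' \<in> L2 Q" for q q'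
    using C[OF L2_lincomb[OF that] weak_solution_lincomb[OF that that[THEN weak_solution_state]], of 1 "-1"] by simp
  then show thesis by (rule that)
qed

text \<open>The difference is a weak solution with data zero, so the a priori bound makes its norm
  vanish; this is as much linearity as the arbitrary choice of states allows.\<close>

lemma state_midpoint:
  assumes q: "q \<in> L2 Q" "q' \<in> L2 Q"
  shows "L2_norm Q (\<lambda>z. state (\<lambda>z. (1/2) * q z + (1/2) * q' z) z - ((1/2) * state q z + (1/2) * state q' z)) = 0"
proof -
  obtain C where C: "\<And>q p. q \<in> L2 Q \<Longrightarrow> weak_solution \<Omega> T \<nu> a0 q p \<Longrightarrow> L2_norm Q p \<le> C * L2_norm Q q"
    by (rule weak_solution_bound) blast
  define m where "m = (\<lambda>z. (1/2) * q z + (1/2) * q' z)"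
  define p where "p z = (1/2) * state q z + (1/2) * state q' z" for z
  have m: "m \<in> L2 Q" unfolding m_def by (rule L2_lincomb[OF q])
  have p: "weak_solution \<Omega> T \<nu> a0 m p"
    unfolding m_def p_def[abs_def] by (rule weak_solution_lincomb[OF q q[THEN weak_solution_state]])
  have "L2_norm Q (\<lambda>z. state m z - p z) \<le> C * L2_norm Q (\<lambda>z. 0::real)"
    using C[OF L2_lincomb[OF m m] weak_solution_lincomb[OF m m weak_solution_state[OF m] p], of 1 "-1"] by simp
  also have "\<dots> = 0" by (simp add: L2_norm_def)
  finally show ?thesis
    unfolding m_def[symmetric] p_def[symmetric] using L2_norm_nonneg by (rule antisym)
qed

section \<open>Strong convexity, continuity and minimization of the cost\<close>

context
  fixes \<O> :: "(real^'n) set" and \<gamma> a b :: real and y\<^sub>d :: "(real^'n) \<times> real \<Rightarrow> real"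
  assumes \<O>: "open \<O>" "\<O> \<subseteq> \<Omega>" and \<gamma>: "0 < \<gamma>" and ab: "a \<le> 0" "0 \<le> b" and y\<^sub>d: "y\<^sub>d \<in> L2 Q"
begin

abbreviation "QO \<equiv> lebesgue_on (cylinder \<O> T)"
abbreviation "J \<equiv> dual_cost \<Omega> \<O> T \<nu> \<gamma> a b a0 y\<^sub>d"

lemma
  assumes "f \<in> L2 Q"
  shows observed_L2: "f \<in> L2 QO" and observed_norm: "L2_norm QO f \<le> L2_norm Q f"
proof -
  have "cylinder \<O> T \<subseteq> cylinder \<Omega> T" using \<O>(2) by (auto simp: cylinder_def)
  note * = assms sets_lebesgue_cylinder[OF open_\<Omega>] sets_lebesgue_cylinder[OF \<O>(1)] this
  show "f \<in> L2 QO" by (rule L2_subset[OF *])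
  show "L2_norm QO f \<le> L2_norm Q f" by (rule L2_norm_subset[OF *])
qed

lemma dual_cost_eq:
  assumes "q \<in> L2 Q"
  shows "J q = (LINT z|QO. truncated_quadratic \<gamma> a b (state q z)) - L2_inner Q q y\<^sub>d + (L2_norm Q q)\<^sup>2 / 2"
  unfolding dual_cost_def Let_def truncated_quadratic_integral[OF \<gamma> ab observed_L2[OF state_L2[OF assms]]]
  by simp

text \<open>The whole gap comes from \<open>||q||^2 / 2\<close>: the parallelogram law loses a
  quarter of the squared distance, halved here. The truncated part is midpoint convex and the
  pairing with the target is linear.\<close>

lemma dual_cost_midpoint:
  assumes q: "q \<in> L2 Q" "q' \<in> L2 Q"
  shows "J (\<lambda>z. (1/2) * q z + (1/2) * q' z) \<le> (J q + J q') / 2 - 1/8 * (L2_norm Q (\<lambda>z. q z - q' z))\<^sup>2"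
proof -
  let ?H = "truncated_quadratic \<gamma> a b"
  define m where "m = (\<lambda>z. (1/2) * q z + (1/2) * q' z)"
  define p where "p z = (1/2) * state q z + (1/2) * state q' z" for z
  have m: "m \<in> L2 Q" unfolding m_def by (rule L2_lincomb[OF q])
  have p: "p \<in> L2 Q" unfolding p_def[abs_def] by (rule L2_lincomb[OF q[THEN state_L2]])
  note sO = observed_L2[OF state_L2[OF m]] observed_L2[OF p]
    observed_L2[OF state_L2[OF q(1)]] observed_L2[OF state_L2[OF q(2)]]
  note i = sO[THEN truncated_quadratic_integrable[OF \<gamma> ab]]
  have "L2_norm QO (\<lambda>z. state m z - p z) \<le> 0"
    using observed_norm[OF L2_diff[OF state_L2[OF m] p]] state_midpoint[OF q]
    unfolding m_def[symmetric] p_def[symmetric] by simp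
  then have "L2_norm QO (\<lambda>z. state m z - p z) = 0"
    using L2_norm_nonneg by (rule antisym)
  \<comment> \<open>The estimate of the difference of integrals has the vanishing norm as a factor,
    so no argument with null sets is needed.\<close>
  then have "(LINT z|QO. ?H (state m z)) \<le> (LINT z|QO. ?H (p z))"
    using truncated_quadratic_integral_diff[OF \<gamma> ab sO(1,2)] by simp
  also have "\<dots> \<le> (LINT z|QO. (?H (state q z) + ?H (state q' z)) / 2)"
    unfolding p_def using i
    by (intro integral_mono truncated_quadratic_midpoint[OF \<gamma> ab]) (simp_all add: p_def)
  also have "\<dots> = ((LINT z|QO. ?H (state q z)) + (LINT z|QO. ?H (state q' z))) / 2"
    using i by simp
  finally have 1: "(LINT z|QO. ?H (state m z)) \<le> ((LINT z|QO. ?H (state q z)) + (LINT z|QO. ?H (state q' z))) / 2" .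
  have 2: "L2_inner Q m y\<^sub>d = (L2_inner Q q y\<^sub>d + L2_inner Q q' y\<^sub>d) / 2"
    using L2_inner_lincomb_right[OF q y\<^sub>d, of "1/2" "1/2"]
    by (simp add: m_def L2_inner_commute[of Q y\<^sub>d])
  have 3: "(L2_norm Q m)\<^sup>2 = ((L2_norm Q q)\<^sup>2 + (L2_norm Q q')\<^sup>2) / 2 - (L2_norm Q (\<lambda>z. q z - q' z))\<^sup>2 / 4"
    using L2_norm_lincomb_power2[OF q, of "1/2" "1/2"] L2_norm_diff_power2[OF q]
    by (simp add: m_def power_divide) (simp add: field_simps)
  have alg: "F - (y + y') / 2 + ((A + B) / 2 - d / 4) / 2 \<le> ((F1 - y + A / 2) + (F2 - y' + B / 2)) / 2 - 1/8 * d"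
    if "F \<le> (F1 + F2) / 2" for F F1 F2 y y' A B d :: real
    using that by (simp add: field_simps)
  show ?thesis
    unfolding m_def[symmetric] dual_cost_eq[OF m] dual_cost_eq[OF q(1)] dual_cost_eq[OF q(2)] 2 3
    using 1 by (rule alg)
qed

text \<open>The truncated part is nonnegative; completing the square in the remaining terms gives
  \<open>||q - yd||^2 / 2\<close> minus the constant.\<close>

lemma dual_cost_bounded_below: "bdd_below (J ` L2 Q)"
proof (rule bdd_belowI2[where m="- ((L2_norm Q y\<^sub>d)\<^sup>2 / 2)"])
  fix q :: "(real^'n) \<times> real \<Rightarrow> real"
  assume q: "q \<in> L2 Q"
  have "0 \<le> (LINT z|QO. truncated_quadratic \<gamma> a b (state q z))"
    by (intro Bochner_Integration.integral_nonneg truncated_quadratic_nonneg[OF \<gamma> ab])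
  moreover have "0 \<le> (L2_norm Q (\<lambda>z. q z - y\<^sub>d z))\<^sup>2" by simp
  ultimately show "- ((L2_norm Q y\<^sub>d)\<^sup>2 / 2) \<le> J q"
    unfolding dual_cost_eq[OF q] L2_norm_diff_power2[OF q y\<^sub>d] by simp
qed

lemma dual_cost_continuous:
  assumes x: "\<And>n. x n \<in> L2 Q" and v: "v \<in> L2 Q" and lim: "(\<lambda>n. L2_norm Q (\<lambda>z. x n z - v z)) \<longlonglongrightarrow> 0"
  shows "(\<lambda>n. J (x n)) \<longlonglongrightarrow> J v"
proof -
  obtain C where C: "\<And>q q'. q \<in> L2 Q \<Longrightarrow> q' \<in> L2 Q \<Longrightarrow>
      L2_norm Q (\<lambda>z. state q z - state q' z) \<le> C * L2_norm Q (\<lambda>z. q z - q' z)"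
    by (rule state_Lipschitz) blast
  have "(\<lambda>n. L2_norm QO (\<lambda>z. state (x n) z - state v z)) \<longlonglongrightarrow> 0"
  proof (rule Lim_null_comparison[OF _ tendsto_mult_right_zero[OF lim]], rule always_eventually, rule allI)
    fix n
    show "norm (L2_norm QO (\<lambda>z. state (x n) z - state v z)) \<le> C * L2_norm Q (\<lambda>z. x n z - v z)"
      using observed_norm[OF L2_diff[OF state_L2[OF x] state_L2[OF v]], of n] C[OF x v, of n]
      by (simp add: L2_norm_nonneg)
  qed
  note 1 = truncated_quadratic_integral_continuous[OF \<gamma> ab observed_L2[OF state_L2[OF x]] observed_L2[OF state_L2[OF v]] this]
  show ?thesis
    unfolding dual_cost_eq[OF x] dual_cost_eq[OF v]
    by (intro tendsto_intros 1 L2_inner_tendsto[OF x v y\<^sub>d lim] L2_norm_tendsto[OF x v lim]) simp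
qed

theorem dual_cost_minimizer:
  "\<exists>qbar\<in>L2 Q. (\<forall>q\<in>L2 Q. J qbar \<le> J q) \<and>
     (\<forall>q'\<in>L2 Q. (\<forall>q\<in>L2 Q. J q' \<le> J q) \<longrightarrow> (AE z in Q. q' z = qbar z))"
proof -
  have mid: "\<exists>m\<in>L2 Q. J m \<le> (J q + J q') / 2 - 1/8 * (L2_norm Q (\<lambda>z. q z - q' z))\<^sup>2"
    if "q \<in> L2 Q" "q' \<in> L2 Q" for q q'
    by (rule bexI, rule dual_cost_midpoint[OF that], rule L2_lincomb[OF that])
  obtain x v where x: "\<And>n::nat. x n \<in> L2 Q" and inf: "(\<lambda>n. J (x n)) \<longlonglongrightarrow> (INF q\<in>L2 Q. J q)"
    and v: "v \<in> L2 Q" and lim: "(\<lambda>n. L2_norm Q (\<lambda>z. x n z - v z)) \<longlonglongrightarrow> 0"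
  proof (rule L2_minimizing_sequence[where w="\<lambda>q. q" and J=J and X="L2 Q" and c="1/8" and M=Q])
    show "bdd_below (J ` L2 Q)" by (rule dual_cost_bounded_below)
    show "\<exists>m\<in>L2 Q. J m \<le> (J q + J q') / 2 - 1/8 * (L2_norm Q (\<lambda>z. q z - q' z))\<^sup>2"
      if "q \<in> L2 Q" "q' \<in> L2 Q" for q q'
      using that by (rule mid)
    show "(L2 Q :: ((real^'n) \<times> real \<Rightarrow> real) set) \<noteq> {}" using y\<^sub>d by blast
  next
    fix x v
    assume "\<And>n::nat. x n \<in> L2 Q" "(\<lambda>n. J (x n)) \<longlonglongrightarrow> (INF q\<in>L2 Q. J q)"
      "v \<in> L2 Q" "(\<lambda>n. L2_norm Q (\<lambda>z. x n z - v z)) \<longlonglongrightarrow> 0"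
    then show thesis by (rule that)
  qed simp_all
  have Jv: "J v = (INF q\<in>L2 Q. J q)"
    by (rule LIMSEQ_unique[OF dual_cost_continuous[OF x v lim] inf])
  have min: "J v \<le> J q" if "q \<in> L2 Q" for q
    unfolding Jv by (rule cINF_lower[OF dual_cost_bounded_below that])
  have uniq: "AE z in Q. q' z = v z" if q': "q' \<in> L2 Q" "\<forall>q\<in>L2 Q. J q' \<le> J q" for q'
  proof -
    obtain m where m: "m \<in> L2 Q" "J m \<le> (J q' + J v) / 2 - 1/8 * (L2_norm Q (\<lambda>z. q' z - v z))\<^sup>2"
      using mid[OF q'(1) v] by (rule bexE)
    \<comment> \<open>Both functions minimize, so the value at the midpoint cannot be lower, which
      leaves no room for the gap term.\<close>
    have "J v \<le> J m" "J q' \<le> J v"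
      using min[OF m(1)] bspec[OF q'(2) v] by simp_all
    then have "(L2_norm Q (\<lambda>z. q' z - v z))\<^sup>2 \<le> 0"
      using m(2) by argo
    then have "L2_norm Q (\<lambda>z. q' z - v z) = 0" by simp
    from L2_norm_eq_0_AE[OF L2_diff[OF q'(1) v] this] show ?thesis by simp
  qed
  show ?thesis
  proof (intro bexI[OF _ v] conjI ballI impI)
    show "J v \<le> J q" if "q \<in> L2 Q" for q using that by (rule min)
    show "AE z in Q. q' z = v z" if "q' \<in> L2 Q" "\<forall>q\<in>L2 Q. J q' \<le> J q" for q'
      using that by (rule uniq)
  qed
qed

end

end

theorem theorem2p3:
  fixes \<Omega> \<O> :: "(real^'n) set"
    and T \<nu> \<gamma> a b :: real
    and a0 y\<^sub>d :: "(real^'n) \<times> real \<Rightarrow> real"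
  assumes "open \<Omega>" and "connected \<Omega>" and "\<Omega> \<noteq> {}"
    and "piecewise_continuous_boundary \<Omega>"
    and "0 < T"
    and "open \<O>" and "\<O> \<subseteq> \<Omega>"
    and "\<nu> > 0" and "\<gamma> > 0"
    and "a0 \<in> Linfty (lebesgue_on (cylinder \<Omega> T))"
    and "AE z in lebesgue_on (cylinder \<Omega> T). 0 \<le> a0 z"
    and "y\<^sub>d \<in> L2 (lebesgue_on (cylinder \<Omega> T))"
    and "a \<le> 0" and "0 \<le> b"
  shows "\<exists>qbar \<in> L2 (lebesgue_on (cylinder \<Omega> T)).
           (\<forall>q \<in> L2 (lebesgue_on (cylinder \<Omega> T)).
              dual_cost \<Omega> \<O> T \<nu> \<gamma> a b a0 y\<^sub>d qbar \<le> dual_cost \<Omega> \<O> T \<nu> \<gamma> a b a0 y\<^sub>d q) \<and>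
           (\<forall>q' \<in> L2 (lebesgue_on (cylinder \<Omega> T)).
              (\<forall>q \<in> L2 (lebesgue_on (cylinder \<Omega> T)).
                 dual_cost \<Omega> \<O> T \<nu> \<gamma> a b a0 y\<^sub>d q' \<le> dual_cost \<Omega> \<O> T \<nu> \<gamma> a b a0 y\<^sub>d q) \<longrightarrow>
              (AE z in lebesgue_on (cylinder \<Omega> T). q' z = qbar z))"
proof -
  interpret parabolic_problem \<Omega> T \<nu> a0
    using assms(1,5,8,10,11) by unfold_locales
  show ?thesis
    by (rule dual_cost_minimizer[OF assms(6,7,9,13,14,12)])
qed

end
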